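(* Let $\Gamma$ be a finitely presented residually finite group. Then $$d\left( \widehat{\Gamma }\right) \geq b_{1}^{(2)}(\Gamma )+1,$$ where $b_{1}^{(2)}(\Gamma )$ denotes the first $L_{2}$-Betti number of $\Gamma$.
   Context: For a group $\Gamma$, $\widehat{\Gamma}$ denotes its profinite completion. For a profinite group $P$, $d(P)$ denotes the minimal number of topological generators of $P$, i.e. the smallest cardinality of a subset generating a dense subgroup of $P$.
   Formalization: The group Γ is additionally assumed to be nontrivial: for the trivial group the minimal number of topological generators and the first L2-Betti number are both 0, so the stated inequality would read 0 ≥ 1 and fails. *)

theory Defs
  imports
    "HOL-Analysis.Analysis"
    "HOL-Algebra.Generated_Groups"
    "HOL-Algebra.Product_Groups"
begin

section \<open>Finite presentations\<close>

text \<open>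
  A letter \<open>(i, True)\<close> stands for the \<open>i\<close>-th generator and \<open>(i, False)\<close> for its inverse.
\<close>

type_synonym letter = "nat \<times> bool"

definition words :: "nat \<Rightarrow> letter list set" where
  "words n = lists ({..<n} \<times> UNIV)"

definition letter_value :: "('a, 'b) monoid_scheme \<Rightarrow> (nat \<Rightarrow> 'a) \<Rightarrow> letter \<Rightarrow> 'a" where
  "letter_value G g l = (if snd l then g (fst l) else inv\<^bsub>G\<^esub> (g (fst l)))"

definition word_value :: "('a, 'b) monoid_scheme \<Rightarrow> (nat \<Rightarrow> 'a) \<Rightarrow> letter list \<Rightarrow> 'a" where
  "word_value G g w = foldr (\<lambda>l y. letter_value G g l \<otimes>\<^bsub>G\<^esub> y) w \<one>\<^bsub>G\<^esub>"

text \<open>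
  The congruence on words whose classes are the elements of the group with generators
  \<open>0, \<dots>, n - 1\<close> and set of relators \<open>R\<close>.
\<close>

inductive presented_eq :: "nat \<Rightarrow> letter list set \<Rightarrow> letter list \<Rightarrow> letter list \<Rightarrow> bool"
  for n :: nat and R :: "letter list set" where
  refl: "w \<in> words n \<Longrightarrow> presented_eq n R w w"
| sym: "presented_eq n R v w \<Longrightarrow> presented_eq n R w v"
| trans: "presented_eq n R u v \<Longrightarrow> presented_eq n R v w \<Longrightarrow> presented_eq n R u w"
| cancel: "u \<in> words n \<Longrightarrow> v \<in> words n \<Longrightarrow> i < n \<Longrightarrow>
    presented_eq n R (u @ [(i, b), (i, \<not> b)] @ v) (u @ v)"
| relator: "u \<in> words n \<Longrightarrow> v \<in> words n \<Longrightarrow> r \<in> R \<Longrightarrow> presented_eq n R (u @ r @ v) (u @ v)"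

text \<open>
  The map \<open>i \<mapsto> g i\<close> induces an isomorphism from the group presented by the generators
  \<open>0, \<dots>, n - 1\<close> and the relators \<open>rs\<close> onto \<open>G\<close>. The \<open>g i\<close> need not be distinct.
\<close>

definition finite_presentation ::
    "('a, 'b) monoid_scheme \<Rightarrow> nat \<Rightarrow> (nat \<Rightarrow> 'a) \<Rightarrow> letter list list \<Rightarrow> bool" where
  "finite_presentation G n g rs \<longleftrightarrow>
     g ` {..<n} \<subseteq> carrier G \<and> set rs \<subseteq> words n \<and>
     word_value G g ` words n = carrier G \<and>
     (\<forall>v\<in>words n. \<forall>w\<in>words n.
        word_value G g v = word_value G g w \<longleftrightarrow> presented_eq n (set rs) v w)"

definition finitely_presented :: "('a, 'b) monoid_scheme \<Rightarrow> bool" where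
  "finitely_presented G \<longleftrightarrow> (\<exists>n g rs. finite_presentation G n g rs)"


section \<open>Residual finiteness and profinite completion\<close>

definition finite_index_normal :: "('a, 'b) monoid_scheme \<Rightarrow> 'a set set" where
  "finite_index_normal G = {N. N \<lhd> G \<and> finite (carrier (G Mod N))}"

definition residually_finite :: "('a, 'b) monoid_scheme \<Rightarrow> bool" where
  "residually_finite G \<longleftrightarrow>
     (\<forall>x\<in>carrier G. x \<noteq> \<one>\<^bsub>G\<^esub> \<longrightarrow> (\<exists>N\<in>finite_index_normal G. x \<notin> N))"

text \<open>
  The inverse limit of the finite quotients. For \<open>N \<subseteq> M\<close> the canonical map
  \<open>G Mod N \<rightarrow> G Mod M\<close> sends the coset \<open>C\<close> to \<open>M <#> C\<close>.
\<close>

definition profinite_completion :: "('a, 'b) monoid_scheme \<Rightarrow> ('a set \<Rightarrow> 'a set) monoid" where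
  "profinite_completion G =
     (product_group (finite_index_normal G) (\<lambda>N. G Mod N))
       \<lparr>carrier := {x \<in> \<Pi>\<^sub>E N\<in>finite_index_normal G. carrier (G Mod N).
          \<forall>N\<in>finite_index_normal G. \<forall>M\<in>finite_index_normal G.
            N \<subseteq> M \<longrightarrow> x M = M <#>\<^bsub>G\<^esub> x N}\<rparr>"

definition profinite_topology :: "('a, 'b) monoid_scheme \<Rightarrow> ('a set \<Rightarrow> 'a set) topology" where
  "profinite_topology G =
     subtopology
       (product_topology (\<lambda>N. discrete_topology (carrier (G Mod N))) (finite_index_normal G))
       (carrier (profinite_completion G))"

text \<open>
  The minimal number of topological generators. All infinite cardinalities are identified
  with \<open>\<infinity>\<close>, which is the infimum of the empty set.
\<close>

definition min_top_generators :: "('a, 'b) monoid_scheme \<Rightarrow> 'a topology \<Rightarrow> enat" where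
  "min_top_generators P T =
     Inf {enat (card S) | S. finite S \<and> S \<subseteq> carrier P \<and>
                             T closure_of (generate P S) = carrier P}"


section \<open>Square-summable functions and von Neumann dimension\<close>

definition l2 :: "'i set \<Rightarrow> ('i \<Rightarrow> complex) set" where
  "l2 A = {f. (\<forall>x. x \<notin> A \<longrightarrow> f x = 0) \<and> (\<lambda>x. (cmod (f x))\<^sup>2) summable_on A}"

definition l2_inner :: "'i set \<Rightarrow> ('i \<Rightarrow> complex) \<Rightarrow> ('i \<Rightarrow> complex) \<Rightarrow> complex" where
  "l2_inner A f h = (\<Sum>\<^sub>\<infinity>x\<in>A. f x * cnj (h x))"

text \<open>Orthogonal projection to a closed subspace \<open>V\<close> of \<open>l2 A\<close>.\<close>

definition l2_proj ::
    "'i set \<Rightarrow> ('i \<Rightarrow> complex) set \<Rightarrow> ('i \<Rightarrow> complex) \<Rightarrow> ('i \<Rightarrow> complex)" where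
  "l2_proj A V f = (THE p. p \<in> V \<and> (\<forall>v\<in>V. l2_inner A (\<lambda>x. f x - p x) v = 0))"

text \<open>
  The von Neumann dimension, i.e. the trace of the orthogonal projection, of a closed
  subspace of the direct sum of \<open>n\<close> copies of \<open>l2 (carrier G)\<close> that is invariant under
  left translation by \<open>G\<close>.
\<close>

definition vn_dim :: "('a, 'b) monoid_scheme \<Rightarrow> nat \<Rightarrow> (nat \<times> 'a \<Rightarrow> complex) set \<Rightarrow> real" where
  "vn_dim G n V =
     (\<Sum>i<n. let A = {..<n} \<times> carrier G; e = (\<lambda>c. of_bool (c = (i, \<one>\<^bsub>G\<^esub>)))
             in Re (l2_inner A (l2_proj A V e) e))"


section \<open>The first L2-Betti number\<close>

text \<open>
  The universal cover of the presentation complex has the elements of \<open>G\<close> as vertices, an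
  oriented edge \<open>(i, x)\<close> from \<open>x\<close> to \<open>x \<otimes> g i\<close> for all \<open>i < n\<close>, and a \<open>2\<close>-cell \<open>(j, x)\<close>
  attached along the loop at \<open>x\<close> that reads \<open>rs ! j\<close>, for all \<open>j < length rs\<close>. The group acts
  by left multiplication, freely on cells. The following functions give the coefficients of
  the cellular boundaries: of an edge at a vertex, of a path at an edge, and of a \<open>2\<close>-cell at
  an edge.
\<close>

definition edge_boundary ::
    "('a, 'b) monoid_scheme \<Rightarrow> (nat \<Rightarrow> 'a) \<Rightarrow> nat \<times> 'a \<Rightarrow> 'a \<Rightarrow> int" where
  "edge_boundary G g c v =
     of_bool (v = snd c \<otimes>\<^bsub>G\<^esub> g (fst c)) - of_bool (v = snd c)"

fun path_chain ::
    "('a, 'b) monoid_scheme \<Rightarrow> (nat \<Rightarrow> 'a) \<Rightarrow> 'a \<Rightarrow> letter list \<Rightarrow> nat \<times> 'a \<Rightarrow> int" where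
  "path_chain G g x [] e = 0"
| "path_chain G g x ((i, True) # w) e =
     of_bool (e = (i, x)) + path_chain G g (x \<otimes>\<^bsub>G\<^esub> g i) w e"
| "path_chain G g x ((i, False) # w) e =
     - of_bool (e = (i, x \<otimes>\<^bsub>G\<^esub> inv\<^bsub>G\<^esub> (g i))) +
     path_chain G g (x \<otimes>\<^bsub>G\<^esub> inv\<^bsub>G\<^esub> (g i)) w e"

definition face_boundary ::
    "('a, 'b) monoid_scheme \<Rightarrow> (nat \<Rightarrow> 'a) \<Rightarrow> letter list list \<Rightarrow> nat \<times> 'a \<Rightarrow> nat \<times> 'a \<Rightarrow> int"
  where "face_boundary G g rs c e = path_chain G g (snd c) (rs ! fst c) e"

text \<open>
  The extension of a cellular boundary with coefficients \<open>bd\<close> to \<open>l2 C\<close>. In both uses below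
  every \<open>e\<close> has only finitely many \<open>c\<close> with \<open>bd c e \<noteq> 0\<close>.
\<close>

definition l2_boundary :: "'c set \<Rightarrow> ('c \<Rightarrow> 'e \<Rightarrow> int) \<Rightarrow> ('c \<Rightarrow> complex) \<Rightarrow> 'e \<Rightarrow> complex" where
  "l2_boundary C bd f e = (\<Sum>\<^sub>\<infinity>c\<in>C. of_int (bd c e) * f c)"

text \<open>
  Reduced first L2-homology, the quotient of the kernel of the first boundary map by the
  closure of the image of the second. The Hilbert space quotient is realised as the
  orthogonal complement of the image within the kernel.
\<close>

definition l2_homology1 ::
    "('a, 'b) monoid_scheme \<Rightarrow> nat \<Rightarrow> (nat \<Rightarrow> 'a) \<Rightarrow> letter list list \<Rightarrow> (nat \<times> 'a \<Rightarrow> complex) set"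
  where
  "l2_homology1 G n g rs =
     (let E = {..<n} \<times> carrier G; F = {..<length rs} \<times> carrier G
      in {f \<in> l2 E.
            (\<forall>v\<in>carrier G. l2_boundary E (edge_boundary G g) f v = 0) \<and>
            (\<forall>h\<in>l2 F. l2_inner E f (l2_boundary F (face_boundary G g rs) h) = 0)})"

text \<open>
  The dimension is the same for all finite presentations of \<open>G\<close>, by homotopy invariance
  of L2-Betti numbers; the definition makes no use of this and chooses a presentation.
\<close>

definition first_l2_betti :: "('a, 'b) monoid_scheme \<Rightarrow> real" where
  "first_l2_betti G =
     (SOME b. \<exists>n g rs. finite_presentation G n g rs \<and> b = vn_dim G n (l2_homology1 G n g rs))"

end

theory Submission
  imports Defs "Jordan_Normal_Form.Schur_Decomposition" "HOL-Real_Asymp.Real_Asymp"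
begin

text \<open>
  This is Lueck's approximation argument, in the direction that needs integrality.
  Let \<open>\<Delta>\<close> be the Laplacian on \<open>1\<close>-chains of the universal cover and \<open>T = 1 - \<Delta>/K\<close>. Since \<open>T\<close> fixes
  harmonic chains, the first \<open>L\<^sup>2\<close>-Betti number is at most the trace of \<open>T\<^sup>2\<^sup>m\<close>, and by residual
  finiteness this trace equals the normalised trace of the corresponding operator \<open>T\<^sub>Q\<^sup>2\<^sup>m\<close> for a
  large finite quotient \<open>Q\<close>. There the Laplacian is an integer matrix, so its nonzero eigenvalues
  have product at least \<open>1\<close> and few of them are close to \<open>0\<close>. Hence the normalised trace exceeds
  \<open>r / |Q|\<close> by an amount tending to \<open>0\<close> as \<open>m\<close> grows, uniformly in \<open>Q\<close>, where \<open>r\<close> is the nullity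
  of the Laplacian.

  If \<open>d\<close> elements generate the profinite completion topologically, then there are at most
  \<open>k\<close> to the power \<open>d |Q|\<close> cocycles on \<open>Q\<close> with values in \<open>\<int>/k\<close>, because such a cocycle is a
  derivation that factors through a finite quotient of the group. Integral harmonic chains and
  coboundaries produce at least a constant times \<open>k\<close> to the power \<open>r + |Q| - 1\<close> of them, so \<open>r \<le> (d - 1) |Q| + 1\<close>.
\<close>

text \<open>On the infinite group no spectral calculus is used: for a basis vector \<open>e\<close>,
  the chains \<open>T^m e\<close> and \<open>e\<close> have the same projection to the harmonic
  chains, so Cauchy-Schwarz bounds a diagonal entry of the projection by the squared norm of
  \<open>T^m e\<close>; this is why the exponents are even. One constant \<open>K\<close> serves for
  all quotients because it is computed from the words of the presentation. The count has to be made
  modulo an integer. Topological generators control only finite quotients of the group, and a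
  derivation with values in a finite module factors through one, whereas an integral one need not.
  The rank comes back by letting the modulus \<open>B L\<close> grow with \<open>B\<close> fixed and
  comparing exponents of \<open>L\<close>. After division by \<open>|Q|\<close> the bound reads
  \<open>d - 1 + 1 / |Q|\<close>, so quotients of unbounded order are wanted. For a finite group the
  Betti number is 0, and what remains is \<open>d >= 1\<close>; this fails for the trivial group,
  which is why that group is excluded.\<close>

unbundle no vec_syntax

section \<open>Square-summable functions\<close>

text \<open>In contrast to \<open>l2\<close>, values outside \<open>A\<close> are unconstrained:
  translates and path integrals of a chain are under control only on the carrier.\<close>

definition sq_summable :: "'i set \<Rightarrow> ('i \<Rightarrow> complex) \<Rightarrow> bool" where
  "sq_summable A f \<longleftrightarrow> (\<lambda>x. (cmod (f x))\<^sup>2) summable_on A"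

definition nrm2 :: "'i set \<Rightarrow> ('i \<Rightarrow> complex) \<Rightarrow> real" where
  "nrm2 A f = (\<Sum>\<^sub>\<infinity>x\<in>A. (cmod (f x))\<^sup>2)"

lemma l2_iff: "f \<in> l2 A \<longleftrightarrow> (\<forall>x. x \<notin> A \<longrightarrow> f x = 0) \<and> sq_summable A f"
  by (auto simp: l2_def sq_summable_def)

lemma nrm2_nonneg: "nrm2 A f \<ge> 0"
  unfolding nrm2_def by (intro infsum_nonneg) auto

lemma cmod_add_sq_le: "(cmod (a + b))\<^sup>2 \<le> 2 * (cmod a)\<^sup>2 + 2 * (cmod b)\<^sup>2"
proof -
  have "(cmod (a + b))\<^sup>2 \<le> (cmod a + cmod b)\<^sup>2"
    by (intro power_mono norm_triangle_ineq) auto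
  also have "\<dots> \<le> 2 * (cmod a)\<^sup>2 + 2 * (cmod b)\<^sup>2"
    using sum_squares_bound[of "cmod a" "cmod b"] by (simp add: power2_sum)
  finally show ?thesis .
qed

lemma sq_summable_bound:
  assumes "\<And>F. finite F \<Longrightarrow> F \<subseteq> A \<Longrightarrow> (\<Sum>x\<in>F. (cmod (f x))\<^sup>2) \<le> C"
  shows "sq_summable A f" "nrm2 A f \<le> C"
proof -
  have "(\<lambda>x. (cmod (f x))\<^sup>2) summable_on A"
    using assms by (intro nonneg_bdd_above_summable_on) (auto intro!: bdd_aboveI[of _ C])
  then show "sq_summable A f" by (simp add: sq_summable_def)
  then show "nrm2 A f \<le> C" unfolding nrm2_def sq_summable_def
    by (intro infsum_le_finite_sums assms)
qed

lemma sum_le_nrm2: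
  assumes "sq_summable A f" "finite F" "F \<subseteq> A"
  shows "(\<Sum>x\<in>F. (cmod (f x))\<^sup>2) \<le> nrm2 A f"
  using assms unfolding nrm2_def sq_summable_def by (intro finite_sum_le_infsum) auto

text \<open>The factor 2 in place of Minkowski's inequality only worsens constants; what matters
  later is a norm bound that depends on the words alone.\<close>

lemma sq_summable_add:
  assumes "sq_summable A f" "sq_summable A h"
  shows "sq_summable A (\<lambda>x. f x + h x)" "nrm2 A (\<lambda>x. f x + h x) \<le> 2 * nrm2 A f + 2 * nrm2 A h"
proof -
  have "(\<Sum>x\<in>F. (cmod (f x + h x))\<^sup>2) \<le> 2 * nrm2 A f + 2 * nrm2 A h" if "finite F" "F \<subseteq> A" for F
  proof -
    have "(\<Sum>x\<in>F. (cmod (f x + h x))\<^sup>2) \<le> (\<Sum>x\<in>F. 2 * (cmod (f x))\<^sup>2 + 2 * (cmod (h x))\<^sup>2)"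
      by (intro sum_mono cmod_add_sq_le)
    also have "\<dots> = 2 * (\<Sum>x\<in>F. (cmod (f x))\<^sup>2) + 2 * (\<Sum>x\<in>F. (cmod (h x))\<^sup>2)"
      by (simp add: sum.distrib sum_distrib_left)
    also have "\<dots> \<le> 2 * nrm2 A f + 2 * nrm2 A h"
      using sum_le_nrm2[OF assms(1) that] sum_le_nrm2[OF assms(2) that] by linarith
    finally show ?thesis .
  qed
  from sq_summable_bound[OF this]
  show "sq_summable A (\<lambda>x. f x + h x)" "nrm2 A (\<lambda>x. f x + h x) \<le> 2 * nrm2 A f + 2 * nrm2 A h"
    by auto
qed

lemma nrm2_cmult: "nrm2 A (\<lambda>x. c * f x) = (cmod c)\<^sup>2 * nrm2 A f"
  by (simp add: nrm2_def norm_mult power_mult_distrib infsum_cmult_right')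

lemma sq_summable_cmult: "sq_summable A f \<Longrightarrow> sq_summable A (\<lambda>x. c * f x)"
  unfolding sq_summable_def norm_mult power_mult_distrib by (intro summable_on_cmult_right)

lemma sq_summable_uminus: "sq_summable A f \<Longrightarrow> sq_summable A (\<lambda>x. - f x)"
  by (simp add: sq_summable_def)

lemma nrm2_uminus: "nrm2 A (\<lambda>x. - f x) = nrm2 A f"
  by (simp add: nrm2_def)

lemma sq_summable_diff:
  "sq_summable A f \<Longrightarrow> sq_summable A h \<Longrightarrow> sq_summable A (\<lambda>x. f x - h x)"
  using sq_summable_add(1)[OF _ sq_summable_uminus, of A f h] by simp

lemma sq_summable_finite: "finite A \<Longrightarrow> sq_summable A f"
  by (simp add: sq_summable_def)

lemma sq_summable_finite_support:
  assumes "finite F" "\<And>x. x \<in> A - F \<Longrightarrow> f x = 0"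
  shows "sq_summable A f"
proof -
  have "(\<lambda>x. (cmod (f x))\<^sup>2) summable_on (A \<inter> F)" using assms by simp
  also have "?this \<longleftrightarrow> (\<lambda>x. (cmod (f x))\<^sup>2) summable_on A"
    using assms by (intro summable_on_cong_neutral) auto
  finally show ?thesis by (simp add: sq_summable_def)
qed

lemma sq_summable_slice:
  assumes f: "sq_summable ({..<m} \<times> C) f" and i: "i < m"
  shows "sq_summable C (\<lambda>x. f (i, x))" "nrm2 C (\<lambda>x. f (i, x)) \<le> nrm2 ({..<m} \<times> C) f"
proof -
  have "(\<Sum>x\<in>F. (cmod (f (i, x)))\<^sup>2) \<le> nrm2 ({..<m} \<times> C) f" if F: "finite F" "F \<subseteq> C" for F
  proof -
    have "(\<Sum>x\<in>F. (cmod (f (i, x)))\<^sup>2) = (\<Sum>e\<in>Pair i ` F. (cmod (f e))\<^sup>2)"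
      by (subst sum.reindex) (auto simp: inj_on_def)
    also have "\<dots> \<le> nrm2 ({..<m} \<times> C) f" using F i by (intro sum_le_nrm2[OF f]) auto
    finally show ?thesis .
  qed
  from sq_summable_bound[OF this]
  show "sq_summable C (\<lambda>x. f (i, x))" "nrm2 C (\<lambda>x. f (i, x)) \<le> nrm2 ({..<m} \<times> C) f"
    by auto
qed

lemma sq_summable_0: "sq_summable A (\<lambda>_. 0)"
  by (simp add: sq_summable_def)

lemma sq_summable_sum:
  assumes "\<And>i. i \<in> S \<Longrightarrow> sq_summable A (f i)"
  shows "sq_summable A (\<lambda>x. \<Sum>i\<in>S. f i x)"
  using assms
  by (induction S rule: infinite_finite_induct) (auto simp: sq_summable_0 intro: sq_summable_add)

section \<open>Inner products and the Cauchy-Schwarz inequality\<close>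

lemma inner_abs_summable:
  assumes "sq_summable A f" "sq_summable A h"
  shows "(\<lambda>x. norm (f x * cnj (h x))) summable_on A"
proof (rule Infinite_Sum.abs_summable_on_comparison_test)
  show "(\<lambda>x. norm ((cmod (f x))\<^sup>2 + (cmod (h x))\<^sup>2)) summable_on A"
    using summable_on_add[of "\<lambda>x. (cmod (f x))\<^sup>2" A "\<lambda>x. (cmod (h x))\<^sup>2"] assms
    by (simp add: sq_summable_def)
  fix x
  show "norm (f x * cnj (h x)) \<le> norm ((cmod (f x))\<^sup>2 + (cmod (h x))\<^sup>2)"
    using sum_squares_bound[of "cmod (f x)" "cmod (h x)"]
      mult_nonneg_nonneg[of "cmod (f x)" "cmod (h x)"]
    by (simp add: norm_mult del: zero_le_mult_iff mult_nonneg_nonneg)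
qed

lemma inner_summable:
  "sq_summable A f \<Longrightarrow> sq_summable A h \<Longrightarrow> (\<lambda>x. f x * cnj (h x)) summable_on A"
  by (rule Infinite_Sum.abs_summable_summable) (rule inner_abs_summable)

lemma l2_inner_cong:
  "(\<And>x. x \<in> A \<Longrightarrow> f x = f' x) \<Longrightarrow> (\<And>x. x \<in> A \<Longrightarrow> h x = h' x) \<Longrightarrow> l2_inner A f h = l2_inner A f' h'"
  unfolding l2_inner_def by (intro infsum_cong) auto

lemma nrm2_cong: "(\<And>x. x \<in> A \<Longrightarrow> f x = f' x) \<Longrightarrow> nrm2 A f = nrm2 A f'"
  unfolding nrm2_def by (intro infsum_cong) auto

lemma l2_inner_add_left:
  assumes "sq_summable A f" "sq_summable A g" "sq_summable A h"
  shows "l2_inner A (\<lambda>x. f x + g x) h = l2_inner A f h + l2_inner A g h"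
  unfolding l2_inner_def distrib_right by (intro infsum_add inner_summable assms)

lemma l2_inner_cmult_left: "l2_inner A (\<lambda>x. c * f x) h = c * l2_inner A f h"
  unfolding l2_inner_def by (simp add: mult.assoc infsum_cmult_right')

lemma l2_inner_commute: "l2_inner A f h = cnj (l2_inner A h f)"
  unfolding l2_inner_def by (simp add: mult.commute flip: infsum_cnj)

lemma l2_inner_add_right:
  assumes "sq_summable A f" "sq_summable A g" "sq_summable A h"
  shows "l2_inner A h (\<lambda>x. f x + g x) = l2_inner A h f + l2_inner A h g"
  using l2_inner_add_left[OF assms] by (simp add: l2_inner_commute[of A h])

lemma l2_inner_cmult_right: "l2_inner A f (\<lambda>x. c * h x) = cnj c * l2_inner A f h"
  using l2_inner_cmult_left[of A c h f] by (simp add: l2_inner_commute[of A f])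

lemma l2_inner_uminus_left: "l2_inner A (\<lambda>x. - f x) h = - l2_inner A f h"
  using l2_inner_cmult_left[of A "-1" f h] by simp

lemma l2_inner_uminus_right: "l2_inner A f (\<lambda>x. - h x) = - l2_inner A f h"
  using l2_inner_cmult_right[of A f "-1" h] by simp

lemma l2_inner_diff_left:
  assumes "sq_summable A f" "sq_summable A g" "sq_summable A h"
  shows "l2_inner A (\<lambda>x. f x - g x) h = l2_inner A f h - l2_inner A g h"
  using l2_inner_add_left[OF assms(1) sq_summable_uminus[OF assms(2)] assms(3)]
  by (simp add: l2_inner_uminus_left)

lemma l2_inner_diff_right:
  assumes "sq_summable A f" "sq_summable A g" "sq_summable A h"
  shows "l2_inner A h (\<lambda>x. f x - g x) = l2_inner A h f - l2_inner A h g"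
  using l2_inner_add_right[OF assms(1) sq_summable_uminus[OF assms(2)] assms(3)]
  by (simp add: l2_inner_uminus_right)

lemma l2_inner_self: "l2_inner A f f = of_real (nrm2 A f)"
proof -
  have "(\<Sum>\<^sub>\<infinity>x\<in>A. of_real ((cmod (f x))\<^sup>2) :: complex) = of_real (nrm2 A f)"
    unfolding nrm2_def 
    by (rule infsum_bounded_linear_strong[OF
          summable_on_bounded_linear_iff[OF bounded_linear_of_real bounded_linear_Re] bounded_linear_of_real]) simp
  then show ?thesis by (simp only: l2_inner_def complex_norm_square)
qed

lemma l2_inner_0 [simp]: "l2_inner A (\<lambda>_. 0) h = 0" "l2_inner A f (\<lambda>_. 0) = 0"
  by (simp_all add: l2_inner_def)

lemma nrm2_diff_cmult:
  assumes f: "sq_summable A f" and h: "sq_summable A h"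
  shows "nrm2 A (\<lambda>x. f x - c * h x) =
    nrm2 A f - 2 * Re (cnj c * l2_inner A f h) + (cmod c)\<^sup>2 * nrm2 A h"
proof -
  have ch: "sq_summable A (\<lambda>x. c * h x)" by (rule sq_summable_cmult[OF h])
  have "of_real (nrm2 A (\<lambda>x. f x - c * h x)) =
      l2_inner A f f - l2_inner A f (\<lambda>x. c * h x)
      - (l2_inner A (\<lambda>x. c * h x) f - l2_inner A (\<lambda>x. c * h x) (\<lambda>x. c * h x))"
    unfolding l2_inner_self[symmetric]
    using f ch by (simp add: l2_inner_diff_left l2_inner_diff_right sq_summable_diff)
  also have "\<dots> = of_real (nrm2 A f) - (cnj c * l2_inner A f h + cnj (cnj c * l2_inner A f h))
      + of_real ((cmod c)\<^sup>2 * nrm2 A h)"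
    unfolding l2_inner_self nrm2_cmult l2_inner_cmult_left l2_inner_cmult_right
    by (subst l2_inner_commute[of A h f]) simp
  finally have "Re (of_real (nrm2 A (\<lambda>x. f x - c * h x))) = Re (of_real (nrm2 A f)
      - (cnj c * l2_inner A f h + cnj (cnj c * l2_inner A f h)) + of_real ((cmod c)\<^sup>2 * nrm2 A h))"
    by (rule arg_cong)
  then show ?thesis by simp
qed

lemma l2_inner_Cauchy_Schwarz:
  assumes f: "sq_summable A f" and h: "sq_summable A h"
  shows "(cmod (l2_inner A f h))\<^sup>2 \<le> nrm2 A f * nrm2 A h"
proof -
  let ?z = "l2_inner A f h"
  \<comment> \<open>Expand the squared norm of \<open>f - s z h\<close> for real \<open>s\<close>,
    where \<open>z\<close> is the inner product; the factor \<open>z\<close> makes the cross term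
    real. Below, \<open>s = 1 / nrm2 A h\<close> minimises the quadratic; if \<open>h\<close> has
    norm 0 the bound is affine in \<open>s\<close>, and a large \<open>s\<close> refutes
    \<open>z \<noteq> 0\<close>.\<close>
  have q: "0 \<le> nrm2 A f - 2 * (s * (cmod ?z)\<^sup>2) + s\<^sup>2 * (cmod ?z)\<^sup>2 * nrm2 A h" for s :: real
  proof -
    have "Re (cnj (of_real s * ?z) * ?z) = s * (cmod ?z)\<^sup>2"
      by (simp add: cmod_power2) (simp add: algebra_simps power2_eq_square)
    then show ?thesis
      using nrm2_nonneg[of A "\<lambda>x. f x - (of_real s * ?z) * h x"]
      by (simp add: nrm2_diff_cmult[OF f h] norm_mult power_mult_distrib)
  qed
  show ?thesis
  proof (cases "nrm2 A h = 0")
    case True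
    have "cmod ?z = 0"
    proof (rule ccontr)
      assume "cmod ?z \<noteq> 0"
      then have "0 \<le> nrm2 A f - 2 * (((nrm2 A f + 1) / (cmod ?z)\<^sup>2) * (cmod ?z)\<^sup>2)"
        using q[of "(nrm2 A f + 1) / (cmod ?z)\<^sup>2"] True by simp
      then have "0 \<le> nrm2 A f - 2 * (nrm2 A f + 1)" using \<open>cmod ?z \<noteq> 0\<close> by simp
      then show False using nrm2_nonneg[of A f] by (simp add: algebra_simps)
    qed
    then show ?thesis using True by simp
  next
    case False
    then have h0: "nrm2 A h > 0" using nrm2_nonneg[of A h] by linarith
    have "0 \<le> nrm2 A f - (cmod ?z)\<^sup>2 / nrm2 A h"
      using q[of "1 / nrm2 A h"] h0 by (simp add: power2_eq_square field_simps)
    then show ?thesis using h0 by (simp add: field_simps)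
  qed
qed

lemma nrm2_eq_0_iff:
  assumes "sq_summable A f"
  shows "nrm2 A f = 0 \<longleftrightarrow> (\<forall>x\<in>A. f x = 0)"
proof
  assume "nrm2 A f = 0"
  show "\<forall>x\<in>A. f x = 0"
  proof
    fix x assume "x \<in> A"
    then have "(cmod (f x))\<^sup>2 \<le> 0" using sum_le_nrm2[OF assms, of "{x}"] \<open>nrm2 A f = 0\<close> by simp
    then show "f x = 0" by simp
  qed
next
  assume "\<forall>x\<in>A. f x = 0"
  then have "nrm2 A f = nrm2 A (\<lambda>_. 0)" by (intro nrm2_cong) auto
  then show "nrm2 A f = 0" by (simp add: nrm2_def)
qed

text \<open>Closedness is asked for pointwise limits inside \<open>l2 A\<close>, which covers norm
  limits. Spaces cut out by equations in finitely many coordinates have this property, and the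
  minimising sequence below is only shown to converge pointwise.\<close>

locale l2_closed_subspace =
  fixes A :: "'i set" and V :: "('i \<Rightarrow> complex) set"
  assumes sub: "V \<subseteq> l2 A"
    and zero: "(\<lambda>_. 0) \<in> V"
    and add: "f \<in> V \<Longrightarrow> h \<in> V \<Longrightarrow> (\<lambda>x. f x + h x) \<in> V"
    and cmult: "f \<in> V \<Longrightarrow> (\<lambda>x. c * f x) \<in> V"
    and pointwise_limit: "(\<And>k. s k \<in> V) \<Longrightarrow> p \<in> l2 A \<Longrightarrow> (\<And>x. (\<lambda>k. s k x) \<longlonglongrightarrow> p x) \<Longrightarrow> p \<in> V"
begin

lemma sqs: "f \<in> V \<Longrightarrow> sq_summable A f"
  using sub by (auto simp: l2_iff)

lemma diff: "f \<in> V \<Longrightarrow> h \<in> V \<Longrightarrow> (\<lambda>x. f x - h x) \<in> V"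
  using add[OF _ cmult[of h "-1"], of f] by simp

text \<open>A pointwise limit \<open>p\<close> of a minimising sequence in \<open>V\<close> is a
  nearest point to \<open>e\<close>, and first-order variation at \<open>p\<close> gives
  orthogonality.\<close>

lemma projection_exists:
  assumes e: "sq_summable A e"
  shows "\<exists>p\<in>V. \<forall>v\<in>V. l2_inner A (\<lambda>x. e x - p x) v = 0"
proof -
  define D where "D = (INF v\<in>V. nrm2 A (\<lambda>x. e x - v x))"
  have bdd: "bdd_below ((\<lambda>v. nrm2 A (\<lambda>x. e x - v x)) ` V)"
    by (intro bdd_belowI[of _ 0]) (auto simp: nrm2_nonneg)
  have D_le: "D \<le> nrm2 A (\<lambda>x. e x - v x)" if "v \<in> V" for v
    unfolding D_def using bdd that by (rule cINF_lower)
  have "\<exists>v\<in>V. nrm2 A (\<lambda>x. e x - v x) < D + 1 / Suc k" for k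
    unfolding D_def using zero bdd by (subst cINF_less_iff[symmetric]) auto
  then obtain s where s: "\<And>k. s k \<in> V" and sD: "\<And>k. nrm2 A (\<lambda>x. e x - s k x) < D + 1 / Suc k"
    by metis
  have es: "sq_summable A (\<lambda>x. e x - s k x)" for k by (intro sq_summable_diff e sqs s)
  \<comment> \<open>By the parallelogram law: the midpoint \<open>?m\<close> lies in
    \<open>V\<close>, so its squared distance to \<open>e\<close> is at least
    \<open>D\<close>.\<close>
  have close: "nrm2 A (\<lambda>x. s k x - s l x) \<le> 2 / Suc k + 2 / Suc l" for k l
  proof -
    let ?m = "\<lambda>x. (1/2) * (s k x + s l x)"
    have m: "?m \<in> V" by (intro cmult add s)
    have par: "(cmod (s k x - s l x))\<^sup>2 + 4 * (cmod (e x - ?m x))\<^sup>2 =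
        2 * (cmod (e x - s k x))\<^sup>2 + 2 * (cmod (e x - s l x))\<^sup>2" for x
      by (simp add: cmod_power2) (simp add: power2_eq_square field_simps)
    have "nrm2 A (\<lambda>x. s k x - s l x) + 4 * nrm2 A (\<lambda>x. e x - ?m x) =
        2 * nrm2 A (\<lambda>x. e x - s k x) + 2 * nrm2 A (\<lambda>x. e x - s l x)"
    proof -
      have "sq_summable A (\<lambda>x. s k x - s l x)" "sq_summable A (\<lambda>x. e x - ?m x)"
        by (intro sq_summable_diff e sqs s m)+
      then have "nrm2 A (\<lambda>x. s k x - s l x) + 4 * nrm2 A (\<lambda>x. e x - ?m x) =
          (\<Sum>\<^sub>\<infinity>x\<in>A. (cmod (s k x - s l x))\<^sup>2 + 4 * (cmod (e x - ?m x))\<^sup>2)"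
        unfolding nrm2_def sq_summable_def
        by (simp add: infsum_add infsum_cmult_right' summable_on_cmult_right)
      also have "\<dots> = 2 * nrm2 A (\<lambda>x. e x - s k x) + 2 * nrm2 A (\<lambda>x. e x - s l x)"
        unfolding par using es[of k] es[of l] unfolding nrm2_def sq_summable_def
        by (simp add: infsum_add infsum_cmult_right' summable_on_cmult_right)
      finally show ?thesis .
    qed
    then show ?thesis using D_le[OF m] sD[of k] sD[of l] by linarith
  qed
  have fin: "(\<Sum>x\<in>F. (cmod (s k x - s l x))\<^sup>2) \<le> 2 / Suc k + 2 / Suc l"
    if "finite F" "F \<subseteq> A" for F k l
    using sum_le_nrm2[OF sq_summable_diff[OF sqs sqs, OF s s] that] close by (rule order_trans)
  have null: "(\<lambda>l. 2 / real (Suc l)) \<longlonglongrightarrow> 0"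
    using tendsto_mult_right_zero[OF LIMSEQ_inverse_real_of_nat, of 2] by (simp add: divide_inverse)
  have "\<exists>z. (\<lambda>k. s k x) \<longlonglongrightarrow> z" for x
  proof (cases "x \<in> A")
    case True
    have "Cauchy (\<lambda>k. s k x)"
    proof (rule metric_CauchyI)
      fix \<epsilon> :: real assume \<epsilon>: "\<epsilon> > 0"
      then have "eventually (\<lambda>l. 2 / real (Suc l) < \<epsilon>\<^sup>2 / 2) sequentially"
        by (intro order_tendstoD(2)[OF null]) auto
      then obtain M where M: "\<And>l. l \<ge> M \<Longrightarrow> 2 / real (Suc l) < \<epsilon>\<^sup>2 / 2"
        by (auto simp: eventually_sequentially)
      show "\<exists>M. \<forall>m\<ge>M. \<forall>n\<ge>M. dist (s m x) (s n x) < \<epsilon>"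
      proof (intro exI[of _ M] allI impI)
        fix k l assume kl: "k \<ge> M" "l \<ge> M"
        have "(cmod (s k x - s l x))\<^sup>2 < \<epsilon>\<^sup>2"
          using fin[of "{x}" k l] True M[OF kl(1)] M[OF kl(2)] by simp
        then show "dist (s k x) (s l x) < \<epsilon>"
          using \<epsilon> by (simp add: dist_norm power_less_imp_less_base)
      qed
    qed
    then show ?thesis by (simp add: Cauchy_convergent_iff convergent_def)
  next
    case False
    then have "s k x = 0" for k using s[of k] sub by (auto simp: l2_iff)
    then show ?thesis by auto
  qed
  then obtain p where p: "\<And>x. (\<lambda>k. s k x) \<longlonglongrightarrow> p x" by metis
  \<comment> \<open>A Fatou argument: each finite partial sum passes to the limit, so
    \<open>p\<close> attains the infimum.\<close>
  have fatou: "(\<Sum>x\<in>F. (cmod (e x - p x))\<^sup>2) \<le> D" if F: "finite F" "F \<subseteq> A" for F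
  proof (rule LIMSEQ_le)
    show "(\<lambda>k. \<Sum>x\<in>F. (cmod (e x - s k x))\<^sup>2) \<longlonglongrightarrow> (\<Sum>x\<in>F. (cmod (e x - p x))\<^sup>2)"
      by (intro tendsto_intros p)
    show "(\<lambda>k. D + 1 / Suc k) \<longlonglongrightarrow> D"
      using tendsto_add[OF tendsto_const[of D] LIMSEQ_inverse_real_of_nat] by (simp add: divide_inverse)
    show "\<exists>N. \<forall>k\<ge>N. (\<Sum>x\<in>F. (cmod (e x - s k x))\<^sup>2) \<le> D + 1 / Suc k"
      using sum_le_nrm2[OF es F] sD by (meson less_imp_le order_trans)
  qed
  have ep: "sq_summable A (\<lambda>x. e x - p x)" "nrm2 A (\<lambda>x. e x - p x) \<le> D"
    using sq_summable_bound[OF fatou] by auto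
  have "p x = 0" if "x \<notin> A" for x
  proof -
    have "s k x = 0" for k using s[of k] sub that by (auto simp: l2_iff)
    then show ?thesis using p[of x] by (simp add: LIMSEQ_const_iff)
  qed
  moreover have "sq_summable A p" using sq_summable_diff[OF e ep(1)] by simp
  ultimately have pV: "p \<in> V" using pointwise_limit[OF s _ p] by (simp add: l2_iff)
  \<comment> \<open>Replace \<open>p\<close> by \<open>p + t z v\<close>, with \<open>z\<close> the
    inner product: the gain is linear in \<open>t\<close> and the loss quadratic. With
    \<open>t = 1 / (nrm2 A v + 1)\<close> the loss is at most half the gain.\<close>
  have "l2_inner A (\<lambda>x. e x - p x) v = 0" if v: "v \<in> V" for v
  proof -
    let ?z = "l2_inner A (\<lambda>x. e x - p x) v"
    have ineq: "2 * (t * (cmod ?z)\<^sup>2) \<le> t\<^sup>2 * (cmod ?z)\<^sup>2 * nrm2 A v" for t :: real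
    proof -
      have "D \<le> nrm2 A (\<lambda>x. e x - (p x + (of_real t * ?z) * v x))"
        by (intro D_le add pV cmult v)
      also have "\<dots> = nrm2 A (\<lambda>x. (e x - p x) - (of_real t * ?z) * v x)" by (simp add: diff_diff_eq)
      also have "\<dots> = nrm2 A (\<lambda>x. e x - p x) - 2 * Re (cnj (of_real t * ?z) * ?z)
          + (cmod (of_real t * ?z))\<^sup>2 * nrm2 A v"
        by (rule nrm2_diff_cmult[OF ep(1) sqs[OF v]])
      also have "Re (cnj (of_real t * ?z) * ?z) = t * (cmod ?z)\<^sup>2"
        by (simp add: cmod_power2) (simp add: algebra_simps power2_eq_square)
      finally show ?thesis using ep(2) by (simp add: norm_mult power_mult_distrib)
    qed
    show ?thesis
    proof (rule ccontr)
      assume "?z \<noteq> 0"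
      then have z: "(cmod ?z)\<^sup>2 > 0" by simp
      define t where "t = 1 / (nrm2 A v + 1)"
      have n: "nrm2 A v + 1 > 0" using nrm2_nonneg[of A v] by linarith
      then have t: "t > 0" by (simp add: t_def)
      have "2 * (t * (cmod ?z)\<^sup>2) \<le> t * (cmod ?z)\<^sup>2 * (t * nrm2 A v)"
        using ineq[of t] by (simp add: power2_eq_square mult_ac)
      also have "t * nrm2 A v \<le> 1" using n by (simp add: t_def)
      then have "t * (cmod ?z)\<^sup>2 * (t * nrm2 A v) \<le> t * (cmod ?z)\<^sup>2 * 1"
        using t z by (intro mult_left_mono) auto
      finally show False using t z by simp
    qed
  qed
  then show ?thesis using pV by blast
qed

lemma l2_proj:
  assumes e: "sq_summable A e"
  shows "l2_proj A V e \<in> V" "\<And>v. v \<in> V \<Longrightarrow> l2_inner A (\<lambda>x. e x - l2_proj A V e x) v = 0"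
proof -
  have "\<exists>!p. p \<in> V \<and> (\<forall>v\<in>V. l2_inner A (\<lambda>x. e x - p x) v = 0)"
  proof (rule ex_ex1I)
    show "\<exists>p. p \<in> V \<and> (\<forall>v\<in>V. l2_inner A (\<lambda>x. e x - p x) v = 0)"
      using projection_exists[OF e] by blast
    fix p q assume p: "p \<in> V \<and> (\<forall>v\<in>V. l2_inner A (\<lambda>x. e x - p x) v = 0)"
      and q: "q \<in> V \<and> (\<forall>v\<in>V. l2_inner A (\<lambda>x. e x - q x) v = 0)"
    let ?d = "\<lambda>x. p x - q x"
    have d: "?d \<in> V" using p q diff by blast
    have "l2_inner A ?d ?d = l2_inner A (\<lambda>x. (e x - q x) - (e x - p x)) ?d"
      by (intro l2_inner_cong) auto
    also have "\<dots> = 0"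
      using p q d sqs e by (subst l2_inner_diff_left) (auto intro: sq_summable_diff)
    finally have "nrm2 A ?d = 0" by (simp add: l2_inner_self)
    then have "?d x = 0" if "x \<in> A" for x using that nrm2_eq_0_iff[OF sqs[OF d]] by blast
    moreover have "p x = 0 \<and> q x = 0" if "x \<notin> A" for x
      using p q sub that by (auto simp: l2_iff)
    ultimately show "p = q" by (metis eq_iff_diff_eq_0 ext)
  qed
  from theI'[OF this] show "l2_proj A V e \<in> V"
    "\<And>v. v \<in> V \<Longrightarrow> l2_inner A (\<lambda>x. e x - l2_proj A V e x) v = 0"
    by (auto simp: l2_proj_def)
qed

text \<open>The hypothesis says that \<open>u\<close> has the same projection as \<open>e\<close>.\<close>
lemma l2_inner_proj_le:
  assumes e: "sq_summable A e" and u: "sq_summable A u"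
    and ue: "\<And>v. v \<in> V \<Longrightarrow> l2_inner A u v = l2_inner A e v"
  shows "Re (l2_inner A (l2_proj A V e) e) \<le> nrm2 A u"
proof -
  define p where "p = l2_proj A V e"
  have p: "p \<in> V" "l2_inner A (\<lambda>x. e x - p x) p = 0"
    using l2_proj[OF e] by (auto simp: p_def)
  have "l2_inner A e p = of_real (nrm2 A p)"
    using p e sqs by (simp add: l2_inner_diff_left l2_inner_self)
  then have ep: "cmod (l2_inner A u p) = nrm2 A p" "Re (l2_inner A p e) = nrm2 A p"
    using ue[OF p(1)] l2_inner_commute[of A p e] nrm2_nonneg[of A p] by auto
  have "(nrm2 A p)\<^sup>2 \<le> nrm2 A u * nrm2 A p"
    using l2_inner_Cauchy_Schwarz[OF u sqs[OF p(1)]] by (simp add: ep)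
  then have "nrm2 A p \<le> nrm2 A u"
    using nrm2_nonneg[of A p] nrm2_nonneg[of A u]
    by (cases "nrm2 A p = 0") (auto simp: power2_eq_square)
  then show ?thesis by (simp add: ep p_def[symmetric])
qed

end

section \<open>Laplacians on Cayley complexes\<close>

text \<open>
  \<open>path_int\<close> is the integral of a \<open>1\<close>-cochain along the path that starts at \<open>x\<close> and reads \<open>w\<close>, and
  \<open>path_adj\<close> is the transpose of this operator. A list \<open>W\<close> of words stands for the sum \<open>b\<^sub>W\<close> of the
  integrals along its members, and \<open>lap\<close> is the sum over \<open>W\<close> of \<open>b\<^sub>W\<^sup>*b\<^sub>W\<close>. The two boundary
  operators of the Cayley complex both have this form, see \<open>pres_chains\<close> below.
\<close>

fun path_int ::
    "('a, 'b) monoid_scheme \<Rightarrow> (nat \<Rightarrow> 'a) \<Rightarrow> (nat \<times> 'a \<Rightarrow> 'c::comm_ring_1) \<Rightarrow> 'a \<Rightarrow> letter list \<Rightarrow> 'c"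
  where
  "path_int G g f x [] = 0"
| "path_int G g f x ((i, True) # w) = f (i, x) + path_int G g f (x \<otimes>\<^bsub>G\<^esub> g i) w"
| "path_int G g f x ((i, False) # w) =
     - f (i, x \<otimes>\<^bsub>G\<^esub> inv\<^bsub>G\<^esub> (g i)) + path_int G g f (x \<otimes>\<^bsub>G\<^esub> inv\<^bsub>G\<^esub> (g i)) w"

fun path_adj ::
    "('a, 'b) monoid_scheme \<Rightarrow> (nat \<Rightarrow> 'a) \<Rightarrow> ('a \<Rightarrow> 'c::comm_ring_1) \<Rightarrow> letter list \<Rightarrow> nat \<times> 'a \<Rightarrow> 'c"
  where
  "path_adj G g h [] e = 0"
| "path_adj G g h ((i, True) # w) e =
     of_bool (fst e = i) * h (snd e) + path_adj G g (\<lambda>x. h (x \<otimes>\<^bsub>G\<^esub> inv\<^bsub>G\<^esub> (g i))) w e"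
| "path_adj G g h ((i, False) # w) e =
     - (of_bool (fst e = i) * h (snd e \<otimes>\<^bsub>G\<^esub> g i)) + path_adj G g (\<lambda>x. h (x \<otimes>\<^bsub>G\<^esub> g i)) w e"

definition chain_int ::
    "('a, 'b) monoid_scheme \<Rightarrow> (nat \<Rightarrow> 'a) \<Rightarrow> (nat \<times> 'a \<Rightarrow> 'c::comm_ring_1) \<Rightarrow> 'a \<Rightarrow> letter list list \<Rightarrow> 'c"
  where "chain_int G g f x W = (\<Sum>w\<leftarrow>W. path_int G g f x w)"

definition chain_adj ::
    "('a, 'b) monoid_scheme \<Rightarrow> (nat \<Rightarrow> 'a) \<Rightarrow> ('a \<Rightarrow> 'c::comm_ring_1) \<Rightarrow> letter list list \<Rightarrow> nat \<times> 'a \<Rightarrow> 'c"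
  where "chain_adj G g h W e = (\<Sum>w\<leftarrow>W. path_adj G g h w e)"

definition lap ::
    "('a, 'b) monoid_scheme \<Rightarrow> (nat \<Rightarrow> 'a) \<Rightarrow> letter list list list \<Rightarrow> (nat \<times> 'a \<Rightarrow> 'c::comm_ring_1)
      \<Rightarrow> nat \<times> 'a \<Rightarrow> 'c"
  where "lap G g Ws f e = (\<Sum>W\<leftarrow>Ws. chain_adj G g (\<lambda>x. chain_int G g f x W) W e)"

text \<open>For \<open>c = 1 / K\<close> this is the operator \<open>T\<close> of the
  overview.\<close>

definition damp ::
    "('a, 'b) monoid_scheme \<Rightarrow> (nat \<Rightarrow> 'a) \<Rightarrow> letter list list list \<Rightarrow> 'c::comm_ring_1 \<Rightarrow>
      (nat \<times> 'a \<Rightarrow> 'c) \<Rightarrow> nat \<times> 'a \<Rightarrow> 'c"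
  where "damp G g Ws c f e = f e - c * lap G g Ws f e"

text \<open>A bound for the squared norm of the operator \<open>b\<^sub>W\<close>, obtained by
  repeated use of \<open>sq_summable_add\<close>. It depends on the words only, so one value serves
  for the group and for all its quotients.\<close>

definition chain_bound :: "letter list list \<Rightarrow> real" where
  "chain_bound W = foldr (\<lambda>w c. 2 * 4 ^ length w + 2 * c) W 0"

definition lap_bound :: "letter list list list \<Rightarrow> real" where
  "lap_bound Ws = (\<Sum>W\<leftarrow>Ws. chain_bound W)"

section \<open>Linearity and change of scalars\<close>

lemma words_simps [simp]: "[] \<in> words n" "l # w \<in> words n \<longleftrightarrow> fst l < n \<and> w \<in> words n"
  by (auto simp: words_def mem_Times_iff)

lemma path_int_add: "path_int G g (\<lambda>e. f e + f' e) x w = path_int G g f x w + path_int G g f' x w"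
  by (induction G g f x w rule: path_int.induct) (auto simp: algebra_simps)

lemma path_int_cmult: "path_int G g (\<lambda>e. c * f e) x w = c * path_int G g f x w"
  by (induction G g f x w rule: path_int.induct) (auto simp: algebra_simps)

lemma path_adj_add: "path_adj G g (\<lambda>x. h x + h' x) w e = path_adj G g h w e + path_adj G g h' w e"
proof (induction w arbitrary: h h')
  case (Cons l w)
  show ?case by (cases l; cases "snd l") (auto simp: Cons.IH algebra_simps)
qed simp

lemma path_adj_cmult: "path_adj G g (\<lambda>x. c * h x) w e = c * path_adj G g h w e"
  by (induction G g h w e rule: path_adj.induct) (auto simp: algebra_simps)

lemma path_int_of_int: "path_int G g (\<lambda>e. of_int (f e)) x w = of_int (path_int G g f x w)"
  by (induction G g f x w rule: path_int.induct) auto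

lemma path_adj_of_int: "path_adj G g (\<lambda>x. of_int (h x)) w e = of_int (path_adj G g h w e)"
  by (induction G g h w e rule: path_adj.induct) auto

lemma chain_int_add: "chain_int G g (\<lambda>e. f e + f' e) x W = chain_int G g f x W + chain_int G g f' x W"
  by (simp add: chain_int_def path_int_add sum_list_addf)

lemma chain_int_cmult: "chain_int G g (\<lambda>e. c * f e) x W = c * chain_int G g f x W"
  by (simp add: chain_int_def path_int_cmult sum_list_const_mult)

lemma chain_int_of_int: "chain_int G g (\<lambda>e. of_int (f e)) x W = of_int (chain_int G g f x W)"
  unfolding chain_int_def by (induction W) (auto simp: path_int_of_int)

lemma chain_adj_add: "chain_adj G g (\<lambda>x. h x + h' x) W e = chain_adj G g h W e + chain_adj G g h' W e"
  by (simp add: chain_adj_def path_adj_add sum_list_addf)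

lemma chain_adj_cmult: "chain_adj G g (\<lambda>x. c * h x) W e = c * chain_adj G g h W e"
  by (simp add: chain_adj_def path_adj_cmult sum_list_const_mult)

lemma chain_adj_of_int: "chain_adj G g (\<lambda>x. of_int (h x)) W e = of_int (chain_adj G g h W e)"
  unfolding chain_adj_def by (induction W) (auto simp: path_adj_of_int)

lemma lap_add: "lap G g Ws (\<lambda>e. f e + f' e) e = lap G g Ws f e + lap G g Ws f' e"
  by (simp add: lap_def chain_int_add chain_adj_add sum_list_addf)

lemma lap_cmult: "lap G g Ws (\<lambda>e. c * f e) e = c * lap G g Ws f e"
  by (simp add: lap_def chain_int_cmult chain_adj_cmult sum_list_const_mult)

lemma lap_of_int: "lap G g Ws (\<lambda>e. of_int (f e)) e = of_int (lap G g Ws f e)"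
  unfolding lap_def by (induction Ws) (auto simp: chain_int_of_int chain_adj_of_int)

lemma damp_pow_Suc:
  "(damp G g Ws c ^^ Suc k) f e = (damp G g Ws c ^^ k) f e - c * lap G g Ws ((damp G g Ws c ^^ k) f) e"
  by (simp add: damp_def)

lemma damp_pow_add:
  "(damp G g Ws c ^^ k) (\<lambda>e. f e + f' e) = (\<lambda>e. (damp G g Ws c ^^ k) f e + (damp G g Ws c ^^ k) f' e)"
  by (induction k) (auto simp: damp_def lap_add algebra_simps)

lemma damp_pow_cmult:
  "(damp G g Ws c ^^ k) (\<lambda>e. b * f e) = (\<lambda>e. b * (damp G g Ws c ^^ k) f e)"
  by (induction k) (auto simp: damp_def lap_cmult algebra_simps)

lemma damp_pow_sum:
  "(damp G g Ws c ^^ k) (\<lambda>e. \<Sum>a\<in>S. b a * f a e) = (\<lambda>e. \<Sum>a\<in>S. b a * (damp G g Ws c ^^ k) (f a) e)"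
proof (induction S rule: infinite_finite_induct)
  case (insert s S)
  then show ?case by (simp add: damp_pow_add damp_pow_cmult)
qed (use damp_pow_cmult[of k G g Ws c 0 "\<lambda>_. 0"] in auto)

lemma lap_sum: "lap G g Ws (\<lambda>e. \<Sum>a\<in>S. b a * f a e) e = (\<Sum>a\<in>S. b a * lap G g Ws (f a) e)"
proof (induction S rule: infinite_finite_induct)
  case (insert s S)
  then show ?case by (simp add: lap_add lap_cmult)
qed (use lap_cmult[of G g Ws 0 "\<lambda>_. 0" e] in auto)

text \<open>The finite set \<open>F\<close> is what a deep quotient must see faithfully, see
  \<open>exists_deep_quotient\<close>. As \<open>F \<subseteq> A\<close>, values outside
  \<open>A\<close> have no influence; this is how sums over a finite edge set can replace a
  chain.\<close>

definition finitary :: "'i set \<Rightarrow> (('i \<Rightarrow> 'c) \<Rightarrow> 'd) \<Rightarrow> bool" where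
  "finitary A \<Phi> \<longleftrightarrow> (\<exists>F. finite F \<and> F \<subseteq> A \<and> (\<forall>f f'. (\<forall>x\<in>F. f x = f' x) \<longrightarrow> \<Phi> f = \<Phi> f'))"

lemma finitary_const: "finitary A (\<lambda>_. b)"
  by (auto simp: finitary_def)

lemma finitary_eval: "x \<in> A \<Longrightarrow> finitary A (\<lambda>f. f x)"
  unfolding finitary_def by (intro exI[of _ "{x}"]) auto

lemma finitary_comp:
  fixes \<theta> :: "('i \<Rightarrow> 'c) \<Rightarrow> 'j \<Rightarrow> 'd"
  assumes "finitary B \<Phi>" and "\<And>b. b \<in> B \<Longrightarrow> finitary A (\<lambda>f. \<theta> f b)"
  shows "finitary A (\<lambda>f. \<Phi> (\<theta> f))"
proof -
  obtain F where F: "finite F" "F \<subseteq> B" "\<And>f f'. (\<forall>x\<in>F. f x = f' x) \<Longrightarrow> \<Phi> f = \<Phi> f'"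
    using assms(1) by (auto simp: finitary_def)
  obtain H where H: "\<And>b. b \<in> F \<Longrightarrow> finite (H b) \<and> H b \<subseteq> A \<and>
      (\<forall>f f' :: 'i \<Rightarrow> 'c. (\<forall>x\<in>H b. f x = f' x) \<longrightarrow> \<theta> f b = \<theta> f' b)"
    using assms(2) F(2) unfolding finitary_def by (metis subsetD)
  show ?thesis
    unfolding finitary_def
  proof (intro exI[of _ "\<Union>b\<in>F. H b"] conjI allI impI)
    fix f f' :: "'i \<Rightarrow> 'c" assume "\<forall>x\<in>\<Union>b\<in>F. H b. f x = f' x"
    then have "\<theta> f b = \<theta> f' b" if "b \<in> F" for b using H[OF that] that by blast
    then show "\<Phi> (\<theta> f) = \<Phi> (\<theta> f')" by (intro F(3)) blast
  qed (use H F(1) in auto)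
qed

lemma finitary_op2:
  assumes "finitary A \<Phi>" "finitary A \<Psi>"
  shows "finitary A (\<lambda>f. b (\<Phi> f) (\<Psi> f))"
proof -
  obtain F H where "finite F" "F \<subseteq> A" "\<And>f f'. (\<forall>x\<in>F. f x = f' x) \<Longrightarrow> \<Phi> f = \<Phi> f'"
    "finite H" "H \<subseteq> A" "\<And>f f'. (\<forall>x\<in>H. f x = f' x) \<Longrightarrow> \<Psi> f = \<Psi> f'"
    using assms by (auto simp: finitary_def)
  then show ?thesis unfolding finitary_def by (intro exI[of _ "F \<union> H"]) (simp, metis UnI1 UnI2)
qed

lemma has_sum_slices:
  fixes f :: "nat \<times> 'x \<Rightarrow> 'c::topological_comm_monoid_add"
  assumes "\<And>i. i < m \<Longrightarrow> ((\<lambda>x. f (i, x)) has_sum s i) C"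
  shows "(f has_sum (\<Sum>i<m. s i)) ({..<m} \<times> C)"
proof -
  have "(f has_sum s i) ({i} \<times> C)" if "i < m" for i
  proof -
    have "((f \<circ> Pair i) has_sum s i) C" using assms[OF that] by (simp add: o_def)
    then have "(f has_sum s i) (Pair i ` C)" by (subst has_sum_reindex) (auto simp: inj_on_def)
    also have "Pair i ` C = {i} \<times> C" by auto
    finally show ?thesis .
  qed
  then have "(f has_sum (sum s {..<m})) (\<Union>i\<in>{..<m}. {i} \<times> C)"
    by (intro sum_has_sum) auto
  also have "(\<Union>i\<in>{..<m}. {i} \<times> C) = {..<m} \<times> C" by auto
  finally show ?thesis .
qed

locale cayley = group G for G (structure) +
  fixes n :: nat and g :: "nat \<Rightarrow> 'a" and Ws :: "letter list list list"
  assumes gens [simp]: "i < n \<Longrightarrow> g i \<in> carrier G"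
    and Ws_words: "W \<in> set Ws \<Longrightarrow> w \<in> set W \<Longrightarrow> w \<in> words n"
begin

abbreviation edges where "edges \<equiv> {..<n} \<times> carrier G"

section \<open>Boundedness, adjointness and positivity of the Laplacian\<close>

lemma bij_shift: "a \<in> carrier G \<Longrightarrow> bij_betw (\<lambda>x. x \<otimes> a) (carrier G) (carrier G)"
  by (rule bij_betw_byWitness[where f' = "\<lambda>x. x \<otimes> inv a"]) (auto simp: m_assoc)

lemma sq_summable_shift:
  assumes "a \<in> carrier G"
  shows "sq_summable (carrier G) (\<lambda>x. h (x \<otimes> a)) \<longleftrightarrow> sq_summable (carrier G) h"
    and "nrm2 (carrier G) (\<lambda>x. h (x \<otimes> a)) = nrm2 (carrier G) h"
  using summable_on_reindex_bij_betw[OF bij_shift[OF assms], of "\<lambda>x. (cmod (h x))\<^sup>2"]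
    infsum_reindex_bij_betw[OF bij_shift[OF assms], of "\<lambda>x. (cmod (h x))\<^sup>2"]
  by (auto simp: sq_summable_def nrm2_def)

lemma l2_inner_shift:
  assumes "a \<in> carrier G"
  shows "l2_inner (carrier G) (\<lambda>x. f (x \<otimes> a)) h = l2_inner (carrier G) f (\<lambda>x. h (x \<otimes> inv a))"
  unfolding l2_inner_def using assms
  by (subst infsum_reindex_bij_betw[OF bij_shift[OF assms], symmetric])
    (auto simp: m_assoc intro!: infsum_cong)

lemma sq_summable_edge:
  assumes h: "sq_summable (carrier G) h"
  shows "sq_summable edges (\<lambda>e. of_bool (fst e = i) * h (snd e))"
proof (rule sq_summable_bound(1))
  fix F assume F: "finite F" "F \<subseteq> edges"
  have "(\<Sum>e\<in>F. (cmod (of_bool (fst e = i) * h (snd e)))\<^sup>2) = (\<Sum>e\<in>{e \<in> F. fst e = i}. (cmod (h (snd e)))\<^sup>2)"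
    using F by (intro sum.mono_neutral_cong_right) auto
  also have "\<dots> = (\<Sum>x\<in>snd ` {e \<in> F. fst e = i}. (cmod (h x))\<^sup>2)"
    by (subst sum.reindex) (auto simp: inj_on_def)
  also have "\<dots> \<le> nrm2 (carrier G) h" using F by (intro sum_le_nrm2[OF h]) auto
  finally show "(\<Sum>e\<in>F. (cmod (of_bool (fst e = i) * h (snd e)))\<^sup>2) \<le> nrm2 (carrier G) h" .
qed

lemma path_int_bound:
  assumes f: "sq_summable edges f" and w: "w \<in> words n"
  shows "sq_summable (carrier G) (\<lambda>x. path_int G g f x w) \<and>
    nrm2 (carrier G) (\<lambda>x. path_int G g f x w) \<le> 4 ^ length w * nrm2 edges f"
  using w
proof (induction w)
  case Nil
  then show ?case by (simp add: sq_summable_0) (simp add: nrm2_def infsum_nonneg)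
next
  case (Cons l w)
  obtain i b where l: "l = (i, b)" by (cases l)
  have i: "i < n" and w: "w \<in> words n" using Cons.prems by (auto simp: l)
  note IH = Cons.IH[OF w]
  define a where "a = (if b then g i else inv g i)"
  define p where "p x = (if b then f (i, x) else - f (i, x \<otimes> inv g i))" for x
  have a: "a \<in> carrier G" using i by (simp add: a_def)
  have p: "sq_summable (carrier G) p" "nrm2 (carrier G) p \<le> nrm2 edges f"
    unfolding p_def using sq_summable_slice[OF f i] sq_summable_shift[of "inv g i" "\<lambda>x. f (i, x)"] i
    by (cases b; simp add: nrm2_uminus sq_summable_uminus)+
  have s: "sq_summable (carrier G) (\<lambda>x. path_int G g f (x \<otimes> a) w)"
    "nrm2 (carrier G) (\<lambda>x. path_int G g f (x \<otimes> a) w) \<le> 4 ^ length w * nrm2 edges f"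
    using IH sq_summable_shift[OF a, of "\<lambda>x. path_int G g f x w"] by auto
  \<comment> \<open>With the doubling from \<open>sq_summable_add\<close> a word with one more
    letter costs \<open>2 + 2 * 4 ^ length w\<close>, at most
    \<open>4 ^ Suc (length w)\<close>.\<close>
  have "1 * nrm2 edges f \<le> 4 ^ length w * nrm2 edges f"
    using nrm2_nonneg[of edges f] by (intro mult_right_mono) auto
  then have "nrm2 (carrier G) (\<lambda>x. p x + path_int G g f (x \<otimes> a) w) \<le> 4 ^ length (l # w) * nrm2 edges f"
    using sq_summable_add(2)[OF p(1) s(1)] p(2) s(2) by simp
  moreover have "path_int G g f x (l # w) = p x + path_int G g f (x \<otimes> a) w" for x
    by (cases b) (auto simp: l p_def a_def)
  ultimately show ?case using sq_summable_add(1)[OF p(1) s(1)] by simp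
qed

lemma sq_summable_path_adj:
  assumes "sq_summable (carrier G) h" "w \<in> words n"
  shows "sq_summable edges (path_adj G g h w)"
  using assms
proof (induction w arbitrary: h)
  case Nil
  then show ?case by (simp add: sq_summable_0)
next
  case (Cons l w)
  obtain i b where l: "l = (i, b)" by (cases l)
  have i: "i < n" "inv g i \<in> carrier G" and w: "w \<in> words n" using Cons.prems by (auto simp: l)
  show ?case
    using Cons.IH[OF _ w] Cons.prems(1) i
    by (cases b) (auto simp: l sq_summable_shift intro!: sq_summable_add(1) sq_summable_diff sq_summable_edge
        sq_summable_edge[where h = "\<lambda>x. h (x \<otimes> g i)"])
qed

lemma l2_inner_edge:
  assumes i: "i < n"
  shows "l2_inner edges f (\<lambda>e. of_bool (fst e = i) * h (snd e)) = l2_inner (carrier G) (\<lambda>x. f (i, x)) h"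
proof -
  have "l2_inner edges f (\<lambda>e. of_bool (fst e = i) * h (snd e)) =
      (\<Sum>\<^sub>\<infinity>e\<in>Pair i ` carrier G. f e * cnj (h (snd e)))"
    unfolding l2_inner_def using i by (intro infsum_cong_neutral) auto
  also have "\<dots> = l2_inner (carrier G) (\<lambda>x. f (i, x)) h"
    unfolding l2_inner_def by (subst infsum_reindex) (auto simp: inj_on_def o_def)
  finally show ?thesis .
qed

text \<open>The rest of a word is integrated from a translated base point.
  \<open>l2_inner_shift\<close> moves the translation over to \<open>h\<close>, which is the
  recursion of \<open>path_adj\<close>; hence the induction with arbitrary \<open>h\<close>.\<close>

lemma path_adjoint:
  assumes f: "sq_summable edges f" and "sq_summable (carrier G) h" "w \<in> words n"
  shows "l2_inner (carrier G) (\<lambda>x. path_int G g f x w) h = l2_inner edges f (path_adj G g h w)"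
  using assms(2,3)
proof (induction w arbitrary: h)
  case Nil
  then show ?case by simp
next
  case (Cons l w)
  obtain i b where l: "l = (i, b)" by (cases l)
  have i: "i < n" and c: "inv g i \<in> carrier G" "g i \<in> carrier G" and w: "w \<in> words n"
    using Cons.prems by (auto simp: l)
  note h = Cons.prems(1)
  have pw: "sq_summable (carrier G) (\<lambda>x. path_int G g f x w)"
    using path_int_bound[OF f w] by simp
  show ?case
  proof (cases b)
    case True
    have h': "sq_summable (carrier G) (\<lambda>x. h (x \<otimes> inv g i))" using h c by (simp add: sq_summable_shift)
    have "l2_inner (carrier G) (\<lambda>x. path_int G g f x (l # w)) h =
        l2_inner (carrier G) (\<lambda>x. f (i, x)) h + l2_inner (carrier G) (\<lambda>x. path_int G g f (x \<otimes> g i) w) h"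
      using True sq_summable_slice[OF f i] pw h c
      by (simp add: l l2_inner_add_left sq_summable_shift(1)[where h = "\<lambda>x. path_int G g f x w"])
    also have "\<dots> = l2_inner edges f (\<lambda>e. of_bool (fst e = i) * h (snd e)) +
        l2_inner edges f (path_adj G g (\<lambda>x. h (x \<otimes> inv g i)) w)"
      using l2_inner_shift[OF c(2), of "\<lambda>x. path_int G g f x w"] Cons.IH[OF h' w]
      by (simp add: l2_inner_edge[OF i])
    also have "\<dots> = l2_inner edges f (\<lambda>e. of_bool (fst e = i) * h (snd e) +
        path_adj G g (\<lambda>x. h (x \<otimes> inv g i)) w e)"
      using f h sq_summable_path_adj[OF h' w] by (simp add: l2_inner_add_right sq_summable_edge)
    also have "\<dots> = l2_inner edges f (path_adj G g h (l # w))"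
      using True by (intro l2_inner_cong) (auto simp: l)
    finally show ?thesis .
  next
    case False
    have h': "sq_summable (carrier G) (\<lambda>x. h (x \<otimes> g i))" using h c by (simp add: sq_summable_shift)
    have "l2_inner (carrier G) (\<lambda>x. path_int G g f x (l # w)) h =
        - l2_inner (carrier G) (\<lambda>x. f (i, x \<otimes> inv g i)) h
        + l2_inner (carrier G) (\<lambda>x. path_int G g f (x \<otimes> inv g i) w) h"
      using False sq_summable_slice[OF f i] pw h c
      by (simp add: l l2_inner_add_left l2_inner_uminus_left sq_summable_uminus
          del: uminus_add_conv_diff add: sq_summable_shift(1)[where h = "\<lambda>x. path_int G g f x w"]
          sq_summable_shift(1)[where h = "\<lambda>x. f (i, x)"])
    also have "\<dots> = - l2_inner edges f (\<lambda>e. of_bool (fst e = i) * h (snd e \<otimes> g i)) +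
        l2_inner edges f (path_adj G g (\<lambda>x. h (x \<otimes> g i)) w)"
      using l2_inner_shift[OF c(1), of "\<lambda>x. path_int G g f x w"] l2_inner_shift[OF c(1), of "\<lambda>x. f (i, x)"]
        Cons.IH[OF h' w] c l2_inner_edge[OF i, of f "\<lambda>x. h (x \<otimes> g i)"]
      by simp
    also have "\<dots> = l2_inner edges f (\<lambda>e. - (of_bool (fst e = i) * h (snd e \<otimes> g i)) +
        path_adj G g (\<lambda>x. h (x \<otimes> g i)) w e)"
      using f sq_summable_edge[OF h', of i] sq_summable_path_adj[OF h' w]
      by (simp only: l2_inner_add_right l2_inner_uminus_right sq_summable_uminus)
    also have "\<dots> = l2_inner edges f (path_adj G g h (l # w))"
      using False by (intro l2_inner_cong) (auto simp: l)
    finally show ?thesis .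
  qed
qed

lemma chain_int_bound:
  assumes f: "sq_summable edges f" and "set W \<subseteq> words n"
  shows "sq_summable (carrier G) (\<lambda>x. chain_int G g f x W) \<and>
    nrm2 (carrier G) (\<lambda>x. chain_int G g f x W) \<le> chain_bound W * nrm2 edges f"
  using assms(2)
proof (induction W)
  case Nil
  then show ?case by (simp add: chain_int_def sq_summable_0 chain_bound_def) (simp add: nrm2_def)
next
  case (Cons w W)
  have w: "w \<in> words n" and W: "set W \<subseteq> words n" using Cons.prems by auto
  note p = path_int_bound[OF f w]
  note a = sq_summable_add[OF conjunct1[OF p] conjunct1[OF Cons.IH[OF W]]]
  have "nrm2 (carrier G) (\<lambda>x. path_int G g f x w + chain_int G g f x W)
      \<le> 2 * (4 ^ length w * nrm2 edges f) + 2 * (chain_bound W * nrm2 edges f)"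
    using a(2) p Cons.IH[OF W] by linarith
  then show ?case using a(1) by (simp add: chain_int_def chain_bound_def algebra_simps)
qed

lemma sq_summable_chain_adj:
  assumes "sq_summable (carrier G) h" "set W \<subseteq> words n"
  shows "sq_summable edges (chain_adj G g h W)"
  using assms(2)
  by (induction W) (auto simp: chain_adj_def[abs_def] sq_summable_0 intro!: sq_summable_add sq_summable_path_adj assms(1))

lemma chain_adjoint:
  assumes f: "sq_summable edges f" and h: "sq_summable (carrier G) h" and "set W \<subseteq> words n"
  shows "l2_inner (carrier G) (\<lambda>x. chain_int G g f x W) h = l2_inner edges f (chain_adj G g h W)"
  using assms(3)
proof (induction W)
  case Nil
  then show ?case by (simp add: chain_int_def chain_adj_def[abs_def])
next
  case (Cons w W)
  have w: "w \<in> words n" and W: "set W \<subseteq> words n" using Cons.prems by auto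
  have "l2_inner (carrier G) (\<lambda>x. path_int G g f x w + chain_int G g f x W) h
    = l2_inner edges f (\<lambda>e. path_adj G g h w e + chain_adj G g h W e)"
    using Cons.IH[OF W] path_adjoint[OF f h w] path_int_bound[OF f w] chain_int_bound[OF f W]
      sq_summable_path_adj[OF h w] sq_summable_chain_adj[OF h W] f h
    by (simp add: l2_inner_add_left l2_inner_add_right)
  then show ?case by (simp add: chain_int_def chain_adj_def[abs_def])
qed

lemma Ws_subset: "W \<in> set Ws \<Longrightarrow> set W \<subseteq> words n"
  using Ws_words by blast

lemma sq_summable_sum_list:
  "(\<And>W. W \<in> set Vs \<Longrightarrow> sq_summable A (h W)) \<Longrightarrow> sq_summable A (\<lambda>e. \<Sum>W\<leftarrow>Vs. h W e)"
  by (induction Vs) (auto simp: sq_summable_0 intro!: sq_summable_add)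

lemma sq_summable_lap:
  assumes f: "sq_summable edges f"
  shows "sq_summable edges (lap G g Ws f)"
  unfolding lap_def[abs_def]
  using chain_int_bound[OF f] Ws_subset by (intro sq_summable_sum_list sq_summable_chain_adj) auto

lemma lap_inner:
  assumes f: "sq_summable edges f" and h: "sq_summable edges h"
  shows "l2_inner edges (lap G g Ws f) h =
    (\<Sum>W\<leftarrow>Ws. l2_inner (carrier G) (\<lambda>x. chain_int G g f x W) (\<lambda>x. chain_int G g h x W))"
proof -
  have "l2_inner edges (\<lambda>e. \<Sum>W\<leftarrow>Vs. chain_adj G g (\<lambda>x. chain_int G g f x W) W e) h =
      (\<Sum>W\<leftarrow>Vs. l2_inner (carrier G) (\<lambda>x. chain_int G g f x W) (\<lambda>x. chain_int G g h x W))"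
    if "set Vs \<subseteq> set Ws" for Vs
    using that
  proof (induction Vs)
    case (Cons W Vs)
    have W: "set W \<subseteq> words n" using Cons.prems Ws_subset by auto
    have fW: "sq_summable (carrier G) (\<lambda>x. chain_int G g f x V)" if "V \<in> set Ws" for V
      using chain_int_bound[OF f Ws_subset[OF that]] by simp
    have "l2_inner edges (chain_adj G g (\<lambda>x. chain_int G g f x W) W) h =
        cnj (l2_inner (carrier G) (\<lambda>x. chain_int G g h x W) (\<lambda>x. chain_int G g f x W))"
      using chain_adjoint[OF h fW W] Cons.prems by (subst l2_inner_commute) auto
    also have "\<dots> = l2_inner (carrier G) (\<lambda>x. chain_int G g f x W) (\<lambda>x. chain_int G g h x W)"
      by (rule l2_inner_commute[symmetric])
    finally have W_eq: "l2_inner edges (chain_adj G g (\<lambda>x. chain_int G g f x W) W) h =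
      l2_inner (carrier G) (\<lambda>x. chain_int G g f x W) (\<lambda>x. chain_int G g h x W)" .
    have "sq_summable edges (chain_adj G g (\<lambda>x. chain_int G g f x V) V)" if "V \<in> set Ws" for V
      by (intro sq_summable_chain_adj fW Ws_subset that)
    then show ?case
      using Cons.IH Cons.prems W_eq h sq_summable_sum_list[of Vs edges "\<lambda>V. chain_adj G g (\<lambda>x. chain_int G g f x V) V"]
      by (simp add: l2_inner_add_left subset_iff)
  qed simp
  then show ?thesis by (simp add: lap_def[abs_def])
qed

lemma lap_self_adjoint:
  assumes "sq_summable edges f" "sq_summable edges h"
  shows "l2_inner edges (lap G g Ws f) h = l2_inner edges f (lap G g Ws h)"
proof -
  have "cnj (\<Sum>W\<leftarrow>Vs. l2_inner (carrier G) (u W) (v W)) = (\<Sum>W\<leftarrow>Vs. l2_inner (carrier G) (v W) (u W))"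
    for Vs and u v :: "letter list list \<Rightarrow> 'a \<Rightarrow> complex"
    by (induction Vs) (auto simp: l2_inner_commute[of _ "v _"])
  then show ?thesis
    using lap_inner[OF assms] lap_inner[OF assms(2,1)] l2_inner_commute[of edges f] by simp
qed

text \<open>Positivity and the norm bound: they confine the eigenvalues on a finite quotient to the
  interval from 0 to \<open>lap_bound Ws\<close>.\<close>

lemma lap_inner_self:
  assumes f: "sq_summable edges f"
  shows "l2_inner edges (lap G g Ws f) f = of_real (\<Sum>W\<leftarrow>Ws. nrm2 (carrier G) (\<lambda>x. chain_int G g f x W))"
    and "(\<Sum>W\<leftarrow>Ws. nrm2 (carrier G) (\<lambda>x. chain_int G g f x W)) \<le> lap_bound Ws * nrm2 edges f"
proof -
  have *: "(\<Sum>W\<leftarrow>Vs. of_real (u W)) = (of_real (\<Sum>W\<leftarrow>Vs. u W) :: complex)" for Vs and u :: "letter list list \<Rightarrow> real"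
    by (induction Vs) auto
  show "l2_inner edges (lap G g Ws f) f = of_real (\<Sum>W\<leftarrow>Ws. nrm2 (carrier G) (\<lambda>x. chain_int G g f x W))"
    by (simp add: lap_inner[OF f f] l2_inner_self *)
  have "(\<Sum>W\<leftarrow>Ws. nrm2 (carrier G) (\<lambda>x. chain_int G g f x W)) \<le> (\<Sum>W\<leftarrow>Ws. chain_bound W * nrm2 edges f)"
    using chain_int_bound[OF f] Ws_subset by (intro sum_list_mono) auto
  then show "(\<Sum>W\<leftarrow>Ws. nrm2 (carrier G) (\<lambda>x. chain_int G g f x W)) \<le> lap_bound Ws * nrm2 edges f"
    by (simp add: lap_bound_def sum_list_mult_const)
qed

lemma sq_summable_damp: "sq_summable edges f \<Longrightarrow> sq_summable edges (damp G g Ws c f)"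
  unfolding damp_def[abs_def] by (intro sq_summable_diff sq_summable_cmult sq_summable_lap)

lemma sq_summable_damp_pow: "sq_summable edges f \<Longrightarrow> sq_summable edges ((damp G g Ws c ^^ k) f)"
  by (induction k) (auto intro: sq_summable_damp)

lemma damp_self_adjoint:
  assumes "sq_summable edges f" "sq_summable edges h" "c \<in> \<real>"
  shows "l2_inner edges (damp G g Ws c f) h = l2_inner edges f (damp G g Ws c h)"
proof -
  have "cnj c = c" using assms(3) by (simp add: Reals_cnj_iff)
  then show ?thesis
    using assms(1,2) unfolding damp_def[abs_def]
    by (simp add: l2_inner_diff_left l2_inner_diff_right sq_summable_cmult sq_summable_lap
        l2_inner_cmult_left l2_inner_cmult_right lap_self_adjoint)
qed

lemma damp_pow_self_adjoint:
  assumes "sq_summable edges f" "sq_summable edges h" "c \<in> \<real>"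
  shows "l2_inner edges ((damp G g Ws c ^^ k) f) h = l2_inner edges f ((damp G g Ws c ^^ k) h)"
  using assms(1,2)
proof (induction k arbitrary: h)
  case (Suc k)
  have "l2_inner edges ((damp G g Ws c ^^ Suc k) f) h = l2_inner edges ((damp G g Ws c ^^ k) f) (damp G g Ws c h)"
    using Suc.prems assms(3) by (simp add: damp_self_adjoint sq_summable_damp_pow)
  also have "\<dots> = l2_inner edges f ((damp G g Ws c ^^ k) (damp G g Ws c h))"
    using Suc.prems by (intro Suc.IH sq_summable_damp)
  finally show ?case by (simp add: funpow_swap1)
qed simp

section \<open>Finite propagation of the Laplacian\<close>

lemma finitary_path_int:
  assumes "x \<in> carrier G" "w \<in> words n"
  shows "finitary edges (\<lambda>f :: _ \<Rightarrow> 'c::comm_ring_1. path_int G g f x w)"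
  using assms
proof (induction w arbitrary: x)
  case (Cons l w)
  obtain i b where l: "l = (i, b)" by (cases l)
  have p: "finitary edges (\<lambda>f :: _ \<Rightarrow> 'c. path_int G g f (x \<otimes> (if b then g i else inv g i)) w)"
    using Cons.prems by (intro Cons.IH) (auto simp: l)
  have q: "finitary edges (\<lambda>f :: _ \<Rightarrow> 'c. f (i, if b then x else x \<otimes> inv g i))"
    using Cons.prems by (intro finitary_eval) (auto simp: l)
  show ?case
    using finitary_op2[where b = "(+)", OF q p] finitary_op2[where b = "\<lambda>u v. - u + v", OF q p]
    by (cases b) (simp_all add: l)
qed (simp add: finitary_const)

lemma finitary_path_adj:
  assumes "e \<in> edges" "w \<in> words n"
  shows "finitary (carrier G) (\<lambda>h :: _ \<Rightarrow> 'c::comm_ring_1. path_adj G g h w e)"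
  using assms(2)
proof (induction w)
  case (Cons l w)
  obtain i b where l: "l = (i, b)" by (cases l)
  define a where "a = (if b then inv g i else g i)"
  have a: "a \<in> carrier G" using Cons.prems by (auto simp: l a_def)
  have p: "finitary (carrier G) (\<lambda>h :: _ \<Rightarrow> 'c. path_adj G g (\<lambda>x. h (x \<otimes> a)) w e)"
    using Cons a
    by (intro finitary_comp[where \<Phi> = "\<lambda>h. path_adj G g h w e" and \<theta> = "\<lambda>h x. h (x \<otimes> a)" and B = "carrier G"]
        finitary_eval) auto
  have q: "finitary (carrier G) (\<lambda>h :: _ \<Rightarrow> 'c. h (if b then snd e else snd e \<otimes> a))"
    using assms(1) a by (intro finitary_eval) auto
  show ?case
    using finitary_op2[where b = "\<lambda>u v. of_bool (fst e = i) * u + v", OF q p]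
      finitary_op2[where b = "\<lambda>u v. - (of_bool (fst e = i) * u) + v", OF q p]
    by (cases b) (simp_all add: l a_def)
qed (simp add: finitary_const)

lemma finitary_chain_int:
  assumes "x \<in> carrier G" "set W \<subseteq> words n"
  shows "finitary edges (\<lambda>f :: _ \<Rightarrow> 'c::comm_ring_1. chain_int G g f x W)"
  using assms(2) unfolding chain_int_def
  by (induction W) (auto simp: finitary_const intro!: finitary_op2[where b = "(+)"] finitary_path_int assms(1))

lemma finitary_chain_adj:
  assumes "e \<in> edges" "set W \<subseteq> words n"
  shows "finitary (carrier G) (\<lambda>h :: _ \<Rightarrow> 'c::comm_ring_1. chain_adj G g h W e)"
  using assms(2) unfolding chain_adj_def
  by (induction W) (auto simp: finitary_const intro!: finitary_op2[where b = "(+)"] finitary_path_adj assms(1))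

lemma finitary_lap:
  assumes "e \<in> edges"
  shows "finitary edges (\<lambda>f :: _ \<Rightarrow> 'c::comm_ring_1. lap G g Ws f e)"
proof -
  have "finitary edges (\<lambda>f :: _ \<Rightarrow> 'c. chain_adj G g (\<lambda>x. chain_int G g f x W) W e)" if "W \<in> set Ws" for W
    by (rule finitary_comp[OF finitary_chain_adj finitary_chain_int]) (use assms Ws_subset[OF that] in auto)
  then have "finitary edges (\<lambda>f :: _ \<Rightarrow> 'c. \<Sum>W\<leftarrow>Vs. chain_adj G g (\<lambda>x. chain_int G g f x W) W e)"
    if "set Vs \<subseteq> set Ws" for Vs
    using that by (induction Vs) (auto intro: finitary_const finitary_op2[where b = "(+)"])
  then show ?thesis by (simp add: lap_def)
qed

lemma finitary_damp_pow:
  assumes "e \<in> edges"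
  shows "finitary edges (\<lambda>f :: _ \<Rightarrow> 'c::comm_ring_1. (damp G g Ws c ^^ k) f e)"
  using assms
proof (induction k arbitrary: e)
  case 0
  then show ?case by (simp add: finitary_eval)
next
  case (Suc k)
  have "finitary edges (\<lambda>f :: _ \<Rightarrow> 'c. lap G g Ws ((damp G g Ws c ^^ k) f) e)"
    by (rule finitary_comp[OF finitary_lap]) (use Suc in auto)
  note finitary_op2[where b = "\<lambda>u v. u - c * v", OF Suc.IH[OF Suc.prems] this]
  then show ?case by (simp only: damp_pow_Suc)
qed

end

section \<open>Traces and eigenvalues of integer matrices\<close>

lemma trace_mult_comm:
  fixes A B :: "'c::comm_semiring_0 mat"
  assumes A: "A \<in> carrier_mat n m" and B: "B \<in> carrier_mat m n"
  shows "(\<Sum>i<n. (A * B) $$ (i, i)) = (\<Sum>i<m. (B * A) $$ (i, i))"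
proof -
  have "(\<Sum>i<n. (A * B) $$ (i, i)) = (\<Sum>i<n. \<Sum>j<m. A $$ (i, j) * B $$ (j, i))"
    using A B by (intro sum.cong) (auto simp: scalar_prod_def atLeast0LessThan)
  also have "\<dots> = (\<Sum>j<m. \<Sum>i<n. B $$ (j, i) * A $$ (i, j))"
    by (subst sum.swap) (simp add: mult.commute)
  also have "\<dots> = (\<Sum>i<m. (B * A) $$ (i, i))"
    using A B by (intro sum.cong) (auto simp: scalar_prod_def atLeast0LessThan)
  finally show ?thesis .
qed

lemma upper_triangular_pow_diag:
  fixes U :: "'c::comm_ring_1 mat"
  assumes U: "U \<in> carrier_mat n n" "upper_triangular U"
  shows "upper_triangular (U ^\<^sub>m k) \<and> (\<forall>i<n. (U ^\<^sub>m k) $$ (i, i) = (U $$ (i, i)) ^ k)"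
proof (induction k)
  case 0
  show ?case using U by auto
next
  case (Suc k)
  have c: "U ^\<^sub>m k \<in> carrier_mat n n" using U by simp
  have e: "(U ^\<^sub>m Suc k) $$ (i, j) = (\<Sum>l = 0..<n. (U ^\<^sub>m k) $$ (i, l) * U $$ (l, j))"
    if "i < n" "j < n" for i j
    using that U c by (auto simp: scalar_prod_def)
  have z: "(U ^\<^sub>m k) $$ (i, l) * U $$ (l, j) = 0" if "l < i \<or> j < l" "i < n" "l < n" for i j l
    using that Suc U c by (auto dest: upper_triangularD)
  show ?case
  proof (intro conjI allI impI)
    show "upper_triangular (U ^\<^sub>m Suc k)"
    proof (rule upper_triangularI)
      fix i j assume ij: "j < i" "i < dim_row (U ^\<^sub>m Suc k)"
      then have n: "i < n" "j < n" using U by auto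
      show "(U ^\<^sub>m Suc k) $$ (i, j) = 0"
        unfolding e[OF n] using ij n by (intro sum.neutral ballI z) auto
    qed
    fix i assume i: "i < n"
    have "(U ^\<^sub>m Suc k) $$ (i, i) = (\<Sum>l \<in> {i}. (U ^\<^sub>m k) $$ (i, l) * U $$ (l, i))"
      unfolding e[OF i i] using i by (intro sum.mono_neutral_right) (auto intro: z)
    then show "(U ^\<^sub>m Suc k) $$ (i, i) = (U $$ (i, i)) ^ Suc k"
      using Suc i by simp
  qed
qed

text \<open>Schur triangularisation conjugates \<open>A\<close> to \<open>B\<close>, and the same
  \<open>P\<close> and \<open>Q\<close> conjugate \<open>1 - c A\<close> to the triangular
  \<open>1 - c B\<close>. The list \<open>es\<close> is the diagonal of \<open>B\<close>, hence the
  same for all \<open>c\<close> and \<open>k\<close>.\<close>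

lemma trace_pow_eigenvalues:
  fixes A :: "complex mat"
  assumes A: "A \<in> carrier_mat n n"
  obtains es where "char_poly A = (\<Prod>e\<leftarrow>es. [:- e, 1:])" "length es = n"
    "\<And>c k. (\<Sum>i<n. ((1\<^sub>m n - c \<cdot>\<^sub>m A) ^\<^sub>m k) $$ (i, i)) = (\<Sum>e\<leftarrow>es. (1 - c * e) ^ k)"
proof -
  obtain as where as: "char_poly A = (\<Prod>e\<leftarrow>as. [:- e, 1:])"
    using char_poly_factorized[OF A] by blast
  obtain B where B: "B \<in> carrier_mat n n" "upper_triangular B" "similar_mat A B"
    using schur_decomposition_exists[OF A as] by blast
  then obtain P Q where w: "similar_mat_wit A B P Q" by (auto simp: similar_mat_def)
  note d = similar_mat_witD2[OF A w]
  have P: "P \<in> carrier_mat n n" and Q: "Q \<in> carrier_mat n n" and PQ: "P * Q = 1\<^sub>m n"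
    and QP: "Q * P = 1\<^sub>m n" and AB: "A = P * B * Q" using d by auto
  show thesis
  proof (rule that[of "diag_mat B"])
    show "char_poly A = (\<Prod>e\<leftarrow>diag_mat B. [:- e, 1:])"
      using char_poly_similar[OF B(3)] char_poly_upper_triangular[OF B(1,2)] by simp
    show "length (diag_mat B) = n" using B by (simp add: diag_mat_def)
    fix c k
    define U where "U = 1\<^sub>m n - c \<cdot>\<^sub>m B"
    have U: "U \<in> carrier_mat n n" using B by (simp add: U_def minus_carrier_mat)
    have Uu: "upper_triangular U" using B unfolding U_def
      by (intro upper_triangularI) (auto dest: upper_triangularD)
    have "1\<^sub>m n - c \<cdot>\<^sub>m A = P * U * Q"
    proof -
      have "P * U * Q = (P * 1\<^sub>m n - P * (c \<cdot>\<^sub>m B)) * Q"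
        unfolding U_def using P B by (subst mult_minus_distrib_mat[of P n n _ n]) auto
      also have "\<dots> = P * 1\<^sub>m n * Q - P * (c \<cdot>\<^sub>m B) * Q"
        using P B Q by (subst minus_mult_distrib_mat[of _ n n _ _ n]) auto
      also have "P * 1\<^sub>m n * Q = 1\<^sub>m n" using P PQ by simp
      also have "P * (c \<cdot>\<^sub>m B) * Q = c \<cdot>\<^sub>m A"
        unfolding AB using P B Q
        by (simp add: mult_smult_distrib[of P n n B n] mult_smult_assoc_mat[of "P * B" n n Q n])
      finally show ?thesis ..
    qed
    then have w': "similar_mat_wit (1\<^sub>m n - c \<cdot>\<^sub>m A) U P Q"
      using P Q U PQ QP A B
      by (intro similar_mat_witI[of _ _ n]) (auto simp: minus_carrier_mat)
    have "(\<Sum>i<n. ((1\<^sub>m n - c \<cdot>\<^sub>m A) ^\<^sub>m k) $$ (i, i)) = (\<Sum>i<n. (P * (U ^\<^sub>m k * Q)) $$ (i, i))"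
      unfolding similar_mat_wit_pow_id[OF w'] using P Q U
      by (subst assoc_mult_mat[of P n n "U ^\<^sub>m k" n Q n]) auto
    also have "\<dots> = (\<Sum>i<n. ((U ^\<^sub>m k * Q) * P) $$ (i, i))"
      using P Q U by (intro trace_mult_comm) auto
    also have "(U ^\<^sub>m k * Q) * P = U ^\<^sub>m k"
      using P Q U QP by (subst assoc_mult_mat[of _ n n _ n _ n]) auto
    also have "(\<Sum>i<n. (U ^\<^sub>m k) $$ (i, i)) = (\<Sum>i<n. (1 - c * B $$ (i, i)) ^ k)"
      using upper_triangular_pow_diag[OF U Uu] B by (intro sum.cong) (auto simp: U_def)
    also have "\<dots> = (\<Sum>e\<leftarrow>diag_mat B. (1 - c * e) ^ k)"
      using B by (simp add: diag_mat_def interv_sum_list_conv_sum_set_nat atLeast0LessThan o_def)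
    finally show "(\<Sum>i<n. ((1\<^sub>m n - c \<cdot>\<^sub>m A) ^\<^sub>m k) $$ (i, i)) = (\<Sum>e\<leftarrow>diag_mat B. (1 - c * e) ^ k)" .
  qed
qed

text \<open>The regimes are separated at \<open>t = 1 / sqrt k\<close>. Below, the logarithmic term
  alone is at least 1, the factor 2 making up for the square root; above,
  \<open>(1 - t) ^ k \<le> exp (- k t)\<close>. A logarithm is used because the product of the
  nonzero eigenvalues controls the sum of their logarithms.\<close>

lemma pow_one_minus_le_log:
  fixes t M :: real
  assumes t: "0 < t" "t \<le> 1" and k: "2 \<le> k"
  shows "(1 - t) ^ k \<le> 2 * ln (1 / t) / ln (real k) + exp (- sqrt (real k))"
proof -
  have k0: "real k > 0" "ln (real k) > 0" using k by auto
  have l0: "ln (1 / t) \<ge> 0" using t by simp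
  show ?thesis
  proof (cases "t \<le> 1 / sqrt k")
    case True
    have "sqrt k \<le> 1 / t" using True t k0 by (simp add: field_simps)
    then have "ln (sqrt k) \<le> ln (1 / t)" using k0 t by (subst ln_le_cancel_iff) auto
    then have "ln (real k) \<le> 2 * ln (1 / t)" using k0 by (simp add: ln_sqrt)
    then have "1 \<le> 2 * ln (1 / t) / ln (real k)" using k0 by (simp add: field_simps)
    moreover have "(1 - t) ^ k \<le> 1" using t by (intro power_le_one) auto
    ultimately show ?thesis by (smt (verit) exp_gt_zero)
  next
    case False
    have "(1 - t) ^ k \<le> exp (- t) ^ k"
      using t exp_ge_add_one_self[of "-t"] by (intro power_mono) auto
    also have "\<dots> = exp (- (real k * t))" by (simp add: exp_of_nat_mult[symmetric])
    also have "\<dots> \<le> exp (- sqrt k)"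
    proof -
      have "real k * t \<ge> real k * (1 / sqrt k)" using False k0 by (intro mult_left_mono) auto
      then show ?thesis using k0 by (simp add: real_div_sqrt)
    qed
    finally show ?thesis using l0 k0 by (smt (verit) divide_nonneg_pos)
  qed
qed

section \<open>Roots of integer polynomials and the trace estimate\<close>

lemma order_0_pow_mult:
  fixes q :: "'c::idom poly"
  assumes "poly q 0 \<noteq> 0"
  shows "Polynomial.order 0 ([:0, 1:] ^ m * q) = m"
proof -
  have "Polynomial.order 0 ([:0, 1:] ^ m * q) = Polynomial.order 0 ([:- 0, 1:] ^ m :: 'c poly) + Polynomial.order 0 q"
    using assms by (subst order_mult) auto
  also have "\<dots> = m" using order_power_n_n[of 0 m] assms by (simp add: order_0I)
  finally show ?thesis .
qed

text \<open>Splitting off the power of \<open>X\<close> leaves an integer polynomial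
  \<open>q\<close> with nonzero constant term, and the absolute value of that integer is the product
  of the absolute values of the nonzero roots.\<close>

lemma norm_prod_nonzero_roots_ge_1:
  fixes p :: "int poly" and es :: "complex list"
  assumes p: "p \<noteq> 0" and es: "map_poly of_int p = (\<Prod>e\<leftarrow>es. [:- e, 1:])"
  shows "length (filter (\<lambda>e. e = 0) es) = Polynomial.order 0 p"
    and "(\<Prod>e\<leftarrow>filter (\<lambda>e. e \<noteq> 0) es. cmod e) \<ge> 1"
proof -
  obtain q where q: "p = [:- 0, 1:] ^ Polynomial.order 0 p * q" "\<not> [:- 0, 1:] dvd q"
    using order_decomp[OF p] by blast
  have q0: "poly q 0 \<noteq> 0" using q(2) by (simp add: poly_eq_0_iff_dvd)
  define r where "r = Polynomial.order 0 p"
  interpret h: map_poly_comm_ring_hom "of_int :: int \<Rightarrow> complex" ..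
  have pC: "map_poly of_int p = [:0, 1:] ^ r * map_poly (of_int :: int \<Rightarrow> complex) q"
    by (subst q(1)) (simp add: hom_distribs r_def)
  have qC0: "poly (map_poly (of_int :: int \<Rightarrow> complex) q) 0 = of_int (poly q 0)"
    by (simp add: poly_0_coeff_0 coeff_map_poly)
  define zs where "zs = filter (\<lambda>e. e = 0) es"
  define ns where "ns = filter (\<lambda>e. e \<noteq> 0) es"
  have split: "(\<Prod>e\<leftarrow>es. [:- e, 1:]) = [:0, 1:] ^ length zs * (\<Prod>e\<leftarrow>ns. [:- e, 1:])"
  proof -
    have "(\<Prod>e\<leftarrow>es. f e) = (\<Prod>e\<leftarrow>zs. f e) * (\<Prod>e\<leftarrow>ns. f e)" for f :: "complex \<Rightarrow> complex poly"
      unfolding zs_def ns_def by (induction es) (auto simp: mult_ac)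
    moreover have "(\<Prod>e\<leftarrow>zs. [:- e, 1:]) = [:0, 1:] ^ length zs"
      unfolding zs_def by (induction es) auto
    ultimately show ?thesis by simp
  qed
  have pn: "poly (\<Prod>e\<leftarrow>ns. [:- e, 1:]) 0 = (\<Prod>e\<leftarrow>ns. - e)"
    by (induction ns) auto
  have n0: "(\<Prod>e\<leftarrow>ns. - e) \<noteq> 0" unfolding ns_def by (induction es) auto
  have "Polynomial.order 0 (map_poly of_int p :: complex poly) = r"
    unfolding pC using q0 by (intro order_0_pow_mult) (simp add: qC0)
  moreover have "Polynomial.order 0 (map_poly of_int p :: complex poly) = length zs"
    unfolding es split using n0 by (intro order_0_pow_mult) (simp add: pn)
  ultimately have r: "length zs = r" by simp
  then show "length (filter (\<lambda>e. e = 0) es) = Polynomial.order 0 p" by (simp add: r_def zs_def)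
  have "[:0, 1:] ^ r * map_poly (of_int :: int \<Rightarrow> complex) q = [:0, 1:] ^ r * (\<Prod>e\<leftarrow>ns. [:- e, 1:])"
    using pC es split r by simp
  then have "map_poly (of_int :: int \<Rightarrow> complex) q = (\<Prod>e\<leftarrow>ns. [:- e, 1:])" by simp
  then have "of_int (poly q 0) = (\<Prod>e\<leftarrow>ns. - e)" using pn qC0 by simp
  then have "cmod (of_int (poly q 0)) = cmod (\<Prod>e\<leftarrow>ns. - e)" by simp
  also have "\<dots> = (\<Prod>e\<leftarrow>ns. cmod e)" by (induction ns) (auto simp: norm_mult)
  finally have "(\<Prod>e\<leftarrow>ns. cmod e) = real_of_int \<bar>poly q 0\<bar>" by simp
  moreover have "real_of_int \<bar>poly q 0\<bar> \<ge> 1" using q0 by linarith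
  ultimately show "(\<Prod>e\<leftarrow>filter (\<lambda>e. e \<noteq> 0) es. cmod e) \<ge> 1" by (simp add: ns_def)
qed

lemma sum_list_if_filter:
  "(\<Sum>e\<leftarrow>es. if P e then f e else g e) =
    (\<Sum>e\<leftarrow>filter P es. f e) + (\<Sum>e\<leftarrow>filter (\<lambda>e. \<not> P e) es. g e :: 'b::comm_monoid_add)"
  by (induction es) (auto simp: ac_simps)

text \<open>Each zero eigenvalue contributes 1, any other \<open>e\<close> at most the bound of
  \<open>pow_one_minus_le_log\<close> at \<open>t = e / K\<close>. Summing
  \<open>ln K - ln e\<close> costs at most \<open>n ln K\<close>, since the logarithms of the
  nonzero eigenvalues have nonnegative sum. The error per dimension thus depends on \<open>K\<close>
  and \<open>k\<close> only.\<close>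

lemma Re_trace_pow_le:
  fixes A :: "int mat"
  assumes A: "A \<in> carrier_mat n n" and K: "K \<ge> 1" and k: "k \<ge> 2"
    and ev: "\<And>e. eigenvalue (map_mat of_int A :: complex mat) e \<Longrightarrow> e \<in> \<real> \<and> 0 \<le> Re e \<and> Re e \<le> K"
  shows "Re (\<Sum>i<n. ((1\<^sub>m n - of_real (1 / K) \<cdot>\<^sub>m map_mat of_int A) ^\<^sub>m k) $$ (i, i))
    \<le> real (Polynomial.order 0 (char_poly A)) + real n * (2 * ln K / ln (real k) + exp (- sqrt (real k)))"
proof -
  define C where "C = (map_mat of_int A :: complex mat)"
  define b where "b = exp (- sqrt (real k))"
  define L where "L = ln (real k)"
  have L: "L > 0" using k by (simp add: L_def)
  have C: "C \<in> carrier_mat n n" using A by (simp add: C_def)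
  obtain es where es: "char_poly C = (\<Prod>e\<leftarrow>es. [:- e, 1:])" "length es = n"
    "\<And>c k. (\<Sum>i<n. ((1\<^sub>m n - c \<cdot>\<^sub>m C) ^\<^sub>m k) $$ (i, i)) = (\<Sum>e\<leftarrow>es. (1 - c * e) ^ k)"
    using trace_pow_eigenvalues[OF C] by blast
  have p0: "char_poly A \<noteq> 0" using degree_monic_char_poly[OF A] by auto
  have "map_poly of_int (char_poly A) = (\<Prod>e\<leftarrow>es. [:- e, 1:])"
    using of_int_hom.char_poly_hom[where 'a=complex, OF A] es(1) by (simp add: C_def)
  note zn = norm_prod_nonzero_roots_ge_1[OF p0 this]
  have ev': "e \<in> \<real> \<and> 0 \<le> Re e \<and> Re e \<le> K" if "e \<in> set es" for e
  proof -
    have "poly (\<Prod>e\<leftarrow>es. [:- e, 1:]) e = 0" using that by (induction es) auto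
    then show ?thesis using ev[of e] eigenvalue_root_char_poly[OF C] es(1) by (simp add: C_def)
  qed
  define ns where "ns = filter (\<lambda>e. e \<noteq> 0) es"
  have "Re (\<Sum>e\<leftarrow>es. (1 - of_real (1 / K) * e) ^ k) = (\<Sum>e\<leftarrow>es. Re ((1 - of_real (1 / K) * e) ^ k))"
    by (induction es) auto
  also have "\<dots> \<le> (\<Sum>e\<leftarrow>es. if e = 0 then 1 else 2 * (ln K - ln (cmod e)) / L + b)"
  proof (rule sum_list_mono)
    fix e assume e: "e \<in> set es"
    show "Re ((1 - of_real (1 / K) * e) ^ k) \<le> (if e = 0 then 1 else 2 * (ln K - ln (cmod e)) / L + b)"
    proof (cases "e = 0")
      case False
      obtain x where x: "e = of_real x" using ev'[OF e] by (auto elim: Reals_cases)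
      have x': "0 < x" "x \<le> K" using ev'[OF e] False x by auto
      have "Re ((1 - of_real (1 / K) * e) ^ k) = (1 - x / K) ^ k"
      proof -
        have "(1 - of_real (1 / K) * e) ^ k = of_real ((1 - x / K) ^ k)" by (simp add: x)
        then show ?thesis by (metis Re_complex_of_real)
      qed
      also have "\<dots> \<le> 2 * ln (1 / (x / K)) / ln (real k) + exp (- sqrt (real k))"
        using x' K k by (intro pow_one_minus_le_log) auto
      also have "ln (1 / (x / K)) = ln K - ln (cmod e)" using x' K x by (simp add: ln_div)
      finally show ?thesis using False by (simp add: L_def b_def)
    qed auto
  qed
  also have "\<dots> = (\<Sum>e\<leftarrow>filter (\<lambda>e. e = 0) es. 1) + (\<Sum>e\<leftarrow>ns. 2 * (ln K - ln (cmod e)) / L + b)"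
    unfolding sum_list_if_filter ns_def by simp
  also have "(\<Sum>e\<leftarrow>filter (\<lambda>e. e = 0) es. 1) = real (Polynomial.order 0 (char_poly A))"
    using zn(1) by (simp add: sum_list_triv)
  also have "(\<Sum>e\<leftarrow>ns. 2 * (ln K - ln (cmod e)) / L + b)
    = real (length ns) * (2 * ln K / L + b) - 2 / L * (\<Sum>e\<leftarrow>ns. ln (cmod e))"
    by (induction ns) (auto simp: algebra_simps add_divide_distrib diff_divide_distrib)
  also have "(\<Sum>e\<leftarrow>ns. ln (cmod e)) = ln (\<Prod>e\<leftarrow>ns. cmod e) \<and> (\<Prod>e\<leftarrow>ns. cmod e) > 0"
    unfolding ns_def by (induction es) (auto simp: ln_mult)
  then have "(\<Sum>e\<leftarrow>ns. ln (cmod e)) \<ge> 0" using zn(2) by (simp add: ns_def)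
  then have "real (length ns) * (2 * ln K / L + b) - 2 / L * (\<Sum>e\<leftarrow>ns. ln (cmod e))
    \<le> real (length ns) * (2 * ln K / L + b)" using L by simp
  also have "\<dots> \<le> real n * (2 * ln K / L + b)"
  proof (rule mult_right_mono)
    show "real (length ns) \<le> real n" using es(2) length_filter_le[of _ es] by (simp add: ns_def)
    show "0 \<le> 2 * ln K / L + b" using K L by (auto simp: b_def)
  qed
  finally show ?thesis using es(3) by (simp add: C_def L_def b_def)
qed

section \<open>Kernels of symmetric integer matrices\<close>

lemma mult_mat_vec_eq_0_iff:
  fixes A :: "'c::comm_ring mat"
  assumes "A \<in> carrier_mat n n" "x \<in> carrier_vec n"
  shows "A *\<^sub>v x = 0\<^sub>v n \<longleftrightarrow> (\<forall>i<n. (\<Sum>l<n. A $$ (i, l) * x $ l) = 0)"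
proof -
  have "(A *\<^sub>v x) $ i = (\<Sum>l<n. A $$ (i, l) * x $ l)" if "i < n" for i
    using that assms by (auto simp: scalar_prod_def atLeast0LessThan)
  moreover have "A *\<^sub>v x = 0\<^sub>v n \<longleftrightarrow> (\<forall>i<n. (A *\<^sub>v x) $ i = 0)"
    using assms by (auto simp: vec_eq_iff)
  ultimately show ?thesis by simp
qed

lemma det_nonzeroI:
  fixes A :: "'c::idom mat"
  assumes A: "A \<in> carrier_mat n n"
    and inj: "\<And>x i. x \<in> carrier_vec n \<Longrightarrow> (\<And>i. i < n \<Longrightarrow> (\<Sum>l<n. A $$ (i, l) * x $ l) = 0) \<Longrightarrow>
      i < n \<Longrightarrow> x $ i = 0"
  shows "det A \<noteq> 0"
proof
  assume "det A = 0"
  then obtain x where x: "x \<in> carrier_vec n" "x \<noteq> 0\<^sub>v n" "A *\<^sub>v x = 0\<^sub>v n"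
    using det_0_iff_vec_prod_zero[OF A] by blast
  then have "x $ i = 0" if "i < n" for i
    using inj[OF x(1) _ that] mult_mat_vec_eq_0_iff[OF A x(1)] by blast
  then have "x = 0\<^sub>v n" using x(1) by auto
  then show False using x(2) by simp
qed

text \<open>
  Take a minimal set \<open>I\<close> of coordinates such that a kernel vector vanishing on \<open>I\<close> is zero.
  Multiplying \<open>X - A\<close> by the matrix \<open>W\<close> with columns \<open>v i\<close> (\<open>i \<in> I\<close>) and unit vectors
  splits off the factor \<open>X\<close> exactly \<open>card I\<close> times, since kernel and image of \<open>A\<close> are
  orthogonal.
\<close>
lemma symmetric_integer_kernel:
  fixes A :: "int mat"
  assumes A: "A \<in> carrier_mat n n"
    and sym: "\<And>i j. i < n \<Longrightarrow> j < n \<Longrightarrow> A $$ (i, j) = A $$ (j, i)"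
  obtains I :: "nat set" and v :: "nat \<Rightarrow> nat \<Rightarrow> int"
  where "I \<subseteq> {..<n}" "card I = Polynomial.order 0 (char_poly A)"
    "\<And>i a. i \<in> I \<Longrightarrow> a < n \<Longrightarrow> (\<Sum>l<n. A $$ (a, l) * v i l) = 0"
    "\<And>i. i \<in> I \<Longrightarrow> v i i \<noteq> 0"
    "\<And>i j. i \<in> I \<Longrightarrow> j \<in> I \<Longrightarrow> j \<noteq> i \<Longrightarrow> v i j = 0"
proof -
  define ker where "ker x \<longleftrightarrow> (\<forall>a<n. (\<Sum>l<n. A $$ (a, l) * x l) = 0)" for x :: "nat \<Rightarrow> int"
  define P where "P I \<longleftrightarrow> I \<subseteq> {..<n} \<and> (\<forall>x. ker x \<and> (\<forall>i\<in>I. x i = 0) \<longrightarrow> (\<forall>i<n. x i = 0))" for I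
  have "P {..<n}" by (auto simp: P_def)
  then obtain I where I: "P I" and Imin: "\<And>J. P J \<Longrightarrow> card I \<le> card J"
    using ex_has_least_nat[of P "{..<n}" card] by blast
  have In: "I \<subseteq> {..<n}" using I by (simp add: P_def)
  then have finI: "finite I" by (rule finite_subset) simp
  \<comment> \<open>By minimality of \<open>I\<close>, dropping \<open>i\<close> admits a nonzero
    kernel vector that vanishes on the rest of \<open>I\<close>; it cannot vanish at
    \<open>i\<close>.\<close>
  have "\<exists>x. ker x \<and> x i \<noteq> 0 \<and> (\<forall>j\<in>I. j \<noteq> i \<longrightarrow> x j = 0)" if i: "i \<in> I" for i
  proof -
    have "card (I - {i}) < card I" using card_Diff1_less[OF finI i] .
    then have "\<not> P (I - {i})" using Imin by (meson not_le)
    then obtain x where x: "ker x" "\<forall>j\<in>I - {i}. x j = 0" "\<exists>j<n. x j \<noteq> 0"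
      using In by (auto simp: P_def)
    then have "x i \<noteq> 0" using I unfolding P_def by blast
    then show ?thesis using x by blast
  qed
  then obtain v where v: "\<And>i. i \<in> I \<Longrightarrow> ker (v i)" "\<And>i. i \<in> I \<Longrightarrow> v i i \<noteq> 0"
    "\<And>i j. i \<in> I \<Longrightarrow> j \<in> I \<Longrightarrow> j \<noteq> i \<Longrightarrow> v i j = 0" by metis
  define W where "W = mat n n (\<lambda>(a, j). if j \<in> I then v j a else of_bool (a = j))"
  define M where "M = mat n n (\<lambda>(a, j). if j \<in> I then [:v j a:]
    else (if a = j then [:0, 1:] else 0) - [:A $$ (a, j):])"
  define D where "D = mat n n (\<lambda>(a, j). if a = j then (if j \<in> I then [:0, 1:] else 1) else 0 :: int poly)"
  define Wp where "Wp = map_mat (\<lambda>a. [:a:]) W"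
  have carr: "W \<in> carrier_mat n n" "M \<in> carrier_mat n n" "D \<in> carrier_mat n n" "Wp \<in> carrier_mat n n"
    "char_poly_matrix A \<in> carrier_mat n n"
    using A by (auto simp: W_def M_def D_def Wp_def)
  \<comment> \<open>Evaluation at 0 turns \<open>det Wp\<close> and \<open>det M\<close> into
    integer determinants. Once these are nonzero, only \<open>det D\<close> contributes to the order
    of vanishing at 0.\<close>
  have "comm_ring_hom (\<lambda>p :: int poly. poly p 0)" by unfold_locales auto
  note eval0_det = comm_ring_hom.hom_det[OF this]
  have sum_C: "(\<Sum>l\<in>S. [:f l:]) = [:sum f S:]" for f :: "nat \<Rightarrow> int" and S
    by (induction S rule: infinite_finite_induct) auto
  have "char_poly_matrix A * Wp = M * D"
  proof (rule eq_matI)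
    fix a j assume "a < dim_row (M * D)" "j < dim_col (M * D)"
    then have aj: "a < n" "j < n" using carr by auto
    have "(char_poly_matrix A * Wp) $$ (a, j) =
      (\<Sum>l<n. ((if a = l then [:0, 1:] else 0) - [:A $$ (a, l):]) * [:W $$ (l, j):])"
      using aj A carr by (auto simp: scalar_prod_def Wp_def char_poly_matrix_def atLeast0LessThan intro!: sum.cong)
    also have "\<dots> = (\<Sum>l<n. if a = l then [:0, 1:] * [:W $$ (l, j):] else 0) - (\<Sum>l<n. [:A $$ (a, l) * W $$ (l, j):])"
      unfolding sum_subtractf[symmetric] by (intro sum.cong) (auto simp: algebra_simps)
    also have "\<dots> = [:0, 1:] * [:W $$ (a, j):] - [:(\<Sum>l<n. A $$ (a, l) * W $$ (l, j)):]"
      using aj by (simp add: sum_C)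
    also have "\<dots> = (if j \<in> I then [:0, 1:] * [:v j a:] else (if a = j then [:0, 1:] else 0) - [:A $$ (a, j):])"
    proof (cases "j \<in> I")
      case True
      have "(\<Sum>l<n. A $$ (a, l) * W $$ (l, j)) = (\<Sum>l<n. A $$ (a, l) * v j l)"
        using True aj by (intro sum.cong) (auto simp: W_def)
      also have "\<dots> = 0" using v(1)[OF True] aj by (auto simp: ker_def)
      finally show ?thesis using True aj by (simp add: W_def)
    next
      case False
      have "(\<Sum>l<n. A $$ (a, l) * W $$ (l, j)) = (\<Sum>l<n. if l = j then A $$ (a, l) else 0)"
        using False aj by (intro sum.cong) (auto simp: W_def)
      then show ?thesis using False aj by (simp add: W_def)
    qed
    also have "\<dots> = M $$ (a, j) * (if j \<in> I then [:0, 1:] else 1)"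
      using aj by (simp add: M_def)
    also have "\<dots> = (M * D) $$ (a, j)"
    proof -
      have "(M * D) $$ (a, j) = (\<Sum>l<n. M $$ (a, l) * D $$ (l, j))"
        using aj carr by (auto simp: scalar_prod_def atLeast0LessThan)
      also have "\<dots> = (\<Sum>l<n. if l = j then M $$ (a, j) * D $$ (j, j) else 0)"
        using aj by (intro sum.cong) (auto simp: D_def)
      finally show ?thesis using aj by (simp add: D_def)
    qed
    finally show "(char_poly_matrix A * Wp) $$ (a, j) = (M * D) $$ (a, j)" .
  qed (use carr in auto)
  then have "char_poly A * det Wp = det M * det D"
    unfolding char_poly_def using carr by (metis det_mult)
  moreover have "det D = [:0, 1:] ^ card I"
  proof -
    have "det D = (\<Prod>j<n. if j \<in> I then [:0, 1:] else 1)"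
      using carr by (subst det_upper_triangular[of D n])
        (auto simp: D_def prod_list_diag_prod atLeast0LessThan intro!: prod.cong)
    also have "\<dots> = (\<Prod>j\<in>I. [:0, 1:])"
      using In by (simp add: prod.If_cases Int_absorb1)
    finally show ?thesis by simp
  qed
  ultimately have eq: "char_poly A * det Wp = [:0, 1:] ^ card I * det M" by (simp add: mult.commute)
  have "det W \<noteq> 0"
  proof (rule det_nonzeroI[OF carr(1)])
    fix x i assume x: "x \<in> carrier_vec n" "\<And>i. i < n \<Longrightarrow> (\<Sum>l<n. W $$ (i, l) * x $ l) = 0" and i: "i < n"
    have xI: "x $ i = 0" if i: "i \<in> I" for i
    proof -
      have "(\<Sum>l<n. W $$ (i, l) * x $ l) = (\<Sum>l<n. if l = i then v i i * x $ i else 0)"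
        using i In v(3) by (intro sum.cong) (auto simp: W_def)
      then show ?thesis using x(2)[of i] i In v(2) by auto
    qed
    have "(\<Sum>l<n. W $$ (i, l) * x $ l) = (\<Sum>l<n. if l = i then x $ i else 0)" if "i \<notin> I"
      using i that xI by (intro sum.cong) (auto simp: W_def)
    then show "x $ i = 0" using xI x(2)[OF i] i by fastforce
  qed
  moreover have "map_mat (\<lambda>p. poly p 0) Wp = W" by (rule eq_matI) (auto simp: Wp_def)
  ultimately have Wp0: "poly (det Wp) 0 \<noteq> 0" by (simp flip: eval0_det)
  have M0: "map_mat (\<lambda>p. poly p 0) M = mat n n (\<lambda>(a, j). if j \<in> I then v j a else - A $$ (a, j))"
    by (rule eq_matI) (auto simp: M_def)
  have "det (mat n n (\<lambda>(a, j). if j \<in> I then v j a else - A $$ (a, j))) \<noteq> 0" (is "det ?N \<noteq> 0")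
  proof (rule det_nonzeroI)
    fix x i assume x: "x \<in> carrier_vec n" "\<And>i. i < n \<Longrightarrow> (\<Sum>l<n. ?N $$ (i, l) * x $ l) = 0" and i: "i < n"
    \<comment> \<open>\<open>y\<close> is in the kernel of \<open>A\<close> by construction and
      equals \<open>A z\<close> by the assumption on \<open>x\<close>; symmetry gives
      \<open>y . y = (A y) . z = 0\<close>.\<close>
    define y where "y a = (\<Sum>j\<in>I. v j a * x $ j)" for a
    define z where "z j = (if j \<in> I then 0 else x $ j)" for j
    have yz: "y a = (\<Sum>l<n. A $$ (a, l) * z l)" if a: "a < n" for a
    proof -
      have "(\<Sum>l<n. ?N $$ (a, l) * x $ l) = (\<Sum>l<n. (if l \<in> I then v l a * x $ l else 0) - A $$ (a, l) * z l)"
        using a by (intro sum.cong) (auto simp: z_def)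
      also have "\<dots> = (\<Sum>l<n. if l \<in> I then v l a * x $ l else 0) - (\<Sum>l<n. A $$ (a, l) * z l)"
        by (simp add: sum_subtractf)
      also have "(\<Sum>l<n. if l \<in> I then v l a * x $ l else 0) = y a"
        using In by (simp add: sum.If_cases Int_absorb1 y_def)
      finally show ?thesis using x(2)[OF a] by simp
    qed
    have Ay: "(\<Sum>l<n. A $$ (a, l) * y l) = 0" if a: "a < n" for a
    proof -
      have "(\<Sum>l<n. A $$ (a, l) * y l) = (\<Sum>j\<in>I. x $ j * (\<Sum>l<n. A $$ (a, l) * v j l))"
        unfolding y_def sum_distrib_left by (subst sum.swap) (simp add: mult_ac)
      also have "\<dots> = 0" using v(1) a by (intro sum.neutral) (auto simp: ker_def)
      finally show ?thesis .
    qed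
    have "(\<Sum>a<n. y a * y a) = (\<Sum>a<n. \<Sum>l<n. A $$ (l, a) * y a * z l)"
    proof (intro sum.cong)
      fix a assume a: "a \<in> {..<n}"
      then have "y a * y a = (\<Sum>l<n. y a * (A $$ (a, l) * z l))"
        using yz by (simp add: sum_distrib_left)
      also have "\<dots> = (\<Sum>l<n. A $$ (l, a) * y a * z l)"
      proof (intro sum.cong)
        fix l assume "l \<in> {..<n}"
        then have "A $$ (a, l) = A $$ (l, a)" using a sym by simp
        then show "y a * (A $$ (a, l) * z l) = A $$ (l, a) * y a * z l" by simp
      qed simp
      finally show "y a * y a = (\<Sum>l<n. A $$ (l, a) * y a * z l)" .
    qed simp
    also have "\<dots> = (\<Sum>l<n. z l * (\<Sum>a<n. A $$ (l, a) * y a))"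
      by (subst sum.swap) (simp add: sum_distrib_left mult_ac)
    also have "\<dots> = 0" using Ay by simp
    finally have y0: "y a = 0" if "a < n" for a
      using that by (subst (asm) sum_nonneg_eq_0_iff) auto
    have xI: "x $ i = 0" if i: "i \<in> I" for i
    proof -
      have "y i = (\<Sum>j\<in>I. if j = i then v i i * x $ i else 0)"
        unfolding y_def using v(3) i by (intro sum.cong) auto
      then have "v i i * x $ i = 0" using y0[of i] i In finI by auto
      then show ?thesis using v(2) i by auto
    qed
    have "ker z" using yz y0 by (auto simp: ker_def)
    moreover have "\<forall>i\<in>I. z i = 0" by (simp add: z_def)
    ultimately have "z i = 0" using I i unfolding P_def by blast
    then show "x $ i = 0" using xI by (auto simp: z_def split: if_splits)
  qed auto
  then have "poly (det M) 0 \<noteq> 0" by (simp flip: eval0_det M0)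
  then have "Polynomial.order 0 (char_poly A * det Wp) = card I" unfolding eq by (rule order_0_pow_mult)
  moreover have "char_poly A \<noteq> 0" using degree_monic_char_poly[OF A] by auto
  ultimately have "Polynomial.order 0 (char_poly A) = card I"
    using Wp0 by (subst (asm) order_mult) (auto simp: order_0I)
  then show thesis using that[of I v] In v by (auto simp: ker_def)
qed

section \<open>Harmonic chains\<close>

lemma damp_eq: "damp G g Ws c f = (\<lambda>e. f e - c * lap G g Ws f e)"
  by (rule ext) (simp add: damp_def)

text \<open>The map \<open>\<sigma>\<close> is only tied to right multiplication by generators,
  because it stands for two kinds of map: the projection to a quotient group, and a left translation
  of \<open>G\<close>, which in general is no homomorphism.\<close>

locale cayley_map = cayley G n g Ws for G (structure) and n g Ws +
  fixes Q :: "('q, 'r) monoid_scheme" and g' :: "nat \<Rightarrow> 'q" and \<sigma> :: "'a \<Rightarrow> 'q"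
  assumes map_gen: "i < n \<Longrightarrow> x \<in> carrier G \<Longrightarrow> \<sigma> (x \<otimes> g i) = \<sigma> x \<otimes>\<^bsub>Q\<^esub> g' i"
    and map_inv_gen: "i < n \<Longrightarrow> x \<in> carrier G \<Longrightarrow> \<sigma> (x \<otimes> inv g i) = \<sigma> x \<otimes>\<^bsub>Q\<^esub> inv\<^bsub>Q\<^esub> (g' i)"
begin

lemma path_int_map:
  assumes f: "\<And>i x. i < n \<Longrightarrow> x \<in> carrier G \<Longrightarrow> f (i, x) = f' (i, \<sigma> x)"
  shows "x \<in> carrier G \<Longrightarrow> w \<in> words n \<Longrightarrow> path_int G g f x w = path_int Q g' f' (\<sigma> x) w"
proof (induction w arbitrary: x)
  case (Cons l w)
  then show ?case
    by (cases l; cases "snd l") (auto simp: f map_gen map_inv_gen)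
qed simp

lemma path_adj_map:
  assumes "\<And>x. x \<in> carrier G \<Longrightarrow> h x = h' (\<sigma> x)" "x \<in> carrier G" "w \<in> words n"
  shows "path_adj G g h w (i, x) = path_adj Q g' h' w (i, \<sigma> x)"
  using assms(1,3)
proof (induction w arbitrary: h h')
  case (Cons l w)
  obtain j b where l: "l = (j, b)" by (cases l)
  have j: "j < n" and w: "w \<in> words n" using Cons.prems by (auto simp: l)
  note h = Cons.prems(1)
  show ?case
  proof (cases b)
    case True
    have "path_adj G g (\<lambda>x. h (x \<otimes> inv g j)) w (i, x) =
        path_adj Q g' (\<lambda>x. h' (x \<otimes>\<^bsub>Q\<^esub> inv\<^bsub>Q\<^esub> (g' j))) w (i, \<sigma> x)"
      using h j by (intro Cons.IH[OF _ w]) (simp add: map_inv_gen[OF j])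
    then show ?thesis using True h assms(2) by (simp add: l)
  next
    case False
    have "path_adj G g (\<lambda>x. h (x \<otimes> g j)) w (i, x) =
        path_adj Q g' (\<lambda>x. h' (x \<otimes>\<^bsub>Q\<^esub> g' j)) w (i, \<sigma> x)"
      using h j by (intro Cons.IH[OF _ w]) (simp add: map_gen[OF j])
    then show ?thesis using False h[of "x \<otimes> g j"] assms(2) j by (simp add: l map_gen)
  qed
qed simp

lemma chain_int_map:
  assumes "\<And>i x. i < n \<Longrightarrow> x \<in> carrier G \<Longrightarrow> f (i, x) = f' (i, \<sigma> x)"
    and "x \<in> carrier G" "set W \<subseteq> words n"
  shows "chain_int G g f x W = chain_int Q g' f' (\<sigma> x) W"
  unfolding chain_int_def using assms path_int_map[of f f' x]
  by (intro arg_cong[of _ _ sum_list] map_cong) auto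

lemma lap_map:
  assumes f: "\<And>i x. i < n \<Longrightarrow> x \<in> carrier G \<Longrightarrow> f (i, x) = f' (i, \<sigma> x)" and x: "x \<in> carrier G"
  shows "lap G g Ws f (i, x) = lap Q g' Ws f' (i, \<sigma> x)"
  unfolding lap_def
proof (intro arg_cong[of _ _ sum_list] map_cong)
  fix W assume W: "W \<in> set Ws"
  have "path_adj G g (\<lambda>x. chain_int G g f x W) w (i, x) =
      path_adj Q g' (\<lambda>x. chain_int Q g' f' x W) w (i, \<sigma> x)" if "w \<in> set W" for w
    using that Ws_words[OF W] Ws_subset[OF W] f x
    by (intro path_adj_map chain_int_map) auto
  then show "chain_adj G g (\<lambda>x. chain_int G g f x W) W (i, x) =
      chain_adj Q g' (\<lambda>x. chain_int Q g' f' x W) W (i, \<sigma> x)"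
    unfolding chain_adj_def by (intro arg_cong[of _ _ sum_list] map_cong) auto
qed simp

lemma damp_pow_map:
  assumes f: "\<And>i x. i < n \<Longrightarrow> x \<in> carrier G \<Longrightarrow> f (i, x) = f' (i, \<sigma> x)"
  shows "i < n \<Longrightarrow> x \<in> carrier G \<Longrightarrow> (damp G g Ws c ^^ k) f (i, x) = (damp Q g' Ws c ^^ k) f' (i, \<sigma> x)"
proof (induction k arbitrary: i x)
  case (Suc k)
  have "lap G g Ws ((damp G g Ws c ^^ k) f) (i, x) = lap Q g' Ws ((damp Q g' Ws c ^^ k) f') (i, \<sigma> x)"
    using Suc by (intro lap_map) auto
  then show ?case using Suc by (simp only: damp_pow_Suc)
qed (simp add: f)

end

section \<open>Harmonic functions and their projection\<close>

abbreviation delta :: "'i \<Rightarrow> 'i \<Rightarrow> 'c::zero_neq_one" where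
  "delta a \<equiv> \<lambda>b. of_bool (b = a)"

lemma sq_summable_delta: "sq_summable A (delta a)"
  by (rule sq_summable_finite_support[of "{a}"]) auto

lemma l2_inner_delta:
  assumes "a \<in> A"
  shows "l2_inner A f (delta a) = f a"
proof -
  have "l2_inner A f (delta a) = (\<Sum>\<^sub>\<infinity>x\<in>{a}. f x)"
    unfolding l2_inner_def using assms by (intro infsum_cong_neutral) auto
  then show ?thesis by simp
qed

context cayley
begin

text \<open>The common kernel of the operators \<open>b\<^sub>W\<close> instead of the kernel of
  \<open>lap\<close>: each equation involves finitely many coordinates, so pointwise limits preserve
  it, and it makes sense over any ring. By positivity, square-summable complex functions killed by
  \<open>lap\<close> are harmonic.\<close>

definition harmonic :: "(nat \<times> 'a \<Rightarrow> 'c::comm_ring_1) \<Rightarrow> bool" where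
  "harmonic f \<longleftrightarrow> (\<forall>W\<in>set Ws. \<forall>x\<in>carrier G. chain_int G g f x W = 0)"

lemma harmonic_lap_inner:
  assumes "sq_summable edges f" "sq_summable edges h" "harmonic f"
  shows "l2_inner edges (lap G g Ws f) h = 0"
proof -
  have "l2_inner (carrier G) (\<lambda>x. chain_int G g f x W) (\<lambda>x. chain_int G g h x W) = 0" if "W \<in> set Ws" for W
  proof -
    have "l2_inner (carrier G) (\<lambda>x. chain_int G g f x W) (\<lambda>x. chain_int G g h x W) =
        l2_inner (carrier G) (\<lambda>_. 0) (\<lambda>x. chain_int G g h x W)"
      using assms(3) that by (intro l2_inner_cong) (auto simp: harmonic_def)
    then show ?thesis by simp
  qed
  then have "map (\<lambda>W. l2_inner (carrier G) (\<lambda>x. chain_int G g f x W) (\<lambda>x. chain_int G g h x W)) Ws =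
      map (\<lambda>_. 0) Ws" by (intro map_cong) auto
  then show ?thesis unfolding lap_inner[OF assms(1,2)] by (simp only: sum_list_0)
qed

lemma harmonic_if_lap_zero:
  assumes f: "sq_summable edges f" and z: "\<And>e. e \<in> edges \<Longrightarrow> lap G g Ws f e = 0"
  shows "harmonic f"
proof -
  have "l2_inner edges (lap G g Ws f) f = l2_inner edges (\<lambda>_. 0) f"
    using z by (intro l2_inner_cong) auto
  then have "(\<Sum>W\<leftarrow>Ws. nrm2 (carrier G) (\<lambda>x. chain_int G g f x W)) = 0"
    using lap_inner_self(1)[OF f] by simp
  then have z: "nrm2 (carrier G) (\<lambda>x. chain_int G g f x W) = 0" if "W \<in> set Ws" for W
    using that by (subst (asm) sum_list_nonneg_eq_0_iff) (auto simp: nrm2_nonneg)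
  have "chain_int G g f x W = 0" if "W \<in> set Ws" "x \<in> carrier G" for W x
    using nrm2_eq_0_iff[OF conjunct1[OF chain_int_bound[OF f Ws_subset[OF that(1)]]]] z[OF that(1)] that(2)
    by blast
  then show ?thesis by (simp add: harmonic_def)
qed

lemma damp_pow_inner_harmonic:
  assumes u: "sq_summable edges u" and f: "sq_summable edges f" "harmonic f" and c: "c \<in> \<real>"
  shows "l2_inner edges ((damp G g Ws c ^^ k) u) f = l2_inner edges u f"
proof (induction k)
  case (Suc k)
  define v where "v = (damp G g Ws c ^^ k) u"
  have u': "sq_summable edges v" unfolding v_def using u by (rule sq_summable_damp_pow)
  have "l2_inner edges (lap G g Ws v) f = l2_inner edges v (lap G g Ws f)"
    by (rule lap_self_adjoint[OF u' f(1)])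
  also have "\<dots> = cnj (l2_inner edges (lap G g Ws f) v)" by (rule l2_inner_commute)
  also have "\<dots> = 0" using harmonic_lap_inner[OF f(1) u' f(2)] by simp
  finally have "l2_inner edges (damp G g Ws c v) f = l2_inner edges v f"
    unfolding damp_eq using u' f
    by (simp add: l2_inner_diff_left sq_summable_cmult sq_summable_lap l2_inner_cmult_left)
  then show ?case using Suc by (simp add: v_def)
qed simp

lemma tendsto_path_int:
  fixes p :: "nat \<times> 'a \<Rightarrow> complex"
  assumes "\<And>e. (\<lambda>k. s k e) \<longlonglongrightarrow> p e"
  shows "(\<lambda>k. path_int G g (s k) x w) \<longlonglongrightarrow> path_int G g p x w"
proof (induction w arbitrary: x)
  case (Cons l w)
  show ?case
    by (cases l; cases "snd l") (auto intro!: tendsto_intros assms Cons.IH)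
qed simp

lemma tendsto_chain_int:
  fixes p :: "nat \<times> 'a \<Rightarrow> complex"
  assumes "\<And>e. (\<lambda>k. s k e) \<longlonglongrightarrow> p e"
  shows "(\<lambda>k. chain_int G g (s k) x W) \<longlonglongrightarrow> chain_int G g p x W"
  unfolding chain_int_def by (induction W) (auto intro!: tendsto_intros tendsto_path_int assms)

lemma harmonic_subspace: "l2_closed_subspace edges {f \<in> l2 edges. harmonic f}"
proof
  show "(\<lambda>_. 0) \<in> {f \<in> l2 edges. harmonic f}"
    using chain_int_cmult[of G g 0 "\<lambda>_. 0 :: complex"]
    by (auto simp: l2_iff sq_summable_0 harmonic_def)
  fix f h :: "nat \<times> 'a \<Rightarrow> complex" and c
  assume f: "f \<in> {f \<in> l2 edges. harmonic f}"
  then show "(\<lambda>x. c * f x) \<in> {f \<in> l2 edges. harmonic f}"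
    by (auto simp: l2_iff harmonic_def chain_int_cmult intro: sq_summable_cmult)
  assume "h \<in> {f \<in> l2 edges. harmonic f}"
  with f show "(\<lambda>x. f x + h x) \<in> {f \<in> l2 edges. harmonic f}"
    by (auto simp: l2_iff harmonic_def chain_int_add intro: sq_summable_add)
next
  fix s p assume s: "\<And>k. s k \<in> {f \<in> l2 edges. harmonic f}" and p: "p \<in> l2 edges"
    and lim: "\<And>x. (\<lambda>k. s k x) \<longlonglongrightarrow> p x"
  have "chain_int G g p x W = 0" if "W \<in> set Ws" "x \<in> carrier G" for W x
  proof (rule LIMSEQ_unique)
    show "(\<lambda>k. chain_int G g (s k) x W) \<longlonglongrightarrow> chain_int G g p x W"
      by (rule tendsto_chain_int[OF lim])
    show "(\<lambda>k. chain_int G g (s k) x W) \<longlonglongrightarrow> 0"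
      using s that by (simp add: harmonic_def)
  qed
  then show "p \<in> {f \<in> l2 edges. harmonic f}" using p by (simp add: harmonic_def)
qed auto

text \<open>\<open>damp\<close> is self-adjoint and fixes harmonic functions, so \<open>?u\<close>
  has the same projection as \<open>delta e\<close>. Moving one half of the power across the inner
  product turns the squared norm of \<open>?u\<close> into a diagonal entry of the power
  \<open>2 * m\<close>.\<close>

lemma harmonic_proj_le:
  assumes e: "e \<in> edges" and c: "c \<in> \<real>"
  shows "Re (l2_inner edges (l2_proj edges {f \<in> l2 edges. harmonic f} (delta e)) (delta e))
    \<le> Re ((damp G g Ws c ^^ (2 * m)) (delta e) e)"
proof -
  interpret V: l2_closed_subspace edges "{f \<in> l2 edges. harmonic f}" by (rule harmonic_subspace)
  let ?u = "(damp G g Ws c ^^ m) (delta e)"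
  have u: "sq_summable edges ?u" by (intro sq_summable_damp_pow sq_summable_delta)
  have "Re (l2_inner edges (l2_proj edges {f \<in> l2 edges. harmonic f} (delta e)) (delta e)) \<le> nrm2 edges ?u"
    using damp_pow_inner_harmonic[OF sq_summable_delta _ _ c]
    by (intro V.l2_inner_proj_le u sq_summable_delta) (auto simp: l2_iff)
  also have "\<dots> = Re (l2_inner edges ?u ?u)" by (simp add: l2_inner_self)
  also have "l2_inner edges ?u ?u = l2_inner edges ((damp G g Ws c ^^ m) ?u) (delta e)"
    by (rule damp_pow_self_adjoint[OF u sq_summable_delta c, symmetric])
  also have "\<dots> = (damp G g Ws c ^^ (2 * m)) (delta e) e"
    by (simp add: l2_inner_delta[OF e] mult_2 funpow_add)
  finally show ?thesis .
qed

end

text \<open>Summing over \<open>div_chain n\<close> gives minus the boundary map from \<open>1\<close>-chains to \<open>0\<close>-chains.\<close>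

definition div_chain :: "nat \<Rightarrow> letter list list" where
  "div_chain n = map (\<lambda>i. [(i, True)]) [0..<n] @ map (\<lambda>i. [(i, False)]) [0..<n]"

text \<open>The divergence is a single operator made of \<open>2 * n\<close> words, every relator an
  operator of its own. In terms of the boundary maps \<open>d1\<close> and \<open>d2\<close>,
  \<open>lap\<close> becomes \<open>d1* d1 + d2 d2*\<close>.\<close>

definition pres_chains :: "nat \<Rightarrow> letter list list \<Rightarrow> letter list list list" where
  "pres_chains n rs = div_chain n # map (\<lambda>r. [r]) rs"

lemma chain_int_div_chain:
  "chain_int G g f x (div_chain n) = (\<Sum>i<n. f (i, x)) - (\<Sum>i<n. f (i, x \<otimes>\<^bsub>G\<^esub> inv\<^bsub>G\<^esub> (g i)))"
  by (simp add: chain_int_def div_chain_def o_def interv_sum_list_conv_sum_set_nat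
      atLeast0LessThan sum_negf)

lemma chain_int_single: "chain_int G g f x [w] = path_int G g f x w"
  by (simp add: chain_int_def)

section \<open>The Cayley complex of a presentation\<close>

locale presentation_cayley = group G for G (structure) +
  fixes n :: nat and g :: "nat \<Rightarrow> 'a" and rs :: "letter list list"
  assumes gens': "i < n \<Longrightarrow> g i \<in> carrier G"
    and rs_words: "set rs \<subseteq> words n"
begin

sublocale cayley G n g "pres_chains n rs"
  using gens' rs_words by unfold_locales (auto simp: pres_chains_def div_chain_def)

lemma harmonic_iff: "harmonic f \<longleftrightarrow> (\<forall>x\<in>carrier G. chain_int G g f x (div_chain n) = 0) \<and>
    (\<forall>r\<in>set rs. \<forall>x\<in>carrier G. path_int G g f x r = 0)"
  unfolding harmonic_def by (auto simp: pres_chains_def chain_int_single)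

text \<open>Identifies the sum over all base points, from which \<open>l2_boundary\<close> is built,
  with the finite recursion \<open>path_adj\<close>. Reindexing by a right translation lets the tail
  of the word start at a new base point.\<close>

lemma has_sum_path_chain:
  fixes h :: "'a \<Rightarrow> complex"
  assumes "e \<in> edges" "w \<in> words n"
  shows "((\<lambda>x. of_int (path_chain G g x w e) * h x) has_sum path_adj G g h w e) (carrier G)"
  using assms(2)
proof (induction w arbitrary: h)
  case (Cons l w)
  obtain i b where l: "l = (i, b)" by (cases l)
  have i: "i < n" "inv g i \<in> carrier G" and w: "w \<in> words n" using Cons.prems by (auto simp: l)
  have point: "((\<lambda>x. of_bool (x = a) * u) has_sum u) (carrier G)" if "a \<in> carrier G" for a and u :: complex
  proof -
    have "((\<lambda>x. of_bool (x = a) * u) has_sum u) {a}" by (rule has_sum_finiteI) auto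
    also have "?this \<longleftrightarrow> ?thesis" using that by (intro has_sum_cong_neutral) auto
    finally show ?thesis .
  qed
  show ?case
  proof (cases b)
    case True
    have "((\<lambda>x. of_int (path_chain G g (x \<otimes> g i) w e) * h (x \<otimes> g i \<otimes> inv g i)) has_sum
        path_adj G g (\<lambda>x. h (x \<otimes> inv g i)) w e) (carrier G)"
      using Cons.IH[OF w, of "\<lambda>x. h (x \<otimes> inv g i)"] i
      by (subst has_sum_reindex_bij_betw[OF bij_shift[of "g i"],
            where f = "\<lambda>x. of_int (path_chain G g x w e) * h (x \<otimes> inv g i)"]) auto
    also have "?this \<longleftrightarrow> ((\<lambda>x. of_int (path_chain G g (x \<otimes> g i) w e) * h x) has_sum
        path_adj G g (\<lambda>x. h (x \<otimes> inv g i)) w e) (carrier G)"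
      using i by (intro has_sum_cong) (auto simp: m_assoc)
    finally have 1: "\<dots>" .
    have 2: "((\<lambda>x. of_bool (e = (i, x)) * h x) has_sum (of_bool (fst e = i) * h (snd e))) (carrier G)"
    proof -
      have "((\<lambda>x. of_bool (x = snd e) * (of_bool (fst e = i) * h (snd e))) has_sum
          (of_bool (fst e = i) * h (snd e))) (carrier G)"
        using assms(1) by (intro point) auto
      also have "?this \<longleftrightarrow> ?thesis" by (intro has_sum_cong) (cases e; auto)
      finally show ?thesis .
    qed
    show ?thesis using has_sum_add[OF 2 1] True by (simp add: l distrib_right)
  next
    case False
    have "((\<lambda>x. of_int (path_chain G g (x \<otimes> inv g i) w e) * h (x \<otimes> inv g i \<otimes> g i)) has_sum
        path_adj G g (\<lambda>x. h (x \<otimes> g i)) w e) (carrier G)"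
      using Cons.IH[OF w, of "\<lambda>x. h (x \<otimes> g i)"] i
      by (subst has_sum_reindex_bij_betw[OF bij_shift[of "inv g i"],
            where f = "\<lambda>x. of_int (path_chain G g x w e) * h (x \<otimes> g i)"]) auto
    also have "?this \<longleftrightarrow> ((\<lambda>x. of_int (path_chain G g (x \<otimes> inv g i) w e) * h x) has_sum
        path_adj G g (\<lambda>x. h (x \<otimes> g i)) w e) (carrier G)"
      using i by (intro has_sum_cong) (auto simp: m_assoc)
    finally have 1: "\<dots>" .
    have 2: "((\<lambda>x. - of_bool (e = (i, x \<otimes> inv g i)) * h x) has_sum
        - (of_bool (fst e = i) * h (snd e \<otimes> g i))) (carrier G)"
    proof -
      have "((\<lambda>x. of_bool (x = snd e \<otimes> g i) * - (of_bool (fst e = i) * h (snd e \<otimes> g i))) has_sum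
          - (of_bool (fst e = i) * h (snd e \<otimes> g i))) (carrier G)"
        using assms(1) i by (intro point) auto
      also have "?this \<longleftrightarrow> ?thesis"
      proof (intro has_sum_cong)
        fix x assume x: "x \<in> carrier G"
        have "e = (i, x \<otimes> inv g i) \<longleftrightarrow> fst e = i \<and> x = snd e \<otimes> g i"
          using x i assms(1) by (cases e) (auto simp: m_assoc)
        then show "of_bool (x = snd e \<otimes> g i) * - (of_bool (fst e = i) * h (snd e \<otimes> g i))
          = - of_bool (e = (i, x \<otimes> inv g i)) * h x" by auto
      qed
      finally show ?thesis .
    qed
    show ?thesis using has_sum_add[OF 2 1] False by (simp add: l left_diff_distrib)
  qed
qed simp

lemma l2_boundary_face:
  assumes "e \<in> edges"
  shows "l2_boundary ({..<length rs} \<times> carrier G) (face_boundary G g rs) h e =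
    (\<Sum>j<length rs. path_adj G g (\<lambda>x. h (j, x)) (rs ! j) e)"
  unfolding l2_boundary_def face_boundary_def using assms rs_words
  by (intro infsumI has_sum_slices) (auto intro!: has_sum_path_chain)

lemma l2_boundary_edge:
  assumes v: "v \<in> carrier G"
  shows "l2_boundary edges (edge_boundary G g) f v = - chain_int G g f v (div_chain n)"
proof -
  have "((\<lambda>e. of_int (edge_boundary G g e v) * f e) has_sum
      (\<Sum>i<n. f (i, v \<otimes> inv g i) - f (i, v))) edges"
  proof (rule has_sum_slices)
    fix i assume i: "i < n"
    have eq: "of_int (edge_boundary G g (i, x) v) * f (i, x) =
        (if x = v \<otimes> inv g i then f (i, x) else 0) - (if x = v then f (i, x) else 0)"
      if "x \<in> carrier G" for x
    proof -
      have "v = x \<otimes> g i \<longleftrightarrow> x = v \<otimes> inv g i" using that i v by (auto simp: m_assoc)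
      then show ?thesis by (auto simp: edge_boundary_def)
    qed
    have "((\<lambda>x. of_int (edge_boundary G g (i, x) v) * f (i, x)) has_sum
        (f (i, v \<otimes> inv g i) - f (i, v))) {v, v \<otimes> inv g i}"
    proof (intro has_sum_finiteI)
      have "(\<Sum>x\<in>{v, v \<otimes> inv g i}. of_int (edge_boundary G g (i, x) v) * f (i, x)) =
          (\<Sum>x\<in>{v, v \<otimes> inv g i}. (if x = v \<otimes> inv g i then f (i, x) else 0) - (if x = v then f (i, x) else 0))"
        using i v by (intro sum.cong eq) auto
      also have "\<dots> = f (i, v \<otimes> inv g i) - f (i, v)" by (simp add: sum_subtractf)
      finally show "f (i, v \<otimes> inv g i) - f (i, v) =
          (\<Sum>x\<in>{v, v \<otimes> inv g i}. of_int (edge_boundary G g (i, x) v) * f (i, x))" ..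
    qed simp
    also have "?this \<longleftrightarrow> ((\<lambda>x. of_int (edge_boundary G g (i, x) v) * f (i, x)) has_sum
        (f (i, v \<otimes> inv g i) - f (i, v))) (carrier G)"
      using i v eq by (intro has_sum_cong_neutral) auto
    finally show "\<dots>" .
  qed
  then show ?thesis
    unfolding l2_boundary_def by (simp add: infsumI chain_int_div_chain sum_subtractf)
qed

text \<open>By adjointness, orthogonality to all boundaries of faces means that \<open>f\<close>
  integrates to 0 along every translate of every relator; delta functions at single faces isolate
  these integrals.\<close>

lemma l2_homology1_eq: "l2_homology1 G n g rs = {f \<in> l2 edges. harmonic f}"
proof -
  have "(\<forall>h\<in>l2 ({..<length rs} \<times> carrier G).
        l2_inner edges f (l2_boundary ({..<length rs} \<times> carrier G) (face_boundary G g rs) h) = 0)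
      \<longleftrightarrow> (\<forall>r\<in>set rs. \<forall>x\<in>carrier G. path_int G g f x r = 0)" (is "?L \<longleftrightarrow> ?R") if f: "f \<in> l2 edges" for f
  proof -
    have f: "sq_summable edges f" using f by (simp add: l2_iff)
    have rw: "rs ! j \<in> words n" if "j < length rs" for j using rs_words that by auto
    have inner: "l2_inner edges f (l2_boundary ({..<length rs} \<times> carrier G) (face_boundary G g rs) h) =
        (\<Sum>j<length rs. l2_inner (carrier G) (\<lambda>x. path_int G g f x (rs ! j)) (\<lambda>x. h (j, x)))"
      if h: "\<And>j. j < length rs \<Longrightarrow> sq_summable (carrier G) (\<lambda>x. h (j, x))" for h
    proof -
      have "l2_inner edges f (\<lambda>e. \<Sum>j<m. path_adj G g (\<lambda>x. h (j, x)) (rs ! j) e) =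
          (\<Sum>j<m. l2_inner (carrier G) (\<lambda>x. path_int G g f x (rs ! j)) (\<lambda>x. h (j, x)))"
        if "m \<le> length rs" for m
        using that
      proof (induction m)
        case (Suc m)
        have "sq_summable edges (path_adj G g (\<lambda>x. h (j, x)) (rs ! j))" if "j < Suc m" for j
          using h rw that Suc.prems by (intro sq_summable_path_adj) auto
        then have "sq_summable edges (\<lambda>e. \<Sum>j<m. path_adj G g (\<lambda>x. h (j, x)) (rs ! j) e)"
          "sq_summable edges (path_adj G g (\<lambda>x. h (m, x)) (rs ! m))"
          by (auto intro: sq_summable_sum)
        then show ?case
          using Suc f h rw by (simp add: l2_inner_add_right path_adjoint)
      qed simp
      then show ?thesis by (subst l2_inner_cong[OF HOL.refl l2_boundary_face]) auto
    qed
    show ?thesis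
    proof
      assume ?L
      show ?R
      proof (intro ballI)
        fix r x assume "r \<in> set rs" and x: "x \<in> carrier G"
        then obtain k where k: "k < length rs" "r = rs ! k" by (auto simp: in_set_conv_nth)
        have d: "sq_summable (carrier G) (\<lambda>y. delta (k, x) (j, y))" for j
          by (rule sq_summable_finite_support[of "{x}"]) auto
        have "delta (k, x) \<in> l2 ({..<length rs} \<times> carrier G)"
          using k x by (auto simp: l2_iff sq_summable_delta)
        then have "0 = (\<Sum>j<length rs. l2_inner (carrier G) (\<lambda>x. path_int G g f x (rs ! j)) (\<lambda>y. delta (k, x) (j, y)))"
          using \<open>?L\<close> inner[OF d] by fastforce
        also have "\<dots> = (\<Sum>j<length rs. if j = k then l2_inner (carrier G) (\<lambda>x. path_int G g f x (rs ! k)) (delta x) else 0)"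
          by (intro sum.cong) auto
        also have "\<dots> = path_int G g f x r" using k x by (simp add: l2_inner_delta)
        finally show "path_int G g f x r = 0" ..
      qed
    next
      assume R: ?R
      show ?L
      proof
        fix h assume "h \<in> l2 ({..<length rs} \<times> carrier G)"
        then have h: "sq_summable ({..<length rs} \<times> carrier G) h" by (simp add: l2_iff)
        note hj = sq_summable_slice(1)[OF h]
        have "l2_inner (carrier G) (\<lambda>x. path_int G g f x (rs ! j)) (\<lambda>x. h (j, x)) = 0" if "j < length rs" for j
        proof -
          have "l2_inner (carrier G) (\<lambda>x. path_int G g f x (rs ! j)) (\<lambda>x. h (j, x)) =
              l2_inner (carrier G) (\<lambda>_. 0) (\<lambda>x. h (j, x))"
            using R that by (intro l2_inner_cong) auto
          then show ?thesis by simp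
        qed
        then show "l2_inner edges f (l2_boundary ({..<length rs} \<times> carrier G) (face_boundary G g rs) h) = 0"
          using inner[OF hj] by simp
      qed
    qed
  qed
  then show ?thesis
    unfolding l2_homology1_def Let_def by (auto simp: harmonic_iff l2_boundary_edge)
qed

end

section \<open>Finite Cayley complexes\<close>

locale finite_cayley = cayley +
  assumes fin: "finite (carrier G)"
begin

lemma fin_edges: "finite edges"
  using fin by simp

lemma sqs [simp]: "sq_summable edges f"
  by (rule sq_summable_finite[OF fin_edges])

text \<open>Numbering the edges turns \<open>lap\<close> into a symmetric integer matrix. Its
  nullity, as the order of 0 in the characteristic polynomial, is at once the number of harmonic
  \<open>\<phi> d\<close> and the main term of the trace.\<close>

lemma laplacian_matrix:
  fixes K :: real
  assumes K: "K \<ge> 1" "lap_bound Ws \<le> K"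
  obtains I :: "(nat \<times> 'a) set" and \<phi> :: "nat \<times> 'a \<Rightarrow> nat \<times> 'a \<Rightarrow> int"
  where "I \<subseteq> edges" "\<And>d. d \<in> I \<Longrightarrow> harmonic (\<phi> d)" "\<And>d. d \<in> I \<Longrightarrow> \<phi> d d \<noteq> 0"
    "\<And>d d'. d \<in> I \<Longrightarrow> d' \<in> I \<Longrightarrow> d' \<noteq> d \<Longrightarrow> \<phi> d d' = 0"
    "\<And>k. k \<ge> 2 \<Longrightarrow> Re (\<Sum>e\<in>edges. (damp G g Ws (of_real (1 / K)) ^^ k) (delta e) e) \<le>
      real (card I) + real (card edges) * (2 * ln K / ln (real k) + exp (- sqrt (real k)))"
proof -
  define N where "N = card edges"
  obtain \<beta> where \<beta>: "bij_betw \<beta> {..<N} edges"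
    using ex_bij_betw_nat_finite[OF fin_edges] by (auto simp: N_def atLeast0LessThan)
  define \<gamma> where "\<gamma> = the_inv_into {..<N} \<beta>"
  have \<beta>E: "\<beta> a \<in> edges" if "a < N" for a using \<beta> that by (auto simp: bij_betw_def)
  have \<gamma>\<beta>: "\<gamma> (\<beta> a) = a" if "a < N" for a
    using \<beta> that by (auto simp: \<gamma>_def bij_betw_def the_inv_into_f_f)
  have \<beta>\<gamma>: "\<beta> (\<gamma> e) = e" "\<gamma> e < N" if "e \<in> edges" for e
    using \<beta> that bij_betw_the_inv_into[OF \<beta>] bij_betwE[of \<gamma> edges "{..<N}"]
    by (auto simp: \<gamma>_def bij_betw_def f_the_inv_into_f)
  have \<beta>_eq: "\<beta> a = \<beta> b \<longleftrightarrow> a = b" if "a < N" "b < N" for a b using \<gamma>\<beta> that by metis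
  define A where "A = mat N N (\<lambda>(a, b). lap G g Ws (delta (\<beta> b)) (\<beta> a) :: int)"
  define C where "C = (map_mat of_int A :: complex mat)"
  have A: "A \<in> carrier_mat N N" and CC: "C \<in> carrier_mat N N" by (auto simp: A_def C_def)
  have A_entry: "A $$ (a, b) = lap G g Ws (delta (\<beta> b)) (\<beta> a)" if "a < N" "b < N" for a b
    using that by (simp add: A_def)
  have C_entry: "C $$ (a, b) = lap G g Ws (delta (\<beta> b)) (\<beta> a)" if "a < N" "b < N" for a b
    using that lap_of_int[of G g Ws "delta (\<beta> b)" "\<beta> a", where 'a = complex]
    by (simp add: C_def A_def)
  have sum_\<beta>: "(\<Sum>a<N. u (\<beta> a)) = (\<Sum>e\<in>edges. u e)" for u :: "nat \<times> 'a \<Rightarrow> complex"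
    by (rule sum.reindex_bij_betw[OF \<beta>])
  have lap_cong: "lap G g Ws f e = lap G g Ws f' e" if "\<And>e. e \<in> edges \<Longrightarrow> f e = f' e" "e \<in> edges"
    for f f' :: "nat \<times> 'a \<Rightarrow> 'z::comm_ring_1" and e
    using finitary_lap[OF that(2), where 'c = 'z, unfolded finitary_def] that(1) by (metis subsetD)
  have lap_expand: "lap G g Ws f e = (\<Sum>b<N. f (\<beta> b) * lap G g Ws (delta (\<beta> b)) e)" if "e \<in> edges"
    for f :: "nat \<times> 'a \<Rightarrow> 'z::comm_ring_1" and e
  proof -
    have "lap G g Ws f e = lap G g Ws (\<lambda>e. \<Sum>b<N. f (\<beta> b) * delta (\<beta> b) e) e"
    proof (rule lap_cong[OF _ that])
      fix d assume d: "d \<in> edges"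
      have "(\<Sum>b<N. f (\<beta> b) * delta (\<beta> b) d) = (\<Sum>b<N. if b = \<gamma> d then f d else 0)"
        using \<beta>\<gamma>[OF d] \<gamma>\<beta> by (intro sum.cong) auto
      then show "f d = (\<Sum>b<N. f (\<beta> b) * delta (\<beta> b) d)" using \<beta>\<gamma>[OF d] by simp
    qed
    then show ?thesis unfolding lap_sum .
  qed
  \<comment> \<open>Self-adjointness over the complex numbers, read off on basis vectors; the
    entries are integers, so conjugation disappears.\<close>
  have sym: "A $$ (a, b) = A $$ (b, a)" if ab: "a < N" "b < N" for a b
  proof -
    have "C $$ (a, b) = l2_inner edges (lap G g Ws (delta (\<beta> b))) (delta (\<beta> a))"
      using ab by (simp add: C_entry l2_inner_delta \<beta>E)
    also have "\<dots> = l2_inner edges (delta (\<beta> b)) (lap G g Ws (delta (\<beta> a)))"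
      by (rule lap_self_adjoint) simp_all
    also have "\<dots> = cnj (C $$ (b, a))"
      using ab by (subst l2_inner_commute) (simp add: C_entry l2_inner_delta \<beta>E)
    finally have "(of_int (A $$ (a, b)) :: complex) = of_int (A $$ (b, a))"
      using ab A by (simp add: C_def)
    then show ?thesis by simp
  qed
  \<comment> \<open>Rayleigh quotient: \<open>e\<close> is \<open>S / nrm2 edges f\<close>, where
    \<open>S\<close> is the sum of the squared norms of the \<open>b\<^sub>W f\<close>.\<close>
  have ev: "e \<in> \<real> \<and> 0 \<le> Re e \<and> Re e \<le> K" if ev: "eigenvalue (map_mat of_int A :: complex mat) e" for e
  proof -
    obtain v where v: "v \<in> carrier_vec N" "v \<noteq> 0\<^sub>v N" "C *\<^sub>v v = e \<cdot>\<^sub>v v"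
      using ev CC unfolding eigenvalue_def eigenvector_def C_def by auto
    define f where "f d = v $ (\<gamma> d)" for d
    have lap_f: "lap G g Ws f d = e * f d" if d: "d \<in> edges" for d
    proof -
      have "lap G g Ws f d = (\<Sum>b<N. C $$ (\<gamma> d, b) * v $ b)"
        using \<beta>\<gamma>[OF d] by (subst lap_expand[OF d], intro sum.cong) (auto simp: C_entry f_def \<gamma>\<beta>)
      also have "\<dots> = (C *\<^sub>v v) $ (\<gamma> d)"
        using \<beta>\<gamma>[OF d] CC v(1) by (auto simp: scalar_prod_def atLeast0LessThan)
      also have "\<dots> = e * f d" using v \<beta>\<gamma>[OF d] by (simp add: f_def)
      finally show ?thesis .
    qed
    define S where "S = (\<Sum>W\<leftarrow>Ws. nrm2 (carrier G) (\<lambda>x. chain_int G g f x W))"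
    have "of_real S = l2_inner edges (lap G g Ws f) f" unfolding S_def by (simp add: lap_inner_self)
    also have "\<dots> = l2_inner edges (\<lambda>d. e * f d) f" by (intro l2_inner_cong lap_f) auto
    also have "\<dots> = e * of_real (nrm2 edges f)" by (simp add: l2_inner_cmult_left l2_inner_self)
    finally have S: "of_real S = e * of_real (nrm2 edges f)" .
    have "nrm2 edges f \<noteq> 0"
    proof
      assume "nrm2 edges f = 0"
      then have z: "f d = 0" if "d \<in> edges" for d using that nrm2_eq_0_iff[OF sqs, of f] by blast
      have "v $ a = 0" if "a < N" for a using z[OF \<beta>E[OF that]] that by (simp add: f_def \<gamma>\<beta>)
      then have "v = 0\<^sub>v N" using v(1) by auto
      then show False using v(2) by simp
    qed
    then have n0: "nrm2 edges f > 0" using nrm2_nonneg[of edges f] by linarith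
    then have e: "e = of_real (S / nrm2 edges f)" using S by (simp add: field_simps)
    have "S \<ge> 0" unfolding S_def by (intro sum_list_nonneg) (auto simp: nrm2_nonneg)
    moreover have "S \<le> K * nrm2 edges f"
      using lap_inner_self(2)[OF sqs, of f] K(2) mult_right_mono[of "lap_bound Ws" K "nrm2 edges f"] n0
      unfolding S_def by linarith
    ultimately show ?thesis using n0 by (simp add: e field_simps)
  qed
  have pow: "((1\<^sub>m N - c \<cdot>\<^sub>m C) ^\<^sub>m k) $$ (a, b) = (damp G g Ws c ^^ k) (delta (\<beta> b)) (\<beta> a)"
    if "a < N" "b < N" for a b c k
    using that
  proof (induction k arbitrary: a b)
    case 0
    then show ?case using CC by (simp add: \<beta>_eq)
  next
    case (Suc k)
    let ?P = "1\<^sub>m N - c \<cdot>\<^sub>m C"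
    have P: "?P \<in> carrier_mat N N" using CC by (simp add: minus_carrier_mat)
    have P_entry: "?P $$ (l, b) = damp G g Ws c (delta (\<beta> b)) (\<beta> l)" if "l < N" for l
      using that Suc.prems CC by (simp add: damp_def C_entry \<beta>_eq)
    have "(?P ^\<^sub>m Suc k) $$ (a, b) = (\<Sum>l<N. (?P ^\<^sub>m k) $$ (a, l) * ?P $$ (l, b))"
      using Suc.prems P by (auto simp: scalar_prod_def atLeast0LessThan simp del: index_minus_mat)
    also have "\<dots> = (\<Sum>l<N. damp G g Ws c (delta (\<beta> b)) (\<beta> l) * (damp G g Ws c ^^ k) (delta (\<beta> l)) (\<beta> a))"
      using Suc by (intro sum.cong) (simp_all add: P_entry mult.commute)
    also have "\<dots> = (damp G g Ws c ^^ k) (\<lambda>e. \<Sum>l<N. damp G g Ws c (delta (\<beta> b)) (\<beta> l) * delta (\<beta> l) e) (\<beta> a)"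
      unfolding damp_pow_sum ..
    also have "\<dots> = (damp G g Ws c ^^ k) (damp G g Ws c (delta (\<beta> b))) (\<beta> a)"
    proof -
      have "(\<Sum>l<N. damp G g Ws c (delta (\<beta> b)) (\<beta> l) * delta (\<beta> l) d) = damp G g Ws c (delta (\<beta> b)) d"
        if d: "d \<in> edges" for d
      proof -
        have "(\<Sum>l<N. damp G g Ws c (delta (\<beta> b)) (\<beta> l) * delta (\<beta> l) d) =
            (\<Sum>l<N. if l = \<gamma> d then damp G g Ws c (delta (\<beta> b)) d else 0)"
          using \<beta>\<gamma>[OF d] \<gamma>\<beta> by (intro sum.cong) auto
        also have "\<dots> = damp G g Ws c (delta (\<beta> b)) d" using \<beta>\<gamma>(2)[OF d] by simp
        finally show ?thesis .
      qed
      \<comment> \<open>The expansion in delta functions is valid on \<open>edges\<close> only;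
        finite propagation shows that the power sees nothing else.\<close>
      moreover obtain F where "F \<subseteq> edges" "\<And>f f' :: nat \<times> 'a \<Rightarrow> complex. \<forall>e\<in>F. f e = f' e \<Longrightarrow>
          (damp G g Ws c ^^ k) f (\<beta> a) = (damp G g Ws c ^^ k) f' (\<beta> a)"
        using finitary_damp_pow[OF \<beta>E[OF Suc.prems(1)], where 'c = complex and c = c and k = k, unfolded finitary_def]
        by (elim exE conjE) (rule that, auto)
      ultimately show ?thesis by (meson subsetD)
    qed
    finally show ?case by (simp add: funpow_swap1)
  qed
  obtain J :: "nat set" and v :: "nat \<Rightarrow> nat \<Rightarrow> int"
    where J: "J \<subseteq> {..<N}" "card J = Polynomial.order 0 (char_poly A)"
    and v: "\<And>i a. i \<in> J \<Longrightarrow> a < N \<Longrightarrow> (\<Sum>l<N. A $$ (a, l) * v i l) = 0"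
      "\<And>i. i \<in> J \<Longrightarrow> v i i \<noteq> 0" "\<And>i j. i \<in> J \<Longrightarrow> j \<in> J \<Longrightarrow> j \<noteq> i \<Longrightarrow> v i j = 0"
    using symmetric_integer_kernel[OF A sym] by blast
  have inj: "inj_on \<beta> J" using \<beta> J(1) by (auto simp: bij_betw_def intro: inj_on_subset)
  show thesis
  proof (rule that[of "\<beta> ` J" "\<lambda>d d'. v (\<gamma> d) (\<gamma> d')"])
    show "\<beta> ` J \<subseteq> edges" using \<beta>E J(1) by blast
    show "v (\<gamma> d) (\<gamma> d) \<noteq> 0" if "d \<in> \<beta> ` J" for d using that v(2) by (auto simp: \<gamma>\<beta> J(1)[THEN subsetD, simplified])
    show "v (\<gamma> d) (\<gamma> d') = 0" if "d \<in> \<beta> ` J" "d' \<in> \<beta> ` J" "d' \<noteq> d" for d d'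
      using that by (auto simp: \<gamma>\<beta> J(1)[THEN subsetD, simplified] intro!: v(3))
    show "harmonic (\<lambda>d'. v (\<gamma> d) (\<gamma> d'))" if "d \<in> \<beta> ` J" for d
    proof -
      obtain j where j: "j \<in> J" "d = \<beta> j" using \<open>d \<in> \<beta> ` J\<close> by blast
      then have jd: "\<gamma> d = j" using \<gamma>\<beta> J(1) by auto
      define f where "f d' = v j (\<gamma> d')" for d'
      have "lap G g Ws f e = 0" if e: "e \<in> edges" for e
      proof -
        have "lap G g Ws f e = (\<Sum>b<N. A $$ (\<gamma> e, b) * v j b)"
          using \<beta>\<gamma>[OF e] by (subst lap_expand[OF e], intro sum.cong) (auto simp: A_entry f_def \<gamma>\<beta>)
        then show ?thesis using v(1)[OF j(1)] \<beta>\<gamma>[OF e] by simp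
      qed
      \<comment> \<open>Positivity is available over the complex numbers, so the integral kernel
        vector is cast there and back.\<close>
      then have "harmonic (\<lambda>e. of_int (f e) :: complex)"
        by (intro harmonic_if_lap_zero) (simp_all add: lap_of_int)
      then have "harmonic f" by (simp add: harmonic_def chain_int_of_int)
      then show ?thesis by (simp add: jd f_def[abs_def])
    qed
    fix k :: nat assume k: "k \<ge> 2"
    have "(\<Sum>e\<in>edges. (damp G g Ws (of_real (1 / K)) ^^ k) (delta e) e :: complex) =
        (\<Sum>a<N. ((1\<^sub>m N - of_real (1 / K) \<cdot>\<^sub>m C) ^\<^sub>m k) $$ (a, a))"
      unfolding sum_\<beta>[symmetric] by (intro sum.cong) (simp_all add: pow)
    then show "Re (\<Sum>e\<in>edges. (damp G g Ws (of_real (1 / K)) ^^ k) (delta e) e) \<le>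
      real (card (\<beta> ` J)) + real (card edges) * (2 * ln K / ln (real k) + exp (- sqrt (real k)))"
      using Re_trace_pow_le[OF A K(1) k ev] J(2) by (simp add: C_def N_def card_image[OF inj])
  qed
qed

end

section \<open>Finite quotients and the profinite completion\<close>

context group
begin

section \<open>Cosets and normal subgroups of finite index\<close>

lemma finite_index_normalD:
  assumes "N \<in> finite_index_normal G"
  shows "N \<lhd> G" "subgroup N G" "finite (carrier (G Mod N))" "group (G Mod N)"
  using assms normal.factorgroup_is_group by (auto simp: finite_index_normal_def normal_imp_subgroup)

lemma rcos_eq_iff:
  assumes "subgroup N G" "x \<in> carrier G" "y \<in> carrier G"
  shows "N #> x = N #> y \<longleftrightarrow> x \<otimes> inv y \<in> N"
proof
  assume "N #> x = N #> y"
  then have "x \<in> N #> y" using rcos_self[OF assms(2,1)] by simp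
  then show "x \<otimes> inv y \<in> N" using subgroup.rcos_module_imp[OF assms(1) is_group assms(3)] by simp
next
  assume h: "x \<otimes> inv y \<in> N"
  have "x = (x \<otimes> inv y) \<otimes> y" using assms by (simp add: m_assoc)
  then have "x \<in> N #> y" using rcosI[OF h _ assms(3)] subgroup.subset[OF assms(1)] by simp
  then show "N #> x = N #> y" using repr_independence[OF _ assms(3,1)] by simp
qed

lemma rcos_eq_self_iff:
  assumes "subgroup N G" "x \<in> carrier G"
  shows "N #> x = N \<longleftrightarrow> x \<in> N"
  using rcos_self[OF assms(2,1)] coset_join2[OF assms(2,1)] by auto

text \<open>Finitely many values of \<open>\<kappa>\<close>, with every fibre inside one coset,
  bound the index. Here \<open>\<kappa>\<close> is any map; the table of values of derivations in
  \<open>card_cocycles_le\<close> is no homomorphism in general.\<close>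

lemma finite_index_normalI:
  assumes N: "N \<lhd> G" and fin: "finite (\<kappa> ` carrier G)"
    and \<kappa>: "\<And>x y. x \<in> carrier G \<Longrightarrow> y \<in> carrier G \<Longrightarrow> \<kappa> x = \<kappa> y \<Longrightarrow> x \<otimes> inv y \<in> N"
  shows "N \<in> finite_index_normal G"
proof -
  have sN: "subgroup N G" using N by (rule normal_imp_subgroup)
  have "carrier (G Mod N) = (\<lambda>k. N #> inv_into (carrier G) \<kappa> k) ` \<kappa> ` carrier G"
  proof -
    have "N #> inv_into (carrier G) \<kappa> (\<kappa> x) = N #> x" if "x \<in> carrier G" for x
      using that inv_into_into[of "\<kappa> x" \<kappa> "carrier G"] f_inv_into_f[of "\<kappa> x" \<kappa> "carrier G"]
      by (subst rcos_eq_iff[OF sN]) (auto intro!: \<kappa>)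
    then show ?thesis by (simp add: carrier_FactGroup image_image)
  qed
  then show ?thesis using fin N by (simp add: finite_index_normal_def)
qed

lemma finite_index_normal_Int:
  assumes "M \<in> finite_index_normal G" "N \<in> finite_index_normal G"
  shows "M \<inter> N \<in> finite_index_normal G"
proof (rule finite_index_normalI)
  note M = finite_index_normalD[OF assms(1)] and N = finite_index_normalD[OF assms(2)]
  show "M \<inter> N \<lhd> G"
    using M(1) N(1) unfolding normal_inv_iff by (auto intro: subgroups_Inter_pair)
  have "(\<lambda>x. (M #> x, N #> x)) ` carrier G \<subseteq> carrier (G Mod M) \<times> carrier (G Mod N)"
    by (auto simp: carrier_FactGroup)
  then show "finite ((\<lambda>x. (M #> x, N #> x)) ` carrier G)"
    using M(3) N(3) by (meson finite_SigmaI finite_subset)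
  show "x \<otimes> inv y \<in> M \<inter> N"
    if "x \<in> carrier G" "y \<in> carrier G" "(M #> x, N #> x) = (M #> y, N #> y)" for x y
    using that M N rcos_eq_iff by auto
qed

lemma finite_index_normal_carrier: "carrier G \<in> finite_index_normal G"
  by (rule finite_index_normalI[where \<kappa> = "\<lambda>_. ()"]) (auto simp: normal_inv_iff subgroup_self)

lemma residually_finite_avoid:
  assumes rf: "residually_finite G" and X: "finite X" "X \<subseteq> carrier G" "\<one> \<notin> X"
  shows "\<exists>N\<in>finite_index_normal G. N \<inter> X = {}"
  using X
proof (induction X rule: finite_induct)
  case empty
  then show ?case using finite_index_normal_carrier by blast
next
  case (insert x X)
  then obtain N where N: "N \<in> finite_index_normal G" "N \<inter> X = {}" by auto
  obtain M where M: "M \<in> finite_index_normal G" "x \<notin> M"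
    using rf insert.prems by (auto simp: residually_finite_def)
  show ?case using finite_index_normal_Int[OF M(1) N(1)] M(2) N(2) by blast
qed

lemma set_mult_rcos_subset:
  assumes "subgroup M G" "subgroup N G" "N \<subseteq> M" "x \<in> carrier G"
  shows "M <#> (N #> x) = M #> x"
proof -
  have "M <#> N = M"
  proof
    show "M <#> N \<subseteq> M" using assms by (auto simp: set_mult_def intro: subgroup.m_closed)
    show "M \<subseteq> M <#> N"
    proof
      fix y assume "y \<in> M"
      then show "y \<in> M <#> N"
        using assms subgroup.one_closed[OF assms(2)] subgroup.mem_carrier[OF assms(1)]
        unfolding set_mult_def by (intro UN_I[of y] UN_I[of \<one>]) auto
    qed
  qed
  then show ?thesis
    using assms by (simp add: setmult_rcos_assoc subgroup.subset)
qed

lemma FactGroup_elem: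
  assumes "C \<in> carrier (G Mod N)"
  obtains x where "x \<in> carrier G" "C = N #> x"
  using assms by (auto simp: carrier_FactGroup)

lemma FactGroup_mult_rcos:
  assumes "N \<lhd> G" "x \<in> carrier G" "y \<in> carrier G"
  shows "(N #> x) \<otimes>\<^bsub>G Mod N\<^esub> (N #> y) = N #> (x \<otimes> y)"
  using normal.rcos_sum[OF assms] by simp

lemma FactGroup_inv_rcos:
  assumes "N \<lhd> G" "x \<in> carrier G"
  shows "inv\<^bsub>G Mod N\<^esub> (N #> x) = N #> inv x"
  using normal.inv_FactGroup[OF assms(1), of "N #> x"] normal.rcos_inv[OF assms] assms(2)
  by (auto simp: carrier_FactGroup)

section \<open>The inverse limit of the finite quotients\<close>

abbreviation (in -) finite_quotient_product :: "('a, 'b) monoid_scheme \<Rightarrow> ('a set \<Rightarrow> 'a set) monoid" where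
  "finite_quotient_product G \<equiv> product_group (finite_index_normal G) (\<lambda>N. G Mod N)"

lemma group_finite_quotient_product: "group (finite_quotient_product G)"
  by (rule product_group) (rule finite_index_normalD(4))

lemma profinite_completion_carrier:
  "x \<in> carrier (profinite_completion G) \<longleftrightarrow>
    x \<in> (\<Pi>\<^sub>E N\<in>finite_index_normal G. carrier (G Mod N)) \<and>
    (\<forall>N\<in>finite_index_normal G. \<forall>M\<in>finite_index_normal G. N \<subseteq> M \<longrightarrow> x M = M <#> x N)"
  by (simp add: profinite_completion_def)

lemma profinite_completion_subgroup:
  "subgroup (carrier (profinite_completion G)) (finite_quotient_product G)"
proof (rule group.subgroupI[OF group_finite_quotient_product])
  let ?I = "finite_index_normal G"
  note carr = profinite_completion_carrier
  show "carrier (profinite_completion G) \<subseteq> carrier (finite_quotient_product G)"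
    unfolding carrier_product_group by (intro subsetI) (simp only: carr)
  have "(\<lambda>N\<in>?I. N #> \<one>) \<in> carrier (profinite_completion G)"
    unfolding carr by (auto simp: carrier_FactGroup set_mult_rcos_subset finite_index_normalD)
  then show "carrier (profinite_completion G) \<noteq> {}" by blast
  fix x assume x: "x \<in> carrier (profinite_completion G)"
  then have xP: "x \<in> (\<Pi>\<^sub>E N\<in>?I. carrier (G Mod N))" by (simp add: carr)
  have invx: "inv\<^bsub>finite_quotient_product G\<^esub> x = (\<lambda>N\<in>?I. inv\<^bsub>G Mod N\<^esub> x N)"
    using xP by (intro inv_product_group) (auto intro: finite_index_normalD)
  have inv_compat: "inv\<^bsub>G Mod M\<^esub> x M = M <#> inv\<^bsub>G Mod N\<^esub> x N" if NM: "N \<in> ?I" "M \<in> ?I" "N \<subseteq> M" for N M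
  proof -
    obtain a where a: "a \<in> carrier G" "x N = N #> a"
      using xP NM by (meson PiE_mem FactGroup_elem)
    have "x M = M <#> x N" using x NM unfolding carr by blast
    then have "x M = M #> a" using a NM by (simp add: set_mult_rcos_subset finite_index_normalD)
    then show ?thesis
      using a NM by (simp add: FactGroup_inv_rcos set_mult_rcos_subset finite_index_normalD)
  qed
  have inv_mem: "inv\<^bsub>G Mod N\<^esub> x N \<in> carrier (G Mod N)" if "N \<in> ?I" for N
    using that xP by (intro group.inv_closed finite_index_normalD) auto
  show "inv\<^bsub>finite_quotient_product G\<^esub> x \<in> carrier (profinite_completion G)"
    unfolding invx carr
  proof (intro conjI ballI impI)
    fix N M assume NM: "N \<in> ?I" "M \<in> ?I" "N \<subseteq> M"
    show "(\<lambda>N\<in>?I. inv\<^bsub>G Mod N\<^esub> x N) M = M <#> (\<lambda>N\<in>?I. inv\<^bsub>G Mod N\<^esub> x N) N"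
      using inv_compat[OF NM] NM(1,2) by simp
  qed (use inv_mem in auto)
  fix y assume y: "y \<in> carrier (profinite_completion G)"
  then have yP: "y \<in> (\<Pi>\<^sub>E N\<in>?I. carrier (G Mod N))" by (simp add: carr)
  have mult_compat: "x M \<otimes>\<^bsub>G Mod M\<^esub> y M = M <#> (x N \<otimes>\<^bsub>G Mod N\<^esub> y N)"
    if NM: "N \<in> ?I" "M \<in> ?I" "N \<subseteq> M" for N M
  proof -
    obtain a b where ab: "a \<in> carrier G" "x N = N #> a" "b \<in> carrier G" "y N = N #> b"
      using xP yP NM by (meson PiE_mem FactGroup_elem)
    have "x M = M <#> x N" "y M = M <#> y N" using x y NM unfolding carr by blast+
    then have "x M = M #> a" "y M = M #> b"
      using ab NM by (simp_all add: set_mult_rcos_subset finite_index_normalD)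
    then show ?thesis
      using ab NM FactGroup_mult_rcos[of N a b] FactGroup_mult_rcos[of M a b]
      by (simp add: set_mult_rcos_subset finite_index_normalD)
  qed
  have mult_mem: "x N \<otimes>\<^bsub>G Mod N\<^esub> y N \<in> carrier (G Mod N)" if "N \<in> ?I" for N
    using that xP yP finite_index_normalD(4)[OF that]
    by (intro monoid.m_closed[OF group.is_monoid]) auto
  show "x \<otimes>\<^bsub>finite_quotient_product G\<^esub> y \<in> carrier (profinite_completion G)"
    unfolding carr mult_product_group
  proof (intro conjI ballI impI)
    fix N M assume NM: "N \<in> ?I" "M \<in> ?I" "N \<subseteq> M"
    show "(\<lambda>N\<in>?I. x N \<otimes>\<^bsub>G Mod N\<^esub> y N) M = M <#> (\<lambda>N\<in>?I. x N \<otimes>\<^bsub>G Mod N\<^esub> y N) N"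
      using mult_compat[OF NM] NM(1,2) by simp
  qed (use mult_mem in auto)
qed

lemma profinite_completion_eq:
  "profinite_completion G = (finite_quotient_product G)\<lparr>carrier := carrier (profinite_completion G)\<rparr>"
  by (simp add: profinite_completion_def)

lemma profinite_completion_mem:
  "x \<in> carrier (profinite_completion G) \<Longrightarrow> N \<in> finite_index_normal G \<Longrightarrow> x N \<in> carrier (G Mod N)"
  unfolding profinite_completion_carrier by blast

lemma profinite_completion_ops:
  assumes N: "N \<in> finite_index_normal G"
  shows "\<one>\<^bsub>profinite_completion G\<^esub> N = N"
    and "(x \<otimes>\<^bsub>profinite_completion G\<^esub> y) N = x N \<otimes>\<^bsub>G Mod N\<^esub> y N"
    and "x \<in> carrier (profinite_completion G) \<Longrightarrow> (inv\<^bsub>profinite_completion G\<^esub> x) N = inv\<^bsub>G Mod N\<^esub> (x N)"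
proof -
  show "\<one>\<^bsub>profinite_completion G\<^esub> N = N" "(x \<otimes>\<^bsub>profinite_completion G\<^esub> y) N = x N \<otimes>\<^bsub>G Mod N\<^esub> y N"
    using N by (auto simp: profinite_completion_def)
  assume x: "x \<in> carrier (profinite_completion G)"
  have "inv\<^bsub>profinite_completion G\<^esub> x = inv\<^bsub>finite_quotient_product G\<^esub> x"
    by (subst profinite_completion_eq)
      (rule group.m_inv_consistent[OF group_finite_quotient_product profinite_completion_subgroup x])
  also have "\<dots> = (\<lambda>N\<in>finite_index_normal G. inv\<^bsub>G Mod N\<^esub> x N)"
    using x unfolding profinite_completion_carrier
    by (intro inv_product_group finite_index_normalD(4)) (rule conjunct1)
  finally show "(inv\<^bsub>profinite_completion G\<^esub> x) N = inv\<^bsub>G Mod N\<^esub> (x N)" using N by simp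
qed

abbreviation top_generates :: "('a set \<Rightarrow> 'a set) set \<Rightarrow> bool" where
  "top_generates S \<equiv> profinite_topology G closure_of (generate (profinite_completion G) S) = carrier (profinite_completion G)"

text \<open>Fixing the coordinate at \<open>N\<close> is an open condition, so a dense subgroup
  meets it for every coset of \<open>N\<close>. The elements generated by \<open>S\<close> have
  their coordinate at \<open>N\<close> inside \<open>H\<close>, hence \<open>H\<close> contains
  every coset.\<close>

lemma dense_generators_subgroup:
  assumes S: "S \<subseteq> carrier (profinite_completion G)"
    and dense: "top_generates S"
    and N: "N \<in> finite_index_normal G" and H: "subgroup H G" "N \<subseteq> H"
    and SH: "\<And>s. s \<in> S \<Longrightarrow> s N \<subseteq> H"
  shows "H = carrier G"
proof
  let ?P = "profinite_completion G"
  have sN: "subgroup N G" and nN: "N \<lhd> G" using finite_index_normalD[OF N] by auto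
  have coset_H: "N #> x \<subseteq> H \<longleftrightarrow> x \<in> H" if "x \<in> carrier G" for x
    using rcos_self[OF that sN] H by (auto simp: r_coset_def intro: subgroup.m_closed)
  interpret P: group ?P
    using subgroup.subgroup_is_group[OF profinite_completion_subgroup group_finite_quotient_product]
    by (simp flip: profinite_completion_eq)
  have gen: "y \<in> carrier ?P \<and> y N \<subseteq> H" if "y \<in> generate ?P S" for y
    using that
  proof (induction rule: generate.induct)
    case one
    then show ?case using H N by (simp add: profinite_completion_ops)
  next
    case (incl h)
    then show ?case using S SH by auto
  next
    case (inv h)
    then have h: "h \<in> carrier ?P" using S by auto
    obtain a where a: "a \<in> carrier G" "h N = N #> a"
      using FactGroup_elem[OF profinite_completion_mem[OF h N]] by blast
    have "a \<in> H" using SH[OF inv] a coset_H by simp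
    then show ?case
      using h N a coset_H[of "inv a"] H
      by (simp add: profinite_completion_ops FactGroup_inv_rcos[OF nN] subgroup.m_inv_closed)
  next
    case (eng h k)
    obtain a b where ab: "a \<in> carrier G" "h N = N #> a" "b \<in> carrier G" "k N = N #> b"
      using FactGroup_elem[OF profinite_completion_mem[OF _ N]] eng by metis
    have "a \<in> H" "b \<in> H" using eng ab coset_H by auto
    then show ?case
      using eng N ab coset_H[of "a \<otimes> b"] H FactGroup_mult_rcos[OF nN, of a b]
      by (simp add: profinite_completion_ops subgroup.m_closed)
  qed
  show "H \<subseteq> carrier G" using H(1) by (rule subgroup.subset)
  show "carrier G \<subseteq> H"
  proof
    fix y assume y: "y \<in> carrier G"
    \<comment> \<open>\<open>yh\<close> is the image of \<open>y\<close> in the completion, and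
      \<open>T\<close> its open neighbourhood of points with the same coordinate at
      \<open>N\<close>.\<close>
    define yh where "yh = (\<lambda>M\<in>finite_index_normal G. M #> y)"
    have yh: "yh \<in> carrier ?P"
      using y unfolding profinite_completion_carrier yh_def
      by (auto simp: carrier_FactGroup set_mult_rcos_subset finite_index_normalD)
    let ?X = "product_topology (\<lambda>N. discrete_topology (carrier (G Mod N))) (finite_index_normal G)"
    define T where "T = {x \<in> topspace ?X. x N \<in> {N #> y}} \<inter> carrier ?P"
    have "openin (profinite_topology G) T"
      unfolding profinite_topology_def T_def openin_subtopology
    proof (intro exI conjI)
      show "openin ?X {x \<in> topspace ?X. x N \<in> {N #> y}}"
        using y by (intro openin_continuous_map_preimage[OF continuous_map_product_projection[OF N]])
          (auto simp: carrier_FactGroup)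
    qed simp
    moreover have "yh \<in> T"
    proof -
      have "yh \<in> topspace ?X" using y by (auto simp: yh_def carrier_FactGroup)
      moreover have "yh N = N #> y" using N by (simp add: yh_def)
      ultimately show ?thesis using yh by (simp add: T_def)
    qed
    moreover have "yh \<in> profinite_topology G closure_of (generate ?P S)" unfolding dense by (rule yh)
    ultimately obtain z where z: "z \<in> generate ?P S" "z \<in> T" unfolding in_closure_of by blast
    then have "N #> y \<subseteq> H" using gen[OF z(1)] by (simp add: T_def)
    then show "y \<in> H" using coset_H[OF y] by simp
  qed
qed

end

section \<open>Counting cocycles modulo an integer\<close>

context presentation_cayley
begin

section \<open>Path integrals of cocycles and coboundaries\<close>

lemma word_value_simps [simp]:
  "word_value G g [] = \<one>" "word_value G g (l # w) = letter_value G g l \<otimes> word_value G g w"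
  by (simp_all add: word_value_def)

lemma letter_value_closed: "fst l < n \<Longrightarrow> letter_value G g l \<in> carrier G"
  by (simp add: letter_value_def)

lemma word_value_closed: "w \<in> words n \<Longrightarrow> word_value G g w \<in> carrier G"
  by (induction w) (auto simp: letter_value_closed)

lemma word_value_append:
  "u \<in> words n \<Longrightarrow> v \<in> words n \<Longrightarrow> word_value G g (u @ v) = word_value G g u \<otimes> word_value G g v"
  by (induction u) (auto simp: letter_value_closed word_value_closed m_assoc)

lemma words_append: "u @ v \<in> words n \<longleftrightarrow> u \<in> words n \<and> v \<in> words n"
  by (auto simp: words_def)

lemma path_int_Cons:
  assumes "x \<in> carrier G" "fst l < n"
  shows "path_int G g f x (l # w) = path_int G g f x [l] + path_int G g f (x \<otimes> letter_value G g l) w"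
  by (cases l; cases "snd l") (auto simp: letter_value_def)

lemma path_int_append:
  assumes "x \<in> carrier G" "u \<in> words n" "v \<in> words n"
  shows "path_int G g f x (u @ v) = path_int G g f x u + path_int G g f (x \<otimes> word_value G g u) v"
  using assms(1,2)
proof (induction u arbitrary: x)
  case (Cons l u)
  then have l: "fst l < n" "letter_value G g l \<in> carrier G" and u: "u \<in> words n"
    by (auto simp: letter_value_closed)
  have "path_int G g f x ((l # u) @ v) = path_int G g f x [l] + path_int G g f (x \<otimes> letter_value G g l) (u @ v)"
    using path_int_Cons[of x l f "u @ v"] Cons.prems l by simp
  also have "\<dots> = path_int G g f x (l # u) + path_int G g f (x \<otimes> word_value G g (l # u)) v"
    using Cons.prems l u Cons.IH[of "x \<otimes> letter_value G g l"] path_int_Cons[of x l f u]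
    by (simp add: m_assoc word_value_closed)
  finally show ?case .
qed simp

definition cob :: "('a \<Rightarrow> 'c::comm_ring_1) \<Rightarrow> nat \<times> 'a \<Rightarrow> 'c" where
  "cob u e = u (snd e \<otimes> g (fst e)) - u (snd e)"

lemma path_int_cob:
  assumes "x \<in> carrier G" "w \<in> words n"
  shows "path_int G g (cob u) x w = u (x \<otimes> word_value G g w) - u x"
  using assms
proof (induction w arbitrary: x)
  case (Cons l w)
  then have l: "fst l < n" "letter_value G g l \<in> carrier G" and w: "w \<in> words n"
    by (auto simp: letter_value_closed)
  have "path_int G g (cob u) x [l] = u (x \<otimes> letter_value G g l) - u x"
    using l Cons.prems by (cases l; cases "snd l") (auto simp: letter_value_def cob_def m_assoc)
  then show ?case
    using Cons.IH[of "x \<otimes> letter_value G g l"] path_int_Cons[of x l "cob u" w] Cons.prems l w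
    by (simp add: m_assoc word_value_closed)
qed simp

text \<open>For \<open>m = 0\<close> this is a congruence rule: the values of \<open>f\<close>
  outside \<open>edges\<close> do not influence integrals.\<close>

lemma path_int_dvd_diff:
  fixes m :: "'c::comm_ring_1"
  assumes eq: "\<And>e. e \<in> edges \<Longrightarrow> m dvd f e - f' e"
  shows "x \<in> carrier G \<Longrightarrow> w \<in> words n \<Longrightarrow> m dvd path_int G g f x w - path_int G g f' x w"
proof (induction w arbitrary: x)
  case (Cons l w)
  obtain i b where l: "l = (i, b)" by (cases l)
  have i: "i < n" and w: "w \<in> words n" using Cons.prems by (auto simp: l)
  show ?case
  proof (cases b)
    case True
    have "m dvd (f (i, x) - f' (i, x)) + (path_int G g f (x \<otimes> g i) w - path_int G g f' (x \<otimes> g i) w)"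
      using Cons.prems i w by (intro dvd_add eq Cons.IH) auto
    then show ?thesis using True by (simp add: l algebra_simps)
  next
    case False
    have "m dvd (path_int G g f (x \<otimes> inv g i) w - path_int G g f' (x \<otimes> inv g i) w)
        - (f (i, x \<otimes> inv g i) - f' (i, x \<otimes> inv g i))"
      using Cons.prems i w by (intro dvd_diff eq Cons.IH) auto
    then show ?thesis using False by (simp add: l algebra_simps)
  qed
qed simp

text \<open>Divisibility keeps the values in one ring: a positive integer \<open>m\<close> gives
  cocycles with values in the residue ring, \<open>m = 0\<close> gives honest cocycles, as in
  \<open>vn_dim_finite\<close>.\<close>

definition cocycle_mod :: "'c::comm_ring_1 \<Rightarrow> (nat \<times> 'a \<Rightarrow> 'c) \<Rightarrow> bool" where
  "cocycle_mod m f \<longleftrightarrow> (\<forall>r\<in>set rs. \<forall>x\<in>carrier G. m dvd path_int G g f x r)"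

definition cocycles :: "int \<Rightarrow> (nat \<times> 'a \<Rightarrow> int) set" where
  "cocycles m = {f \<in> edges \<rightarrow>\<^sub>E {0..<m}. cocycle_mod m f}"

lemma chain_adj_div_chain:
  assumes "e \<in> edges"
  shows "chain_adj G g u (div_chain n) e = - cob u e"
proof -
  have "chain_adj G g u (div_chain n) e = (\<Sum>i<n. of_bool (fst e = i) * u (snd e))
      - (\<Sum>i<n. of_bool (fst e = i) * u (snd e \<otimes> g i))"
    by (simp add: chain_adj_def div_chain_def o_def interv_sum_list_conv_sum_set_nat
        atLeast0LessThan sum_negf)
  also have "(\<Sum>i<n. of_bool (fst e = i) * u (snd e)) = (\<Sum>i<n. if i = fst e then u (snd e) else 0)"
    by (intro sum.cong) auto
  also have "(\<Sum>i<n. of_bool (fst e = i) * u (snd e \<otimes> g i)) =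
      (\<Sum>i<n. if i = fst e then u (snd e \<otimes> g (fst e)) else 0)"
    by (intro sum.cong) auto
  finally show ?thesis using assms by (auto simp: cob_def)
qed

text \<open>Harmonic functions are orthogonal to coboundaries.\<close>
lemma harmonic_cob_zero:
  assumes fin: "finite (carrier G)" and f: "harmonic f"
    and eq: "\<And>e. e \<in> edges \<Longrightarrow> f e = cob u e" and e: "e \<in> edges"
  shows "f e = (0 :: complex)"
proof -
  have sq: "sq_summable edges f" "sq_summable (carrier G) u"
    using fin by (auto intro: sq_summable_finite)
  have div: "set (div_chain n) \<subseteq> words n" by (auto simp: div_chain_def)
  have "l2_inner (carrier G) (\<lambda>x. chain_int G g f x (div_chain n)) u =
      l2_inner edges f (chain_adj G g u (div_chain n))"
    by (rule chain_adjoint[OF sq div])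
  also have "\<dots> = l2_inner edges f (\<lambda>e. - f e)"
    by (intro l2_inner_cong) (simp_all add: chain_adj_div_chain eq)
  also have "\<dots> = - of_real (nrm2 edges f)" by (simp add: l2_inner_uminus_right l2_inner_self)
  also have "l2_inner (carrier G) (\<lambda>x. chain_int G g f x (div_chain n)) u = l2_inner (carrier G) (\<lambda>_. 0) u"
    using f by (intro l2_inner_cong) (auto simp: harmonic_iff)
  finally have "nrm2 edges f = 0" by simp
  then show ?thesis using nrm2_eq_0_iff[OF sq(1)] e by blast
qed

end

text \<open>This describes the quotients of a presented group: the relators hold in them, but do not
  present them in general.\<close>

locale connected_cayley = presentation_cayley +
  assumes gen: "word_value G g ` words n = carrier G"
    and rel: "r \<in> set rs \<Longrightarrow> word_value G g r = \<one>"
begin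

definition rep_word :: "'a \<Rightarrow> letter list" where
  "rep_word x = (SOME w. w \<in> words n \<and> word_value G g w = x)"

lemma rep_word:
  assumes "x \<in> carrier G"
  shows "rep_word x \<in> words n" "word_value G g (rep_word x) = x"
proof -
  have "\<exists>w. w \<in> words n \<and> word_value G g w = x" using gen assms by (metis imageE)
  from someI_ex[OF this] show "rep_word x \<in> words n" "word_value G g (rep_word x) = x"
    by (auto simp: rep_word_def)
qed

lemma cob_cocycle: "r \<in> set rs \<Longrightarrow> x \<in> carrier G \<Longrightarrow> path_int G g (cob u) x r = 0"
  using rs_words by (auto simp: path_int_cob rel)

text \<open>Relator loops integrate to 0 modulo \<open>m\<close> from every base point, so deleting
  a relator does not change an integral modulo \<open>m\<close>. The congruence on words is that of
  the presented group, while the integrals may live on a proper quotient; this is what makes a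
  cocycle on a quotient a derivation of the whole group.\<close>

lemma presented_eq_path_int:
  assumes "presented_eq n (set rs) v w" and f: "cocycle_mod m f"
  shows "v \<in> words n \<and> w \<in> words n \<and> word_value G g v = word_value G g w \<and>
    (\<forall>x\<in>carrier G. m dvd path_int G g f x v - path_int G g f x w)"
  using assms(1)
proof (induction rule: presented_eq.induct)
  case (sym v w)
  have "m dvd path_int G g f x w - path_int G g f x v" if "x \<in> carrier G" for x
    using sym.IH that dvd_minus_iff[of m "path_int G g f x v - path_int G g f x w"] by simp
  then show ?case using sym.IH by simp
next
  case (trans u v w)
  have "m dvd path_int G g f x u - path_int G g f x w" if "x \<in> carrier G" for x
    using dvd_add[of m "path_int G g f x u - path_int G g f x v" "path_int G g f x v - path_int G g f x w"]
      trans.IH that by simp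
  then show ?case using trans.IH by simp
next
  case (cancel u v i b)
  let ?c = "[(i, b), (i, \<not> b)]"
  have c: "?c \<in> words n" "word_value G g ?c = \<one>" using cancel
    by (auto simp: letter_value_def)
  have "path_int G g f y ?c = 0" if "y \<in> carrier G" for y
    using that cancel by (cases b) (auto simp: m_assoc)
  then have "path_int G g f x (u @ ?c @ v) = path_int G g f x (u @ v)" if "x \<in> carrier G" for x
    using that cancel c word_value_closed[OF cancel(1)] words_append[of ?c v]
      path_int_append[of x u "?c @ v" f] path_int_append[of "x \<otimes> word_value G g u" ?c v f]
      path_int_append[of x u v f]
    by (simp del: append.simps word_value_simps path_int.simps)
  then show ?case
    using cancel c words_append[of u "?c @ v"] words_append[of ?c v] words_append[of u v]
      word_value_append[of u "?c @ v"] word_value_append[of ?c v] word_value_append[of u v] word_value_closed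
    by (simp del: append.simps(2) word_value_simps words_simps)
next
  case (relator u v r)
  have r: "r \<in> words n" "word_value G g r = \<one>" using relator rs_words rel by auto
  have "m dvd path_int G g f x (u @ r @ v) - path_int G g f x (u @ v)" if x: "x \<in> carrier G" for x
  proof -
    have y: "x \<otimes> word_value G g u \<in> carrier G" using x word_value_closed[OF relator(1)] by simp
    then have "m dvd path_int G g f (x \<otimes> word_value G g u) r"
      using f relator by (auto simp: cocycle_mod_def)
    then show ?thesis
      using x y relator r words_append[of r v] path_int_append[of x u "r @ v" f]
        path_int_append[of "x \<otimes> word_value G g u" r v f] path_int_append[of x u v f]
      by simp
  qed
  then show ?case
    using relator r words_append[of u "r @ v"] words_append[of r v] words_append[of u v]
      word_value_append[of u "r @ v"] word_value_append[of r v] word_value_append[of u v] word_value_closed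
    by simp
qed simp

end

locale finite_connected_cayley = connected_cayley + assumes fin: "finite (carrier G)"
begin

sublocale finite_cayley G n g "pres_chains n rs"
  using fin by unfold_locales

text \<open>
  Integer combinations of the harmonic functions \<open>\<phi> d\<close> and of coboundaries of functions
  vanishing at \<open>\<one>\<close>, all with coefficients in \<open>{0..<L}\<close>, are pairwise distinct modulo \<open>B L\<close>.
\<close>
lemma card_cocycles_ge:
  assumes I: "I \<subseteq> edges" and \<phi>: "\<And>d. d \<in> I \<Longrightarrow> harmonic (\<phi> d :: _ \<Rightarrow> int)" "\<And>d. d \<in> I \<Longrightarrow> \<phi> d d \<noteq> 0"
    "\<And>d d'. d \<in> I \<Longrightarrow> d' \<in> I \<Longrightarrow> d' \<noteq> d \<Longrightarrow> \<phi> d d' = 0"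
  shows "\<exists>B\<ge>1. \<forall>L\<ge>1. L ^ (card I + (card (carrier G) - 1)) \<le> card (cocycles (int (B * L)))"
proof -
  have finI: "finite I" using I fin_edges finite_subset by blast
  \<comment> \<open>A coboundary determines its function up to a constant only; leaving out
    \<open>\<one>\<close> normalises it and accounts for the \<open>- 1\<close> in the
    exponent.\<close>
  define V where "V = carrier G - {\<one>}"
  have V: "finite V" "card V = card (carrier G) - 1" using fin by (auto simp: V_def)
  \<comment> \<open>The summand 1 covers the coboundary part, whose values are at most
    \<open>L\<close> in absolute value, so that \<open>F\<close> is bounded by
    \<open>b * L\<close>.\<close>
  define b where "b = 1 + (\<Sum>e\<in>edges. \<Sum>d\<in>I. nat \<bar>\<phi> d e\<bar>)"
  define u where "u t x = (if x = \<one> then 0 else int (t x))" for t :: "'a \<Rightarrow> nat" and x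
  define F where "F a t e = (\<Sum>d\<in>I. int (a d) * \<phi> d e) + cob (u t) e" for a :: "nat \<times> 'a \<Rightarrow> nat" and t e
  have "L ^ (card I + (card (carrier G) - 1)) \<le> card (cocycles (int ((2 * b + 1) * L)))" if L: "L \<ge> 1" for L
  proof -
    \<comment> \<open>Differences of values of \<open>F\<close> are at most
      \<open>2 * b * L\<close>, less than \<open>m\<close>, so congruence modulo \<open>m\<close> is
      equality.\<close>
    define m where "m = int ((2 * b + 1) * L)"
    have m: "m > 0" unfolding m_def of_nat_0_less_iff using L by simp
    define X where "X = (I \<rightarrow>\<^sub>E {..<L}) \<times> (V \<rightarrow>\<^sub>E {..<L})"
    define \<Phi> where "\<Phi> p = (\<lambda>e\<in>edges. F (fst p) (snd p) e mod m)" for p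
    have F_bound: "\<bar>F a t e\<bar> \<le> int (b * L)" if at: "(a, t) \<in> X" and e: "e \<in> edges" for a t e
    proof -
      have a: "a d < L" if "d \<in> I" for d using at that by (auto simp: X_def PiE_iff)
      have t: "0 \<le> u t x \<and> u t x < int L" if "x \<in> carrier G" for x
        using at that L by (auto simp: X_def PiE_iff V_def u_def)
      have c: "\<bar>cob (u t) e\<bar> \<le> int L"
      proof -
        have "snd e \<in> carrier G" "snd e \<otimes> g (fst e) \<in> carrier G" using e by auto
        then show ?thesis using t[of "snd e"] t[of "snd e \<otimes> g (fst e)"] unfolding cob_def by linarith
      qed
      have "\<bar>\<Sum>d\<in>I. int (a d) * \<phi> d e\<bar> \<le> (\<Sum>d\<in>I. \<bar>int (a d) * \<phi> d e\<bar>)" by (rule sum_abs)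
      also have "\<dots> \<le> (\<Sum>d\<in>I. int L * \<bar>\<phi> d e\<bar>)"
      proof (rule sum_mono)
        fix d assume "d \<in> I"
        then have "int (a d) \<le> int L" using a by fastforce
        then show "\<bar>int (a d) * \<phi> d e\<bar> \<le> int L * \<bar>\<phi> d e\<bar>"
          by (simp add: abs_mult mult_right_mono)
      qed
      also have "\<dots> = int L * int (\<Sum>d\<in>I. nat \<bar>\<phi> d e\<bar>)" by (simp add: sum_distrib_left)
      also have "\<dots> \<le> int L * int (b - 1)"
      proof -
        have "(\<Sum>d\<in>I. nat \<bar>\<phi> d e\<bar>) \<le> b - 1"
          using e fin_edges unfolding b_def by (simp add: member_le_sum[of e edges "\<lambda>e. \<Sum>d\<in>I. nat \<bar>\<phi> d e\<bar>"])
        then show ?thesis by (intro mult_left_mono) (simp_all only: of_nat_le_iff of_nat_0_le_iff)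
      qed
      finally have "\<bar>F a t e\<bar> \<le> int L * int (b - 1) + int L"
        using c unfolding F_def by linarith
      also have "\<dots> = int (b * L)" by (simp add: b_def algebra_simps)
      finally show ?thesis .
    qed
    have "\<Phi> ` X \<subseteq> cocycles m"
    proof
      fix f assume "f \<in> \<Phi> ` X"
      then obtain a t where at: "(a, t) \<in> X" "f = \<Phi> (a, t)" by auto
      have "m dvd path_int G g f x r" if r: "r \<in> set rs" and x: "x \<in> carrier G" for r x
      proof -
        have rw: "r \<in> words n" using r rs_words by auto
        have lin: "path_int G g (\<lambda>e. \<Sum>d\<in>S. int (a d) * \<phi> d e) x r = (\<Sum>d\<in>S. int (a d) * path_int G g (\<phi> d) x r)" for S
        proof (induction S rule: infinite_finite_induct)
          case (insert s S)
          then show ?case by (simp add: path_int_add path_int_cmult)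
        qed (use path_int_cmult[of G g 0 "\<lambda>_. 0 :: int" x r] in auto)
        have "path_int G g (F a t) x r = 0"
          using \<phi>(1) r x cob_cocycle[OF r x, of "u t"]
          by (simp add: F_def[abs_def] path_int_add lin harmonic_iff)
        moreover have "m dvd path_int G g f x r - path_int G g (F a t) x r"
          using x rw by (intro path_int_dvd_diff) (auto simp: at \<Phi>_def minus_mod_eq_mult_div mod_eq_dvd_iff[symmetric])
        ultimately show ?thesis by simp
      qed
      then show "f \<in> cocycles m" using m by (auto simp: cocycles_def cocycle_mod_def at \<Phi>_def)
    qed
    moreover have "inj_on \<Phi> X"
    proof (rule inj_onI)
      fix p p' assume p: "p \<in> X" "p' \<in> X" and eq: "\<Phi> p = \<Phi> p'"
      obtain a t a' t' where pp: "p = (a, t)" "p' = (a', t')" by (cases p, cases p')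
      have F_eq: "F a t e = F a' t' e" if e: "e \<in> edges" for e
      proof -
        have "F a t e mod m = F a' t' e mod m"
          using fun_cong[OF eq, of e] e by (simp add: \<Phi>_def pp)
        then have "m dvd F a t e - F a' t' e" by (simp add: mod_eq_dvd_iff)
        then have "\<bar>m\<bar> \<le> \<bar>F a t e - F a' t' e\<bar>" if "F a t e \<noteq> F a' t' e"
          using dvd_imp_le_int[of "F a t e - F a' t' e" m] that by simp
        moreover have "\<bar>F a t e - F a' t' e\<bar> < m"
        proof -
          have "\<bar>F a t e\<bar> \<le> int (b * L)" "\<bar>F a' t' e\<bar> \<le> int (b * L)" using F_bound p pp e by auto
          moreover have "m = 2 * int (b * L) + int L" by (simp add: m_def algebra_simps)
          ultimately show ?thesis using L by linarith
        qed
        ultimately show ?thesis by linarith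
      qed
      \<comment> \<open>\<open>f\<close> is the harmonic part of the difference and \<open>w\<close>
        the potential of its coboundary part. Since the two agree, \<open>f\<close> vanishes;
        evaluation at \<open>d\<close> then recovers \<open>a\<close>, and integrating along words
        recovers \<open>t\<close>.\<close>
      define w where "w x = u t' x - u t x" for x
      define f where "f e = (\<Sum>d\<in>I. (int (a d) - int (a' d)) * \<phi> d e)" for e
      have fw: "f e = cob w e" if "e \<in> edges" for e
        using F_eq[OF that] by (simp add: F_def f_def w_def cob_def left_diff_distrib sum_subtractf)
      have "harmonic f"
      proof -
        have lin: "chain_int G g (\<lambda>e. \<Sum>d\<in>S. c d * \<phi> d e) x W = (\<Sum>d\<in>S. c d * chain_int G g (\<phi> d) x W)" for S c x W
        proof (induction S rule: infinite_finite_induct)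
          case (insert s S)
          then show ?case by (simp add: chain_int_add chain_int_cmult)
        qed (use chain_int_cmult[of G g 0 "\<lambda>_. 0 :: int" x W] in auto)
        show ?thesis using \<phi>(1) by (simp add: harmonic_def f_def[abs_def] lin)
      qed
      then have hC: "harmonic (\<lambda>e. of_int (f e) :: complex)" by (simp add: harmonic_def chain_int_of_int)
      have f0: "f e = 0" if e: "e \<in> edges" for e
      proof -
        have "(of_int (f e) :: complex) = 0"
          using harmonic_cob_zero[OF fin hC, of "\<lambda>x. of_int (w x)"] fw e by (simp add: cob_def)
        then show ?thesis by simp
      qed
      have "a d = a' d" if d: "d \<in> I" for d
      proof -
        have "f d = (\<Sum>d'\<in>I. if d' = d then (int (a d) - int (a' d)) * \<phi> d d else 0)"
          unfolding f_def using \<phi>(3) d by (intro sum.cong) auto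
        then have "(int (a d) - int (a' d)) * \<phi> d d = 0" using f0[of d] d I finI by auto
        then show ?thesis using \<phi>(2)[OF d] by simp
      qed
      then have "a = a'" using p by (auto simp: pp X_def intro: PiE_ext)
      moreover have "t x = t' x" if x: "x \<in> V" for x
      proof -
        obtain v where v: "v \<in> words n" "x = word_value G g v" using gen x by (auto simp: V_def)
        have "path_int G g (cob w) \<one> v - path_int G g (\<lambda>_. 0) \<one> v = 0"
          using path_int_dvd_diff[of 0 "cob w" "\<lambda>_. 0" \<one> v] fw f0 v(1) by simp
        moreover have "path_int G g (\<lambda>_. 0 :: int) \<one> v = 0"
          using path_int_cmult[of G g 0 "\<lambda>_. 0 :: int" \<one> v] by simp
        ultimately have "w x = w \<one>" using path_int_cob[of \<one> v w] v word_value_closed[OF v(1)] by simp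
        then show ?thesis using x by (simp add: w_def u_def V_def)
      qed
      then have "t = t'" using p by (auto simp: pp X_def intro: PiE_ext)
      ultimately show "p = p'" by (simp add: pp)
    qed
    moreover have "finite (cocycles m)"
      by (rule finite_subset[of _ "edges \<rightarrow>\<^sub>E {0..<m}"]) (auto simp: cocycles_def fin_edges intro: finite_PiE)
    ultimately have "card X \<le> card (cocycles m)" using card_inj_on_le by blast
    moreover have "card X = L ^ (card I + (card (carrier G) - 1))"
      using finI V by (simp add: X_def card_cartesian_product card_PiE power_add)
    ultimately show ?thesis by (simp add: m_def)
  qed
  then show ?thesis by (intro exI[of _ "2 * b + 1"]) auto
qed

end

section \<open>Cocycles on the finite quotients of a presented group\<close>

locale presented_group = group G for G (structure) +
  fixes n :: nat and g :: "nat \<Rightarrow> 'a" and rs :: "letter list list"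
  assumes pres: "finite_presentation G n g rs"
begin

sublocale connected_cayley G n g rs
proof
  show "g i \<in> carrier G" if "i < n" for i
    using pres that by (auto simp: finite_presentation_def)
  then interpret pc: presentation_cayley G n g rs
    using pres by unfold_locales (auto simp: finite_presentation_def)
  show "set rs \<subseteq> words n" "word_value G g ` words n = carrier G"
    using pres by (auto simp: finite_presentation_def)
  fix r assume r: "r \<in> set rs"
  have "presented_eq n (set rs) ([] @ r @ []) ([] @ [])"
    using r by (intro presented_eq.relator) auto
  moreover have "r \<in> words n" using r pres by (auto simp: finite_presentation_def)
  moreover have "\<forall>v\<in>words n. \<forall>w\<in>words n. word_value G g v = word_value G g w \<longleftrightarrow> presented_eq n (set rs) v w"
    using pres by (simp add: finite_presentation_def)
  ultimately have "word_value G g r = word_value G g []" by (simp del: pc.word_value_simps)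
  then show "word_value G g r = \<one>" by simp
qed

lemma quotient_connected:
  assumes N: "N \<lhd> G"
  shows "connected_cayley (G Mod N) n (\<lambda>i. N #> g i) rs"
    and "w \<in> words n \<Longrightarrow> word_value (G Mod N) (\<lambda>i. N #> g i) w = N #> word_value G g w"
proof -
  have sN: "subgroup N G" using N by (rule normal_imp_subgroup)
  interpret Q: presentation_cayley "G Mod N" n "\<lambda>i. N #> g i" rs
    using normal.factorgroup_is_group[OF N] rs_words
    by (intro presentation_cayley.intro presentation_cayley_axioms.intro) (auto simp: carrier_FactGroup)
  have wv: "word_value (G Mod N) (\<lambda>i. N #> g i) w = N #> word_value G g w" if "w \<in> words n" for w
    using that
  proof (induction w)
    case Nil
    then show ?case using subgroup.subset[OF sN] by simp
  next
    case (Cons l w)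
    then have "letter_value (G Mod N) (\<lambda>i. N #> g i) l = N #> letter_value G g l"
      using FactGroup_inv_rcos[OF N] by (auto simp: letter_value_def)
    then show ?case
      using Cons FactGroup_mult_rcos[OF N letter_value_closed word_value_closed] by simp
  qed
  show "w \<in> words n \<Longrightarrow> word_value (G Mod N) (\<lambda>i. N #> g i) w = N #> word_value G g w" by (rule wv)
  show "connected_cayley (G Mod N) n (\<lambda>i. N #> g i) rs"
  proof unfold_locales
    have "word_value (G Mod N) (\<lambda>i. N #> g i) ` words n = (\<lambda>x. N #> x) ` word_value G g ` words n"
      using wv by (auto simp: image_image)
    then show "word_value (G Mod N) (\<lambda>i. N #> g i) ` words n = carrier (G Mod N)"
      by (simp add: gen carrier_FactGroup)
    show "word_value (G Mod N) (\<lambda>i. N #> g i) r = \<one>\<^bsub>G Mod N\<^esub>" if "r \<in> set rs" for r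
      using that rs_words wv[of r] rel[OF that] subgroup.subset[OF sN] by auto
  qed
qed

text \<open>
  A cocycle on a finite quotient \<open>Q\<close> with values in \<open>\<int>/m\<close> is a derivation of \<open>G\<close> with values in
  \<open>\<int>/m[Q]\<close>, which factors through a finite quotient \<open>G/N'\<close>. It is determined by its values on
  the generators of \<open>G/N'\<close> that come from topological generators of the profinite completion.
\<close>
lemma card_cocycles_le:
  assumes N: "N \<in> finite_index_normal G"
    and S: "finite S" "S \<subseteq> carrier (profinite_completion G)"
    and dense: "top_generates S"
    and m: "m > 0"
  shows "card (presentation_cayley.cocycles (G Mod N) n (\<lambda>i. N #> g i) rs (int m))
    \<le> m ^ (card S * card (carrier (G Mod N)))"
proof -
  note nN = finite_index_normalD[OF N]
  define Q where "Q = G Mod N"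
  define \<pi> where "\<pi> x = N #> x" for x
  define h where "h i = \<pi> (g i)" for i
  interpret Q: connected_cayley Q n h rs
    using quotient_connected(1)[OF nN(1)] by (simp add: Q_def h_def[abs_def] \<pi>_def)
  have finQ: "finite (carrier Q)" using nN by (simp add: Q_def)
  have \<pi>_mem: "\<pi> x \<in> carrier Q" if "x \<in> carrier G" for x
    using that by (auto simp: Q_def \<pi>_def carrier_FactGroup)
  have \<pi>_mult: "\<pi> (x \<otimes> y) = \<pi> x \<otimes>\<^bsub>Q\<^esub> \<pi> y" if "x \<in> carrier G" "y \<in> carrier G" for x y
    using FactGroup_mult_rcos[OF nN(1) that] by (simp add: Q_def \<pi>_def)
  have \<pi>_one: "\<pi> x = \<one>\<^bsub>Q\<^esub>" if "x \<in> N" for x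
    using subgroup.rcos_const[OF nN(2) is_group that] by (simp add: Q_def \<pi>_def)
  define Z where "Z = Q.cocycles (int m)"
  \<comment> \<open>\<open>D f x q\<close> is the coefficient at \<open>q\<close> of the derivation
    attached to \<open>f\<close>, evaluated at \<open>x\<close>: the base point of the path serves
    as the group ring coordinate.\<close>
  define D where "D f x q = path_int Q h f q (rep_word x)" for f :: "nat \<times> 'a set \<Rightarrow> int" and x q
  have Z_coc: "Q.cocycle_mod (int m) f" if "f \<in> Z" for f using that by (simp add: Z_def Q.cocycles_def)
  \<comment> \<open>Since \<open>rs\<close> presents \<open>G\<close>, two words for the same
    element are congruent, so modulo \<open>m\<close> the choice made by \<open>rep_word\<close>
    does not affect \<open>D\<close>.\<close>
  have D_word: "int m dvd path_int Q h f q w - D f (word_value G g w) q"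
    if "f \<in> Z" "q \<in> carrier Q" "w \<in> words n" for f q w
  proof -
    have x: "word_value G g w \<in> carrier G" using word_value_closed that by simp
    have "presented_eq n (set rs) w (rep_word (word_value G g w))"
      using pres rep_word[OF x] that(3) unfolding finite_presentation_def by metis
    from Q.presented_eq_path_int[OF this Z_coc[OF that(1)]] show ?thesis using that(2) by (simp add: D_def)
  qed
  \<comment> \<open>The Leibniz rule, with \<open>G\<close> acting on base points through
    \<open>\<pi>\<close>.\<close>
  have D_mult: "int m dvd D f (x \<otimes> y) q - D f x q - D f y (q \<otimes>\<^bsub>Q\<^esub> \<pi> x)"
    if "f \<in> Z" "q \<in> carrier Q" "x \<in> carrier G" "y \<in> carrier G" for f q x y
  proof -
    have w: "rep_word x @ rep_word y \<in> words n" using rep_word that words_append by simp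
    have "word_value G g (rep_word x @ rep_word y) = x \<otimes> y" using rep_word that by (simp add: word_value_append)
    moreover have "word_value Q h (rep_word x) = \<pi> x"
      using quotient_connected(2)[OF nN(1) rep_word(1)[OF that(3)]] rep_word that by (simp add: Q_def h_def[abs_def] \<pi>_def)
    ultimately have "int m dvd D f x q + D f y (q \<otimes>\<^bsub>Q\<^esub> \<pi> x) - D f (x \<otimes> y) q"
      using D_word[OF that(1,2) w] that rep_word by (simp add: Q.path_int_append D_def)
    then show ?thesis by (simp add: dvd_diff_commute diff_diff_eq)
  qed
  have D_one: "int m dvd D f \<one> q" if "f \<in> Z" "q \<in> carrier Q" for f q
    using D_word[OF that, of "[]"] by simp
  have D_gen: "int m dvd f (i, q) - D f (g i) q" if "f \<in> Z" "q \<in> carrier Q" "i < n" for f i q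
    using D_word[OF that(1,2), of "[(i, True)]"] that(3) by (simp add: letter_value_def)
  have D_inv: "int m dvd D f x q + D f (inv x) (q \<otimes>\<^bsub>Q\<^esub> \<pi> x)"
    if "f \<in> Z" "q \<in> carrier Q" "x \<in> carrier G" for f q x
  proof -
    have "D f x q + D f (inv x) (q \<otimes>\<^bsub>Q\<^esub> \<pi> x) =
        D f \<one> q - (D f (x \<otimes> inv x) q - D f x q - D f (inv x) (q \<otimes>\<^bsub>Q\<^esub> \<pi> x))"
      using that(3) by simp
    then show ?thesis using D_mult[OF that(1,2,3), of "inv x"] D_one[OF that(1,2)] that(3)
      by (metis dvd_diff inv_closed)
  qed
  \<comment> \<open>The common kernel of all derivations from \<open>Z\<close> within
    \<open>N\<close>. Elements of \<open>N\<close> fix all base points, so modulo \<open>m\<close>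
    the derivations restrict to homomorphisms on \<open>N\<close>.\<close>
  define N' where "N' = {x \<in> N. \<forall>f\<in>Z. \<forall>q\<in>carrier Q. int m dvd D f x q}"
  have N'_carrier: "x \<in> carrier G" if "x \<in> N'" for x
    using that subgroup.mem_carrier[OF nN(2)] by (auto simp: N'_def)
  have N'_diff: "int m dvd D f (x \<otimes> inv y) q - (D f x q - D f y q)"
    if "f \<in> Z" "q \<in> carrier Q" "x \<in> carrier G" "y \<in> carrier G" "\<pi> x = \<pi> y" for f q x y
  proof -
    have "D f (x \<otimes> inv y) q - (D f x q - D f y q) =
        (D f (x \<otimes> inv y) q - D f x q - D f (inv y) (q \<otimes>\<^bsub>Q\<^esub> \<pi> x)) +
        (D f y q + D f (inv y) (q \<otimes>\<^bsub>Q\<^esub> \<pi> y))" using that(5) by simp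
    then show ?thesis using D_mult[of f q x "inv y"] D_inv[of f q y] that by (metis dvd_add inv_closed)
  qed
  have "N' \<lhd> G"
    unfolding normal_inv_iff
  proof (intro conjI ballI)
    show "subgroup N' G"
    proof (rule subgroupI)
      show "N' \<subseteq> carrier G" using N'_carrier by blast
      show "N' \<noteq> {}" using D_one subgroup.one_closed[OF nN(2)] by (auto simp: N'_def)
      fix x assume x: "x \<in> N'"
      have xc: "x \<in> carrier G" and xN: "x \<in> N" using x N'_carrier by (auto simp: N'_def)
      have "int m dvd D f (inv x) q" if "f \<in> Z" "q \<in> carrier Q" for f q
      proof -
        have "int m dvd D f x q" using x that by (simp add: N'_def)
        moreover have "int m dvd D f x q + D f (inv x) q"
          using D_inv[OF that xc] that \<pi>_one[OF xN] by simp
        ultimately show ?thesis by (simp add: dvd_add_right_iff)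
      qed
      then show "inv x \<in> N'" using xN nN(2) by (auto simp: N'_def subgroup.m_inv_closed)
      fix y assume y: "y \<in> N'"
      have yc: "y \<in> carrier G" and yN: "y \<in> N" using y N'_carrier by (auto simp: N'_def)
      have "int m dvd D f (x \<otimes> y) q" if "f \<in> Z" "q \<in> carrier Q" for f q
      proof -
        have "int m dvd D f x q" "int m dvd D f y q" using x y that by (simp_all add: N'_def)
        moreover have "int m dvd D f (x \<otimes> y) q - D f x q - D f y q"
          using D_mult[OF that xc yc] that \<pi>_one[OF xN] by simp
        ultimately show ?thesis by (simp add: dvd_diff_left_iff)
      qed
      then show "x \<otimes> y \<in> N'" using xN yN nN(2) by (auto simp: N'_def subgroup.m_closed)
    qed
    fix x y assume x: "x \<in> carrier G" and y: "y \<in> N'"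
    have yc: "y \<in> carrier G" and yN: "y \<in> N" using y N'_carrier by (auto simp: N'_def)
    have \<pi>xy: "\<pi> (x \<otimes> y) = \<pi> x" using \<pi>_mult[OF x yc] \<pi>_one[OF yN] \<pi>_mem[OF x] by simp
    \<comment> \<open>The Leibniz rule turns conjugation by \<open>x\<close> into a shift of the
      base point by \<open>\<pi> x\<close>, under which the condition on \<open>y\<close> is
      stable.\<close>
    have "int m dvd D f (x \<otimes> y \<otimes> inv x) q" if "f \<in> Z" "q \<in> carrier Q" for f q
    proof -
      have qx: "q \<otimes>\<^bsub>Q\<^esub> \<pi> x \<in> carrier Q" using that \<pi>_mem[OF x] by simp
      have 1: "int m dvd D f (x \<otimes> y \<otimes> inv x) q - (D f (x \<otimes> y) q - D f x q)"
        by (rule N'_diff) (use that x yc \<pi>xy in auto)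
      have 2: "int m dvd D f (x \<otimes> y) q - D f x q - D f y (q \<otimes>\<^bsub>Q\<^esub> \<pi> x)"
        by (rule D_mult[OF that x yc])
      have 3: "int m dvd D f y (q \<otimes>\<^bsub>Q\<^esub> \<pi> x)" using y that qx by (simp add: N'_def)
      have "D f (x \<otimes> y \<otimes> inv x) q = (D f (x \<otimes> y \<otimes> inv x) q - (D f (x \<otimes> y) q - D f x q)) +
          ((D f (x \<otimes> y) q - D f x q - D f y (q \<otimes>\<^bsub>Q\<^esub> \<pi> x)) + D f y (q \<otimes>\<^bsub>Q\<^esub> \<pi> x))" by simp
      then show ?thesis using 1 2 3 by (metis dvd_add)
    qed
    then show "x \<otimes> y \<otimes> inv x \<in> N'"
      using x yN normal.inv_op_closed2[OF nN(1)] by (auto simp: N'_def)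
  qed
  have "finite Z"
    by (rule finite_subset[of _ "({..<n} \<times> carrier Q) \<rightarrow>\<^sub>E {0..<int m}"])
      (auto simp: Z_def Q.cocycles_def finQ intro: finite_PiE)
  have "N' \<in> finite_index_normal G"
  proof (rule finite_index_normalI[OF \<open>N' \<lhd> G\<close>])
    let ?\<kappa> = "\<lambda>x. (\<pi> x, \<lambda>p\<in>Z \<times> carrier Q. D (fst p) x (snd p) mod int m)"
    have "?\<kappa> ` carrier G \<subseteq> carrier Q \<times> ((Z \<times> carrier Q) \<rightarrow>\<^sub>E {0..<int m})"
      using m \<pi>_mem by (simp add: image_subset_iff restrict_PiE_iff)
    then show "finite (?\<kappa> ` carrier G)"
      by (rule finite_subset) (auto simp: finQ \<open>finite Z\<close> intro!: finite_PiE)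
    fix x y assume xy: "x \<in> carrier G" "y \<in> carrier G" and eq: "?\<kappa> x = ?\<kappa> y"
    have \<pi>xy: "\<pi> x = \<pi> y" using eq by simp
    have "int m dvd D f (x \<otimes> inv y) q" if "f \<in> Z" "q \<in> carrier Q" for f q
    proof -
      have "D f x q mod int m = D f y q mod int m"
        using fun_cong[OF arg_cong[OF eq, of snd], of "(f, q)"] that by simp
      then have "int m dvd D f x q - D f y q" by (simp add: mod_eq_dvd_iff)
      moreover have "int m dvd D f (x \<otimes> inv y) q - (D f x q - D f y q)"
        by (rule N'_diff[OF that xy \<pi>xy])
      ultimately show ?thesis by (metis diff_add_cancel dvd_add)
    qed
    moreover have "x \<otimes> inv y \<in> N" using \<pi>xy rcos_eq_iff[OF nN(2) xy] by (simp add: \<pi>_def)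
    ultimately show "x \<otimes> inv y \<in> N'" by (simp add: N'_def)
  qed
  define \<rho> where "\<rho> s = (SOME x. x \<in> carrier G \<and> s N' = N' #> x)" for s :: "'a set \<Rightarrow> 'a set"
  have \<rho>: "\<rho> s \<in> carrier G \<and> s N' = N' #> \<rho> s" if "s \<in> S" for s
  proof -
    have "s N' \<in> carrier (G Mod N')"
      using that S(2) \<open>N' \<in> finite_index_normal G\<close> by (intro profinite_completion_mem) auto
    then have "\<exists>x. x \<in> carrier G \<and> s N' = N' #> x" by (auto simp: carrier_FactGroup)
    then show ?thesis unfolding \<rho>_def by (rule someI_ex)
  qed
  define \<Psi> where "\<Psi> f = (\<lambda>p\<in>S \<times> carrier Q. D f (\<rho> (fst p)) (snd p) mod int m)" for f
  have "inj_on \<Psi> Z"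
  proof (rule inj_onI)
    fix f f' assume f: "f \<in> Z" "f' \<in> Z" and eq: "\<Psi> f = \<Psi> f'"
    \<comment> \<open>Two derivations agree modulo \<open>m\<close> on a subgroup. Here it contains
      \<open>N'\<close> and the cosets of all \<open>\<rho> s\<close>, hence by density everything,
      in particular the \<open>g i\<close>, whose values recover the cocycles.\<close>
    define H where "H = {x \<in> carrier G. \<forall>q\<in>carrier Q. int m dvd D f x q - D f' x q}"
    have "subgroup H G"
    proof (rule subgroupI)
      show "H \<subseteq> carrier G" by (auto simp: H_def)
      show "H \<noteq> {}" using D_one f by (auto simp: H_def intro!: exI[of _ \<one>] dvd_diff)
      fix x assume x: "x \<in> H"
      then have xc: "x \<in> carrier G" by (simp add: H_def)
      have "int m dvd D f (inv x) q - D f' (inv x) q" if q: "q \<in> carrier Q" for q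
      proof -
        \<comment> \<open>Chosen with \<open>p \<pi>(x) = q\<close>, so that \<open>D_inv\<close> at
          base point \<open>p\<close> speaks about \<open>inv x\<close> at \<open>q\<close>.\<close>
        define p where "p = q \<otimes>\<^bsub>Q\<^esub> \<pi> (inv x)"
        have p: "p \<in> carrier Q" using q xc \<pi>_mem by (simp add: p_def)
        have "\<pi> (inv x) \<otimes>\<^bsub>Q\<^esub> \<pi> x = \<one>\<^bsub>Q\<^esub>"
          using \<pi>_mult[of "inv x" x] xc \<pi>_one[OF subgroup.one_closed[OF nN(2)]] by simp
        then have pq: "p \<otimes>\<^bsub>Q\<^esub> \<pi> x = q" using q xc \<pi>_mem by (simp add: p_def Q.m_assoc)
        have "D f (inv x) q - D f' (inv x) q = (D f x p + D f (inv x) q) - (D f' x p + D f' (inv x) q)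
            - (D f x p - D f' x p)" by simp
        moreover have "int m dvd D f x p + D f (inv x) q" "int m dvd D f' x p + D f' (inv x) q"
          using D_inv[OF _ p xc] f pq by auto
        moreover have "int m dvd D f x p - D f' x p" using x p by (simp add: H_def)
        ultimately show ?thesis by (metis dvd_diff)
      qed
      then show "inv x \<in> H" using xc by (simp add: H_def)
      fix y assume y: "y \<in> H"
      then have yc: "y \<in> carrier G" by (simp add: H_def)
      have "int m dvd D f (x \<otimes> y) q - D f' (x \<otimes> y) q" if q: "q \<in> carrier Q" for q
      proof -
        define p where "p = q \<otimes>\<^bsub>Q\<^esub> \<pi> x"
        have p: "p \<in> carrier Q" using q xc \<pi>_mem by (simp add: p_def)
        have "D f (x \<otimes> y) q - D f' (x \<otimes> y) q = (D f (x \<otimes> y) q - D f x q - D f y p)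
            - (D f' (x \<otimes> y) q - D f' x q - D f' y p) + ((D f x q - D f' x q) + (D f y p - D f' y p))"
          by simp
        moreover have "int m dvd D f (x \<otimes> y) q - D f x q - D f y p"
          "int m dvd D f' (x \<otimes> y) q - D f' x q - D f' y p"
          using D_mult[OF _ q xc yc] f by (auto simp: p_def)
        moreover have "int m dvd D f x q - D f' x q" "int m dvd D f y p - D f' y p"
          using x y p q by (simp_all add: H_def)
        ultimately show ?thesis by (metis dvd_add dvd_diff)
      qed
      then show "x \<otimes> y \<in> H" using xc yc by (simp add: H_def)
    qed
    moreover have N'H: "N' \<subseteq> H"
      using f N'_carrier by (auto simp: H_def N'_def intro!: dvd_diff)
    moreover have "s N' \<subseteq> H" if s: "s \<in> S" for s
    proof -
      have "D f (\<rho> s) q mod int m = D f' (\<rho> s) q mod int m" if "q \<in> carrier Q" for q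
        using fun_cong[OF eq, of "(s, q)"] s that by (simp add: \<Psi>_def)
      then have "\<rho> s \<in> H" using \<rho>[OF s] by (simp add: H_def mod_eq_dvd_iff)
      then show ?thesis
        using \<rho>[OF s] N'H subgroup.m_closed[OF \<open>subgroup H G\<close>] by (auto simp: r_coset_def)
    qed
    ultimately have H: "H = carrier G"
      by (intro dense_generators_subgroup[OF S(2) dense \<open>N' \<in> finite_index_normal G\<close>])
    have PiE: "f \<in> ({..<n} \<times> carrier Q) \<rightarrow>\<^sub>E {0..<int m}" "f' \<in> ({..<n} \<times> carrier Q) \<rightarrow>\<^sub>E {0..<int m}"
      using f by (auto simp: Z_def Q.cocycles_def)
    show "f = f'"
    proof (rule PiE_ext[OF PiE])
      fix e assume e: "e \<in> {..<n} \<times> carrier Q"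
      obtain i q where iq: "e = (i, q)" "i < n" "q \<in> carrier Q" using e by auto
      have "g i \<in> H" using H iq by simp
      then have "int m dvd D f (g i) q - D f' (g i) q" using iq by (simp add: H_def)
      moreover have "int m dvd f (i, q) - D f (g i) q" "int m dvd f' (i, q) - D f' (g i) q"
        using D_gen f iq by auto
      moreover have "f (i, q) - f' (i, q) = (f (i, q) - D f (g i) q) - (f' (i, q) - D f' (g i) q)
          + (D f (g i) q - D f' (g i) q)" by simp
      ultimately have "int m dvd f (i, q) - f' (i, q)" by (metis dvd_add dvd_diff)
      then have "f e mod int m = f' e mod int m" by (simp add: mod_eq_dvd_iff iq)
      moreover have "f e \<in> {0..<int m}" "f' e \<in> {0..<int m}" using PiE e by (auto simp: PiE_iff)
      ultimately show "f e = f' e" by simp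
    qed
  qed
  moreover have "\<Psi> ` Z \<subseteq> (S \<times> carrier Q) \<rightarrow>\<^sub>E {0..<int m}"
    using m by (simp add: \<Psi>_def image_subset_iff restrict_PiE_iff)
  moreover have "finite ((S \<times> carrier Q) \<rightarrow>\<^sub>E {0..<int m})" using S(1) finQ by (intro finite_PiE) auto
  ultimately have "card Z \<le> card ((S \<times> carrier Q) \<rightarrow>\<^sub>E {0..<int m})" using card_inj_on_le by blast
  also have "\<dots> = m ^ (card S * card (carrier Q))"
    using S(1) finQ by (simp add: card_PiE card_cartesian_product)
  finally show ?thesis by (simp add: Z_def Q_def h_def[abs_def] \<pi>_def)
qed

end

section \<open>The approximation argument\<close>

text \<open>The constant \<open>B ^ c\<close> is beaten by \<open>L = B ^ c + 1\<close> as soon as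
  \<open>a\<close> exceeds \<open>c\<close>.\<close>

lemma exponent_le_if_power_le:
  fixes B a c :: nat
  assumes "\<And>L. L \<ge> 1 \<Longrightarrow> L ^ a \<le> (B * L) ^ c"
  shows "a \<le> c"
proof (rule ccontr)
  assume "\<not> a \<le> c"
  define L where "L = B ^ c + 1"
  have "L ^ c * L \<le> L ^ a" using \<open>\<not> a \<le> c\<close> power_increasing[of "Suc c" a L] by (simp add: L_def mult.commute)
  also have "L ^ a \<le> L ^ c * B ^ c" using assms[of L] by (simp add: L_def power_mult_distrib mult.commute del: mult_Suc mult_Suc_right)
  finally have "L \<le> B ^ c" by (simp add: L_def)
  then show False by (simp add: L_def)
qed

lemma (in connected_cayley) cayley_translation:
  assumes "q \<in> carrier G"
  shows "cayley_map G n g (pres_chains n rs) G g (\<lambda>x. inv q \<otimes> x)"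
  using assms by unfold_locales (auto simp: m_assoc)

text \<open>Left translations commute with \<open>damp\<close>, so a diagonal entry depends only on
  the direction \<open>i\<close> of the edge. The factor is the one between the trace of a matrix
  and the von Neumann trace.\<close>

lemma (in finite_connected_cayley) sum_damp_diagonal:
  "(\<Sum>e\<in>edges. (damp G g (pres_chains n rs) c ^^ k) (delta e) e :: 'c::comm_ring_1) =
    of_nat (card (carrier G)) * (\<Sum>i<n. (damp G g (pres_chains n rs) c ^^ k) (delta (i, \<one>)) (i, \<one>))"
proof -
  let ?T = "damp G g (pres_chains n rs) c ^^ k :: (nat \<times> 'a \<Rightarrow> 'c) \<Rightarrow> _"
  have "?T (delta (i, q)) (i, q) = ?T (delta (i, \<one>)) (i, \<one>)" if "i < n" "q \<in> carrier G" for i q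
  proof -
    interpret m: cayley_map G n g "pres_chains n rs" G g "\<lambda>x. inv q \<otimes> x"
      using that(2) by (rule cayley_translation)
    have "?T (delta (i, q)) (i, q) = ?T (delta (i, \<one>)) (i, inv q \<otimes> q)"
    proof (rule m.damp_pow_map[OF _ that])
      fix j x assume "x \<in> carrier G"
      then have "x = q \<longleftrightarrow> inv q \<otimes> x = \<one>" using that(2) inv_solve_left[of \<one> q x] by auto
      then show "delta (i, q) (j, x) = delta (i, \<one>) (j, inv q \<otimes> x)" by simp
    qed
    then show ?thesis using that by simp
  qed
  note eq = this
  have "(\<Sum>i<n. \<Sum>q\<in>carrier G. ?T (delta (i, q)) (i, q)) =
      (\<Sum>i<n. \<Sum>q\<in>carrier G. ?T (delta (i, \<one>)) (i, \<one>))"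
    by (intro sum.cong HOL.refl eq) (simp_all only: lessThan_iff)
  then show ?thesis by (simp add: sum.cartesian_product case_prod_unfold sum_distrib_left)
qed

context presented_group
begin

abbreviation "Ws \<equiv> pres_chains n rs"

lemma quotient_trace_bound:
  assumes N: "N \<in> finite_index_normal G"
    and S: "finite S" "S \<subseteq> carrier (profinite_completion G)"
    and dense: "top_generates S"
    and K: "K \<ge> 1" "lap_bound Ws \<le> K" and k: "k \<ge> 2"
  shows "(\<Sum>i<n. Re ((damp (G Mod N) (\<lambda>i. N #> g i) Ws (of_real (1 / K)) ^^ k) (delta (i, N)) (i, N)))
    \<le> real (card S) - 1 + 1 / real (card (carrier (G Mod N))) +
      real n * (2 * ln K / ln (real k) + exp (- sqrt (real k)))"
proof -
  note nN = finite_index_normalD[OF N]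
  define Q where "Q = G Mod N"
  define h where "h i = N #> g i" for i
  interpret Q: finite_connected_cayley Q n h rs
    using quotient_connected(1)[OF nN(1)] nN(3)
    by (simp add: Q_def h_def[abs_def] finite_connected_cayley_def finite_connected_cayley_axioms_def)
  define q where "q = card (carrier Q)"
  define d where "d = card S"
  define \<epsilon> where "\<epsilon> = 2 * ln K / ln (real k) + exp (- sqrt (real k))"
  have q: "q \<ge> 1" using Q.fin Q.one_closed by (auto simp: q_def card_gt_0_iff Suc_le_eq)
  obtain I :: "(nat \<times> 'a set) set" and \<phi> :: "nat \<times> 'a set \<Rightarrow> nat \<times> 'a set \<Rightarrow> int" where
    I: "I \<subseteq> Q.edges" "\<And>d. d \<in> I \<Longrightarrow> Q.harmonic (\<phi> d)" "\<And>d. d \<in> I \<Longrightarrow> \<phi> d d \<noteq> 0"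
      "\<And>d d'. d \<in> I \<Longrightarrow> d' \<in> I \<Longrightarrow> d' \<noteq> d \<Longrightarrow> \<phi> d d' = 0"
    and tr': "\<And>k. k \<ge> 2 \<Longrightarrow> Re (\<Sum>e\<in>Q.edges. (damp Q h Ws (of_real (1 / K)) ^^ k) (delta e) e) \<le>
      real (card I) + real (card Q.edges) * (2 * ln K / ln (real k) + exp (- sqrt (real k)))"
    by (rule Q.laplacian_matrix[OF K]) (rule that; assumption)
  have tr: "Re (\<Sum>e\<in>Q.edges. (damp Q h Ws (of_real (1 / K)) ^^ k) (delta e) e) \<le>
      real (card I) + real (card Q.edges) * \<epsilon>"
    unfolding \<epsilon>_def by (rule tr'[OF k])
  obtain B where B: "\<And>L. L \<ge> 1 \<Longrightarrow> L ^ (card I + (q - 1)) \<le> card (Q.cocycles (int (B * L)))" and B1: "B \<ge> 1"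
    using Q.card_cocycles_ge[OF I] unfolding q_def by blast
  \<comment> \<open>Both counts are made modulo \<open>B * L\<close> with \<open>B\<close>
    independent of \<open>L\<close>; letting \<open>L\<close> grow compares the exponents.\<close>
  have "card I + (q - 1) \<le> d * q"
  proof (rule exponent_le_if_power_le)
    fix L :: nat assume L: "L \<ge> 1"
    have "card (Q.cocycles (int (B * L))) \<le> (B * L) ^ (d * q)"
      using card_cocycles_le[OF N S dense, of "B * L"] L B1
      by (simp add: Q_def h_def[abs_def] d_def q_def)
    then show "L ^ (card I + (q - 1)) \<le> (B * L) ^ (d * q)" using B[OF L] by linarith
  qed
  then have "real (card I + (q - 1)) \<le> real (d * q)" by (rule of_nat_mono)
  then have r: "real (card I) \<le> real d * real q - real q + 1" using q by (simp add: of_nat_diff)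
  define t where "t = (\<Sum>i<n. Re ((damp Q h Ws (of_real (1 / K)) ^^ k) (delta (i, N)) (i, N)))"
  have "real q * t = Re (\<Sum>e\<in>Q.edges. (damp Q h Ws (of_real (1 / K)) ^^ k) (delta e) e)"
    unfolding Q.sum_damp_diagonal by (simp add: q_def t_def Q_def)
  also have "\<dots> \<le> real d * real q - real q + 1 + real n * real q * \<epsilon>"
    using tr r by (simp add: card_cartesian_product q_def)
  finally have "t \<le> (real d * real q - real q + 1 + real n * real q * \<epsilon>) / real q"
    using q by (simp add: field_simps)
  also have "\<dots> = real d - 1 + 1 / real q + real n * \<epsilon>" using q by (simp add: field_simps)
  finally show ?thesis by (simp add: t_def d_def q_def Q_def h_def[abs_def] \<epsilon>_def)
qed

text \<open>\<open>N\<close> is chosen to miss the nontrivial vertices that the power sees from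
  \<open>(i, \<one>)\<close>, and the nontrivial quotients \<open>x \<otimes> inv y\<close> of
  \<open>R\<close> distinct elements. The first keeps the diagonal entries, the second makes the
  index at least \<open>R\<close>.\<close>

lemma exists_deep_quotient:
  assumes rf: "residually_finite G" and inf: "infinite (carrier G)"
  shows "\<exists>N\<in>finite_index_normal G. R \<le> card (carrier (G Mod N)) \<and>
    (\<forall>i<n. (damp G g Ws c ^^ k) (delta (i, \<one>)) (i, \<one>) =
      ((damp (G Mod N) (\<lambda>i. N #> g i) Ws c ^^ k) (delta (i, N)) (i, N) :: 'c::comm_ring_1))"
proof -
  have "\<forall>i\<in>{..<n}. \<exists>F. finite F \<and> F \<subseteq> edges \<and> (\<forall>f f' :: _ \<Rightarrow> 'c.
      (\<forall>e\<in>F. f e = f' e) \<longrightarrow> (damp G g Ws c ^^ k) f (i, \<one>) = (damp G g Ws c ^^ k) f' (i, \<one>))"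
    by (intro ballI finitary_damp_pow[unfolded finitary_def]) auto
  then obtain F where F: "\<And>i. i < n \<Longrightarrow> finite (F i)" "\<And>i. i < n \<Longrightarrow> F i \<subseteq> edges"
    "\<And>i f f'. i < n \<Longrightarrow> (\<forall>e\<in>F i. f e = f' e) \<Longrightarrow>
      (damp G g Ws c ^^ k) f (i, \<one>) = ((damp G g Ws c ^^ k) f' (i, \<one>) :: 'c)"
    unfolding bchoice_iff by (metis lessThan_iff)
  obtain Y where Y: "finite Y" "Y \<subseteq> carrier G" "card Y = R"
    using infinite_arbitrarily_large[OF inf] by blast
  define X where "X = ((\<Union>i<n. snd ` F i) \<union> (\<lambda>(x, y). x \<otimes> inv y) ` (Y \<times> Y)) - {\<one>}"
  have "finite X" "X \<subseteq> carrier G" "\<one> \<notin> X" using F(1,2) Y(1,2) by (fastforce simp: X_def)+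
  then obtain N where N: "N \<in> finite_index_normal G" "N \<inter> X = {}"
    using residually_finite_avoid[OF rf] by blast
  note nN = finite_index_normalD[OF N(1)]
  interpret m: cayley_map G n g Ws "G Mod N" "\<lambda>i. N #> g i" "\<lambda>x. N #> x"
    by unfold_locales (use FactGroup_mult_rcos[OF nN(1)] FactGroup_inv_rcos[OF nN(1)] in auto)
  have "inj_on (\<lambda>x. N #> x) Y"
  proof (rule inj_onI)
    fix x y assume xy: "x \<in> Y" "y \<in> Y" "N #> x = N #> y"
    then have "x \<otimes> inv y \<in> N" using rcos_eq_iff[OF nN(2)] Y(2) by auto
    then have "x \<otimes> inv y = \<one>" using N(2) xy by (force simp: X_def)
    then show "x = y" using xy Y(2) by (metis inv_closed inv_equality inv_inv subsetD)
  qed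
  moreover have "(\<lambda>x. N #> x) ` Y \<subseteq> carrier (G Mod N)" using Y(2) by (auto simp: carrier_FactGroup)
  ultimately have R: "R \<le> card (carrier (G Mod N))"
    using card_inj_on_le[OF _ _ nN(3)] Y(3) by blast
  have "(damp G g Ws c ^^ k) (delta (i, \<one>)) (i, \<one>) =
      ((damp (G Mod N) (\<lambda>i. N #> g i) Ws c ^^ k) (delta (i, N)) (i, N) :: 'c)" if i: "i < n" for i
  proof -
    have "(damp G g Ws c ^^ k) (delta (i, \<one>)) (i, \<one>) =
        ((damp G g Ws c ^^ k) (\<lambda>e. delta (i, N) (fst e, N #> snd e)) (i, \<one>) :: 'c)"
    proof (rule F(3)[OF i], rule ballI)
      fix e assume e: "e \<in> F i"
      have ec: "snd e \<in> carrier G" using F(2)[OF i] e by auto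
      have "snd e \<in> X \<or> snd e = \<one>" using e i by (auto simp: X_def)
      then have "N #> snd e = N \<longleftrightarrow> snd e = \<one>"
        using rcos_eq_self_iff[OF nN(2) ec] N(2) subgroup.one_closed[OF nN(2)] by auto
      then show "delta (i, \<one>) e = (delta (i, N) (fst e, N #> snd e) :: 'c)"
        by (cases e) auto
    qed
    also have "\<dots> = (damp (G Mod N) (\<lambda>i. N #> g i) Ws c ^^ k) (delta (i, N)) (i, N #> \<one>)"
      using i by (intro m.damp_pow_map) auto
    finally show ?thesis using subgroup.subset[OF nN(2)] by simp
  qed
  then show ?thesis using N(1) R by blast
qed

lemma vn_dim_le_damp:
  assumes "c \<in> \<real>"
  shows "vn_dim G n (l2_homology1 G n g rs) \<le>
    (\<Sum>i<n. Re ((damp G g Ws c ^^ (2 * m)) (delta (i, \<one>)) (i, \<one>)))"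
  unfolding vn_dim_def Let_def l2_homology1_eq
  using assms by (intro sum_mono harmonic_proj_le) auto

text \<open>The quotient is chosen after the exponent, while the error \<open>\<epsilon> j\<close>
  does not depend on the quotient; therefore both limits can be taken along one sequence.\<close>

lemma vn_dim_le_infinite:
  assumes rf: "residually_finite G" and inf: "infinite (carrier G)"
    and S: "finite S" "S \<subseteq> carrier (profinite_completion G)"
    and dense: "top_generates S"
  shows "vn_dim G n (l2_homology1 G n g rs) \<le> real (card S) - 1"
proof -
  define K where "K = max 1 (lap_bound Ws)"
  have K: "K \<ge> 1" "lap_bound Ws \<le> K" by (auto simp: K_def)
  \<comment> \<open>The exponent \<open>2 * Suc j\<close> is even for \<open>vn_dim_le_damp\<close>
    and at least 2 for \<open>quotient_trace_bound\<close>.\<close>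
  define \<epsilon> where "\<epsilon> j = 2 * ln K / ln (real (2 * Suc j)) + exp (- sqrt (real (2 * Suc j)))" for j
  have bound: "vn_dim G n (l2_homology1 G n g rs) \<le> real (card S) - 1 + (1 / real (Suc j) + real n * \<epsilon> j)" for j
  proof -
    let ?k = "2 * Suc j"
    obtain N where N: "N \<in> finite_index_normal G" "Suc j \<le> card (carrier (G Mod N))"
      and eq: "\<And>i. i < n \<Longrightarrow> (damp G g Ws (of_real (1 / K)) ^^ ?k) (delta (i, \<one>)) (i, \<one>) =
      ((damp (G Mod N) (\<lambda>i. N #> g i) Ws (of_real (1 / K)) ^^ ?k) (delta (i, N)) (i, N) :: complex)"
      using exists_deep_quotient[OF rf inf, where R = "Suc j" and c = "of_real (1 / K)" and k = ?k] by blast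
    have "vn_dim G n (l2_homology1 G n g rs) \<le>
        (\<Sum>i<n. Re ((damp G g Ws (of_real (1 / K)) ^^ ?k) (delta (i, \<one>)) (i, \<one>)))"
      by (rule vn_dim_le_damp) simp
    also have "\<dots> = (\<Sum>i<n. Re ((damp (G Mod N) (\<lambda>i. N #> g i) Ws (of_real (1 / K)) ^^ ?k) (delta (i, N)) (i, N)))"
      using eq by (intro sum.cong) (simp_all del: funpow.simps)
    also have "\<dots> \<le> real (card S) - 1 + 1 / real (card (carrier (G Mod N))) + real n * \<epsilon> j"
      unfolding \<epsilon>_def by (rule quotient_trace_bound[OF N(1) S dense K]) simp
    also have "1 / real (card (carrier (G Mod N))) \<le> 1 / real (Suc j)"
      using N(2) by (intro divide_left_mono) auto
    finally show ?thesis by simp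
  qed
  have lim: "(\<lambda>j. 1 / ln (real (2 * Suc j))) \<longlonglongrightarrow> 0" "(\<lambda>j. exp (- sqrt (real (2 * Suc j)))) \<longlonglongrightarrow> 0"
    "(\<lambda>j. 1 / real (Suc j)) \<longlonglongrightarrow> 0"
    by real_asymp+
  have "\<epsilon> \<longlonglongrightarrow> 0"
    using tendsto_add[OF tendsto_mult_right_zero[OF lim(1), of "2 * ln K"] lim(2)]
    by (simp add: \<epsilon>_def[abs_def])
  then have "(\<lambda>j. real (card S) - 1 + (1 / real (Suc j) + real n * \<epsilon> j)) \<longlonglongrightarrow> real (card S) - 1"
    using tendsto_add[OF tendsto_const[of "real (card S) - 1"]
        tendsto_add[OF lim(3) tendsto_mult_right_zero[of \<epsilon> _ "real n"]]] by simp
  then show ?thesis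
    by (rule LIMSEQ_le_const) (use bound in auto)
qed

text \<open>The complex is simply connected: a closed 1-cochain is the coboundary of its integral
  along representative words, and a harmonic coboundary on a finite complex is 0.\<close>

lemma vn_dim_finite:
  assumes fin: "finite (carrier G)"
  shows "vn_dim G n (l2_homology1 G n g rs) = 0"
proof -
  have zero: "f e = 0" if f: "harmonic f" and e: "e \<in> edges" for f :: "nat \<times> 'a \<Rightarrow> complex" and e
  proof -
    define u where "u x = path_int G g f \<one> (rep_word x)" for x
    have coc: "cocycle_mod 0 f" using f by (simp add: cocycle_mod_def harmonic_iff)
    have "f (i, x) = cob u (i, x)" if i: "i < n" and x: "x \<in> carrier G" for i x
    proof -
      have w: "rep_word x @ [(i, True)] \<in> words n" "word_value G g (rep_word x @ [(i, True)]) = x \<otimes> g i"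
        using rep_word[OF x] i x by (simp_all add: words_append word_value_append letter_value_def)
      have xg: "x \<otimes> g i \<in> carrier G" using x i by simp
      have "presented_eq n (set rs) (rep_word x @ [(i, True)]) (rep_word (x \<otimes> g i))"
        using pres rep_word[OF xg] w unfolding finite_presentation_def by metis
      from presented_eq_path_int[OF this coc]
      have "path_int G g f \<one> (rep_word x @ [(i, True)]) = u (x \<otimes> g i)" by (simp add: u_def)
      then show ?thesis using rep_word[OF x] i x path_int_append[of \<one> "rep_word x" "[(i, True)]" f]
        by (simp add: u_def cob_def algebra_simps)
    qed
    then show ?thesis using harmonic_cob_zero[OF fin f, of u e] e by auto
  qed
  have "Re (l2_inner edges (l2_proj edges {f \<in> l2 edges. harmonic f} (delta (i, \<one>))) (delta (i, \<one>))) = 0" for i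
  proof -
    interpret V: l2_closed_subspace edges "{f \<in> l2 edges. harmonic f}" by (rule harmonic_subspace)
    let ?p = "l2_proj edges {f \<in> l2 edges. harmonic f} (delta (i, \<one>))"
    have "harmonic ?p" using V.l2_proj(1)[OF sq_summable_delta[of edges "(i, \<one>)"]] by blast
    then have "l2_inner edges ?p (delta (i, \<one>)) = l2_inner edges (\<lambda>_. 0) (delta (i, \<one>))"
      by (intro l2_inner_cong zero) auto
    then show ?thesis by simp
  qed
  then show ?thesis unfolding vn_dim_def Let_def l2_homology1_eq by simp
qed

end

text \<open>Without generators, \<open>dense_generators_subgroup\<close> with \<open>H = N\<close>
  forces a finite-index \<open>N\<close> that misses some \<open>x\<close> to be the whole group.
  For finite groups this is all of the bound.\<close>

lemma (in group) dense_generators_nonempty: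
  assumes rf: "residually_finite G" and nontriv: "\<not> trivial_group G"
    and dense: "top_generates S"
  shows "S \<noteq> {}"
proof
  assume "S = {}"
  obtain x where x: "x \<in> carrier G" "x \<noteq> \<one>"
    using nontriv is_group one_closed unfolding trivial_group_def by blast
  then obtain N where N: "N \<in> finite_index_normal G" "x \<notin> N"
    using rf by (auto simp: residually_finite_def)
  have "N = carrier G"
    using dense_generators_subgroup[OF _ dense N(1) finite_index_normalD(2)[OF N(1)]] \<open>S = {}\<close> by simp
  then show False using x N by simp
qed

theorem proposition2:
  fixes G :: "('a, 'b) monoid_scheme"
  assumes "group G"
    and "finitely_presented G"
    and "residually_finite G"
    and "\<not> trivial_group G"
  shows "ereal_of_enat (min_top_generators (profinite_completion G) (profinite_topology G))
           \<ge> ereal (first_l2_betti G + 1)"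
proof -
  interpret group G by fact
  have "\<exists>b n g rs. finite_presentation G n g rs \<and> b = vn_dim G n (l2_homology1 G n g rs)"
    using assms(2) by (auto simp: finitely_presented_def)
  from someI_ex[OF this] obtain n g rs where pres: "finite_presentation G n g rs"
    and betti: "first_l2_betti G = vn_dim G n (l2_homology1 G n g rs)"
    unfolding first_l2_betti_def by blast
  interpret presented_group G n g rs using pres by unfold_locales
  \<comment> \<open>A finite group has no quotients of unbounded order that would remove the term
    \<open>1 / card\<close>, so it is treated apart.\<close>
  have le: "first_l2_betti G + 1 \<le> real (card S)"
    if S: "finite S" "S \<subseteq> carrier (profinite_completion G)"
      "top_generates S" for S
  proof (cases "finite (carrier G)")
    case True
    have "S \<noteq> {}" by (rule dense_generators_nonempty[OF assms(3,4) S(3)])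
    then have "card S \<ge> 1" using S(1) by (simp add: Suc_le_eq card_gt_0_iff)
    then show ?thesis using vn_dim_finite[OF True] by (simp add: betti)
  next
    case False
    then show ?thesis using vn_dim_le_infinite[OF assms(3) False S] by (simp add: betti)
  qed
  define X where "X = {enat (card S) | S. finite S \<and> S \<subseteq> carrier (profinite_completion G) \<and>
      profinite_topology G closure_of (generate (profinite_completion G) S) = carrier (profinite_completion G)}"
  \<comment> \<open>If no finite set generates a dense subgroup, the infimum is infinite; otherwise
    it is attained, as \<open>enat\<close> is well-ordered.\<close>
  have "ereal (first_l2_betti G + 1) \<le> ereal_of_enat (Inf X)"
  proof (cases "X = {}")
    case True
    then show ?thesis by (simp add: top_enat_def)
  next
    case False
    then have "Inf X \<in> X" unfolding Inf_enat_def by (auto intro: LeastI)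
    then obtain S where S: "Inf X = enat (card S)" "finite S" "S \<subseteq> carrier (profinite_completion G)"
      "top_generates S"
      unfolding X_def mem_Collect_eq by (elim exE conjE)
    then show ?thesis using le[OF S(2,3,4)] by simp
  qed
  then show ?thesis by (simp add: min_top_generators_def X_def)
qed

end
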